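(* Let $(M,a,b,g)$ be the data of an $N$-dimensional Finsleroid--Finsler space ($N\ge 2$) with Finsleroid--Finsler metric function $K(x,y)$, where $a_{ij}(x)$ is a Riemannian metric, $b=b_i(x)y^i$ is a 1-form of unit Riemannian length, and $g=g(x)$ is the Finsleroid charge, with $-2<g(x)<2$ and $g(x)\neq 0$. Assume that the space is involutive, i.e. there is a scalar function $\mu=\mu(x)$ on $M$ such that $$\frac{\partial g}{\partial x^i}=\mu(x)\, b_i(x),$$ and that it is $b$-parallel, i.e. $\nabla_i b_j=0$, where $\nabla$ is the Levi-Civita covariant derivative of $a_{ij}$. Then the $A$-special relation holds: there is a scalar $\eta=\eta(x,y)$ such that $$A_{i|k}=\frac1g\, g_k\, A_i+\eta\,\mathcal{H}_{ik},\qquad g_k=\frac{\partial g}{\partial x^k}.$$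
   Context: Finsleroid--Finsler space. Let $M$ be an $N$-dimensional $C^\infty$ manifold ($N\ge2$) with a positive-definite Riemannian metric $a_{ij}(x)$ and a non-vanishing 1-form $b=b_i(x)y^i$ with $a^{ij}b_ib_j=1$. For a nonzero tangent vector $y$ put $S=\sqrt{a_{ij}(x)y^iy^j}$ and $q=\sqrt{S^2-b^2}$. Let $g=g(x)$ be a scalar function with $-2<g(x)<2$ (the Finsleroid charge), and put $$h=\sqrt{1-\tfrac14 g^2},\quad G=\frac gh,\quad B=b^2+gbq+q^2,\quad L=q+\frac g2 b,$$ $$K(x,y)=\sqrt{B}\;e^{-\frac12 G f},\qquad f=-\arctan\frac G2+\arctan\frac{L}{hb}\ \text{ if } b\ge0,\qquad f=\pi-\arctan\frac G2+\arctan\frac{L}{hb}\ \text{ if } b\le0$$ (at $b=0$, $f=\frac{\pi}{2}-\arctan\frac G2$). $K$ is the Finsleroid--Finsler metric function. All tensors are considered at $y$ with $q>0$. Finslerian objects. $g_{ij}=\frac12\frac{\partial^2K^2}{\partial y^i\partial y^j}$ is the Finslerian metric tensor, $g^{ij}$ its inverse (used for raising indices of Finslerian tensors), $l^i=y^i/K$, $l_i=g_{ij}l^j$, $h_{ij}=g_{ij}-l_il_j$, $A_{ijk}=\frac K2\frac{\partial g_{ij}}{\partial y^k}$ (Cartan tensor), $A_k=g^{ij}A_{ijk}$, and $$\mathcal{H}_{ij}=h_{ij}-\frac{A_iA_j}{A_nA^n}.$$ ($g$ without indices and $g_k$ with one index refer to the Finsleroid charge and its gradient.) Connection. $\gamma^k{}_{ij}=\frac12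 g^{kn}\left(\frac{\partial g_{ni}}{\partial x^j}+\frac{\partial g_{nj}}{\partial x^i}-\frac{\partial g_{ji}}{\partial x^n}\right)$, $\ 2\bar G^k=\gamma^k{}_{ij}y^iy^j$, $\ \bar G^k{}_j=\partial\bar G^k/\partial y^j$, $\ \bar G^{kn}=\bar G^k{}_m g^{mn}$, $\ C_{nij}=A_{nij}/K$, $\ C_n{}^k{}_j=g^{km}C_{nmj}$, $$\Gamma^k{}_{ij}=\gamma^k{}_{ij}-\bar G^n{}_i C_n{}^k{}_j-\bar G^n{}_jC_n{}^k{}_i+\bar G^{kn}C_{nij}.$$ The $h$-covariant derivative of a covector is $$A_{i|j}=\frac{\partial A_i}{\partial x^j}-\bar G^k{}_j\frac{\partial A_i}{\partial y^k}-\Gamma^k{}_{ij}A_k.$$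
   Formalization: In the connection Γ^k_ij, the term Ḡ^{kn}C_nij is read with Ḡ^{kn} = g^{km}Ḡ^n_m instead of Ḡ^k_m g^{mn}, the standard Cartan order; with the printed order the relation fails for N ≥ 3, already for constant g on flat space in curvilinear coordinates. *)

theory Defs
  imports "HOL-Analysis.Analysis"
begin

section \<open>Partial derivatives and smoothness in coordinates\<close>

definition pd :: "'n::finite \<Rightarrow> (real^'n \<Rightarrow> real) \<Rightarrow> real^'n \<Rightarrow> real" where
  "pd i f x = deriv (\<lambda>t. f (x + t *\<^sub>R axis i 1)) 0"

text \<open>Only meant for open \<open>S\<close>.\<close>

primrec Ck_on :: "nat \<Rightarrow> (real^'n::finite) set \<Rightarrow> (real^'n \<Rightarrow> real) \<Rightarrow> bool" where
  "Ck_on 0 S f \<longleftrightarrow> continuous_on S f"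
| "Ck_on (Suc k) S f \<longleftrightarrow> f differentiable_on S \<and> (\<forall>i. Ck_on k S (pd i f))"

definition Cinf_on :: "(real^'n::finite) set \<Rightarrow> (real^'n \<Rightarrow> real) \<Rightarrow> bool" where
  "Cinf_on S f \<longleftrightarrow> (\<forall>k. Ck_on k S f)"


section \<open>Smooth manifolds and tensor fields\<close>

text \<open>
  The manifold is the whole type \<open>'m\<close>, its dimension is \<open>CARD('n)\<close>. A chart is a pair of a
  domain and a coordinate map; the values of the map outside the domain are irrelevant.
  Tensor fields are families of components, one for each chart of the atlas, that satisfy
  the classical transformation law. Components in a chart \<open>c\<close> are functions of the
  coordinates \<open>x \<in> img c\<close>.
\<close>

type_synonym ('m, 'n) chart = "'m set \<times> ('m \<Rightarrow> real^'n)"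

definition img :: "('m, 'n) chart \<Rightarrow> (real^'n) set" where
  "img c = snd c ` fst c"

definition pt :: "('m, 'n) chart \<Rightarrow> real^'n \<Rightarrow> 'm" where
  "pt c = inv_into (fst c) (snd c)"

definition overlap :: "('m, 'n) chart \<Rightarrow> ('m, 'n) chart \<Rightarrow> (real^'n) set" where
  "overlap c d = snd c ` (fst c \<inter> fst d)"

definition trans_map :: "('m, 'n) chart \<Rightarrow> ('m, 'n) chart \<Rightarrow> real^'n \<Rightarrow> real^'n" where
  "trans_map c d x = snd d (pt c x)"

definition trans_jac :: "('m, 'n::finite) chart \<Rightarrow> ('m, 'n) chart \<Rightarrow> real^'n \<Rightarrow> real^'n^'n" where
  "trans_jac c d x = (\<chi> i j. pd j (\<lambda>x. trans_map c d x $ i) x)"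

definition smooth_atlas ::
  "('m::{t2_space,second_countable_topology}, 'n::finite) chart set \<Rightarrow> bool" where
  "smooth_atlas \<A> \<longleftrightarrow>
     (\<Union>c\<in>\<A>. fst c) = UNIV \<and>
     (\<forall>c\<in>\<A>. open (fst c) \<and> open (img c) \<and> homeomorphism (fst c) (img c) (snd c) (pt c)) \<and>
     (\<forall>c\<in>\<A>. \<forall>d\<in>\<A>. \<forall>i. Cinf_on (overlap c d) (\<lambda>x. trans_map c d x $ i))"

definition smooth_scalar :: "('m, 'n::finite) chart set \<Rightarrow> ('m \<Rightarrow> real) \<Rightarrow> bool" where
  "smooth_scalar \<A> s \<longleftrightarrow> (\<forall>c\<in>\<A>. Cinf_on (img c) (s \<circ> pt c))"

definition smooth_covector ::
  "('m, 'n::finite) chart set \<Rightarrow> (('m, 'n) chart \<Rightarrow> real^'n \<Rightarrow> real^'n) \<Rightarrow> bool" where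
  "smooth_covector \<A> w \<longleftrightarrow>
     (\<forall>c\<in>\<A>. \<forall>i. Cinf_on (img c) (\<lambda>x. w c x $ i)) \<and>
     (\<forall>c\<in>\<A>. \<forall>d\<in>\<A>. \<forall>x\<in>overlap c d. \<forall>i.
        w c x $ i = (\<Sum>k\<in>UNIV. w d (trans_map c d x) $ k * trans_jac c d x $ k $ i))"

definition riemannian_metric ::
  "('m, 'n::finite) chart set \<Rightarrow> (('m, 'n) chart \<Rightarrow> real^'n \<Rightarrow> real^'n^'n) \<Rightarrow> bool" where
  "riemannian_metric \<A> a \<longleftrightarrow>
     (\<forall>c\<in>\<A>. \<forall>i j. Cinf_on (img c) (\<lambda>x. a c x $ i $ j)) \<and>
     (\<forall>c\<in>\<A>. \<forall>d\<in>\<A>. \<forall>x\<in>overlap c d. \<forall>i j.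
        a c x $ i $ j = (\<Sum>k\<in>UNIV. \<Sum>l\<in>UNIV. a d (trans_map c d x) $ k $ l
                            * trans_jac c d x $ k $ i * trans_jac c d x $ l $ j)) \<and>
     (\<forall>c\<in>\<A>. \<forall>x\<in>img c. (\<forall>i j. a c x $ i $ j = a c x $ j $ i) \<and>
        (\<forall>y. y \<noteq> 0 \<longrightarrow> 0 < (\<Sum>i\<in>UNIV. \<Sum>j\<in>UNIV. a c x $ i $ j * y $ i * y $ j)))"

text \<open>\<open>a\<^sup>i\<^sup>jb\<^sub>ib\<^sub>j = 1\<close>\<close>

definition unit_covector ::
  "('m, 'n::finite) chart set \<Rightarrow> (('m, 'n) chart \<Rightarrow> real^'n \<Rightarrow> real^'n^'n)
     \<Rightarrow> (('m, 'n) chart \<Rightarrow> real^'n \<Rightarrow> real^'n) \<Rightarrow> bool" where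
  "unit_covector \<A> a b \<longleftrightarrow> (\<forall>c\<in>\<A>. \<forall>x\<in>img c.
     (\<Sum>i\<in>UNIV. \<Sum>j\<in>UNIV. matrix_inv (a c x) $ i $ j * b c x $ i * b c x $ j) = 1)"

definition christoffel ::
  "(real^'n::finite \<Rightarrow> real^'n^'n) \<Rightarrow> 'n \<Rightarrow> 'n \<Rightarrow> 'n \<Rightarrow> real^'n \<Rightarrow> real" where
  "christoffel a k i j x = 1/2 * (\<Sum>n\<in>UNIV. matrix_inv (a x) $ k $ n *
     (pd j (\<lambda>x. a x $ n $ i) x + pd i (\<lambda>x. a x $ n $ j) x - pd n (\<lambda>x. a x $ j $ i) x))"

definition levi_civita ::
  "(real^'n::finite \<Rightarrow> real^'n^'n) \<Rightarrow> (real^'n \<Rightarrow> real^'n) \<Rightarrow> 'n \<Rightarrow> 'n \<Rightarrow> real^'n \<Rightarrow> real" where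
  "levi_civita a w i j x = pd i (\<lambda>x. w x $ j) x - (\<Sum>k\<in>UNIV. christoffel a k i j x * w x $ k)"

definition b_parallel ::
  "('m, 'n::finite) chart set \<Rightarrow> (('m, 'n) chart \<Rightarrow> real^'n \<Rightarrow> real^'n^'n)
     \<Rightarrow> (('m, 'n) chart \<Rightarrow> real^'n \<Rightarrow> real^'n) \<Rightarrow> bool" where
  "b_parallel \<A> a b \<longleftrightarrow> (\<forall>c\<in>\<A>. \<forall>x\<in>img c. \<forall>i j. levi_civita (a c) (b c) i j x = 0)"

definition involutive ::
  "('m, 'n::finite) chart set \<Rightarrow> (('m, 'n) chart \<Rightarrow> real^'n \<Rightarrow> real^'n) \<Rightarrow> ('m \<Rightarrow> real) \<Rightarrow> bool" where
  "involutive \<A> b g \<longleftrightarrow> (\<exists>\<mu> :: 'm \<Rightarrow> real. \<forall>c\<in>\<A>. \<forall>x\<in>img c. \<forall>i.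
     pd i (g \<circ> pt c) x = \<mu> (pt c x) * b c x $ i)"


section \<open>The Finsleroid metric function\<close>

text \<open>
  Pointwise: \<open>a\<close>, \<open>b\<close>, \<open>g\<close> are the values at one point (in one chart), and \<open>y\<close> a tangent
  vector.
\<close>

definition b_form :: "real^'n::finite \<Rightarrow> real^'n \<Rightarrow> real" where
  "b_form b y = (\<Sum>i\<in>UNIV. b $ i * y $ i)"

definition S_norm :: "real^'n::finite^'n \<Rightarrow> real^'n \<Rightarrow> real" where
  "S_norm a y = sqrt (\<Sum>i\<in>UNIV. \<Sum>j\<in>UNIV. a $ i $ j * y $ i * y $ j)"

definition q_norm :: "real^'n::finite^'n \<Rightarrow> real^'n \<Rightarrow> real^'n \<Rightarrow> real" where
  "q_norm a b y = sqrt ((S_norm a y)\<^sup>2 - (b_form b y)\<^sup>2)"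

definition h_of :: "real \<Rightarrow> real" where
  "h_of g = sqrt (1 - g\<^sup>2 / 4)"

definition G_of :: "real \<Rightarrow> real" where
  "G_of g = g / h_of g"

text \<open>
  \<open>u\<close> and \<open>q\<close> stand for the numbers \<open>b(y)\<close> and \<open>q(y)\<close>. Since \<open>L / 0 = 0\<close> in HOL, the
  common value of both branches at \<open>b = 0\<close> has to be given separately.
\<close>

definition f_fun :: "real \<Rightarrow> real \<Rightarrow> real \<Rightarrow> real" where
  "f_fun g u q =
     (let G = G_of g; L = q + g / 2 * u in
      if u > 0 then - arctan (G / 2) + arctan (L / (h_of g * u))
      else if u < 0 then pi - arctan (G / 2) + arctan (L / (h_of g * u))
      else pi / 2 - arctan (G / 2))"

definition B_fun :: "real \<Rightarrow> real \<Rightarrow> real \<Rightarrow> real" where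
  "B_fun g u q = u\<^sup>2 + g * u * q + q\<^sup>2"

definition finsleroid_K :: "real^'n::finite^'n \<Rightarrow> real^'n \<Rightarrow> real \<Rightarrow> real^'n \<Rightarrow> real" where
  "finsleroid_K a b g y =
     (let u = b_form b y; q = q_norm a b y in
      sqrt (B_fun g u q) * exp (- (1/2) * G_of g * f_fun g u q))"


section \<open>Objects of a Finsler metric function in a chart\<close>

text \<open>
  Indexed objects take their indices first and then the arguments \<open>x\<close> (position) and \<open>y\<close>
  (tangent vector); upper indices come before lower ones.
\<close>

type_synonym 'n fscalar = "real^'n \<Rightarrow> real^'n \<Rightarrow> real"

definition dx :: "'n::finite \<Rightarrow> 'n fscalar \<Rightarrow> 'n fscalar" where
  "dx i F x y = pd i (\<lambda>x. F x y) x"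

definition dy :: "'n::finite \<Rightarrow> 'n fscalar \<Rightarrow> 'n fscalar" where
  "dy i F x y = pd i (\<lambda>y. F x y) y"

definition g_low :: "'n::finite fscalar \<Rightarrow> 'n \<Rightarrow> 'n \<Rightarrow> 'n fscalar" where
  "g_low K i j x y = 1/2 * dy i (dy j (\<lambda>x y. (K x y)\<^sup>2)) x y"

definition g_up :: "'n::finite fscalar \<Rightarrow> 'n \<Rightarrow> 'n \<Rightarrow> 'n fscalar" where
  "g_up K i j x y = matrix_inv (\<chi> i j. g_low K i j x y) $ i $ j"

definition l_up :: "'n::finite fscalar \<Rightarrow> 'n \<Rightarrow> 'n fscalar" where
  "l_up K i x y = y $ i / K x y"

definition l_low :: "'n::finite fscalar \<Rightarrow> 'n \<Rightarrow> 'n fscalar" where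
  "l_low K i x y = (\<Sum>j\<in>UNIV. g_low K i j x y * l_up K j x y)"

definition h_ang :: "'n::finite fscalar \<Rightarrow> 'n \<Rightarrow> 'n \<Rightarrow> 'n fscalar" where
  "h_ang K i j x y = g_low K i j x y - l_low K i x y * l_low K j x y"

definition cartan :: "'n::finite fscalar \<Rightarrow> 'n \<Rightarrow> 'n \<Rightarrow> 'n \<Rightarrow> 'n fscalar" where
  "cartan K i j k x y = K x y / 2 * dy k (g_low K i j) x y"

definition A_low :: "'n::finite fscalar \<Rightarrow> 'n \<Rightarrow> 'n fscalar" where
  "A_low K k x y = (\<Sum>i\<in>UNIV. \<Sum>j\<in>UNIV. g_up K i j x y * cartan K i j k x y)"

definition A_up :: "'n::finite fscalar \<Rightarrow> 'n \<Rightarrow> 'n fscalar" where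
  "A_up K n x y = (\<Sum>k\<in>UNIV. g_up K n k x y * A_low K k x y)"

definition H_cal :: "'n::finite fscalar \<Rightarrow> 'n \<Rightarrow> 'n \<Rightarrow> 'n fscalar" where
  "H_cal K i j x y = h_ang K i j x y
     - A_low K i x y * A_low K j x y / (\<Sum>n\<in>UNIV. A_low K n x y * A_up K n x y)"

definition gamma_F :: "'n::finite fscalar \<Rightarrow> 'n \<Rightarrow> 'n \<Rightarrow> 'n \<Rightarrow> 'n fscalar" where
  "gamma_F K k i j x y = 1/2 * (\<Sum>n\<in>UNIV. g_up K k n x y *
     (dx j (g_low K n i) x y + dx i (g_low K n j) x y - dx n (g_low K j i) x y))"

definition spray :: "'n::finite fscalar \<Rightarrow> 'n \<Rightarrow> 'n fscalar" where
  "spray K k x y = 1/2 * (\<Sum>i\<in>UNIV. \<Sum>j\<in>UNIV. gamma_F K k i j x y * y $ i * y $ j)"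

text \<open>\<open>G_bar K k j\<close> is the nonlinear connection \<open>\<partial>G\<^sup>k/\<partial>y\<^sup>j\<close>.\<close>

definition G_bar :: "'n::finite fscalar \<Rightarrow> 'n \<Rightarrow> 'n \<Rightarrow> 'n fscalar" where
  "G_bar K k j x y = dy j (spray K k) x y"

text \<open>
  \<open>G_bar\<^sup>k\<^sup>n\<close>: the index \<open>k\<close> is the raised lower index and \<open>n\<close> the original upper index
  of \<open>G_bar\<close>, i.e. it is \<open>g\<^sup>k\<^sup>m G_bar\<^sup>n\<^sub>m\<close>. The order matters, as \<open>G_bar\<^sup>k\<^sup>n\<close> is not
  symmetric: this is the order for which \<open>Gamma_F\<close> below is the h-metrical (Cartan)
  connection, obtained from \<open>gamma_F\<close> by replacing \<open>\<partial>/\<partial>x\<^sup>j\<close> with the horizontal derivative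
  \<open>\<partial>/\<partial>x\<^sup>j - G_bar\<^sup>n\<^sub>j \<partial>/\<partial>y\<^sup>n\<close>. With the opposite order
  \<open>G_bar\<^sup>k\<^sub>m g\<^sup>m\<^sup>n\<close>, \<open>Gamma_F\<close> would not transform as a connection.
\<close>

definition G_bar_up :: "'n::finite fscalar \<Rightarrow> 'n \<Rightarrow> 'n \<Rightarrow> 'n fscalar" where
  "G_bar_up K k n x y = (\<Sum>m\<in>UNIV. g_up K k m x y * G_bar K n m x y)"

definition C_low :: "'n::finite fscalar \<Rightarrow> 'n \<Rightarrow> 'n \<Rightarrow> 'n \<Rightarrow> 'n fscalar" where
  "C_low K n i j x y = cartan K n i j x y / K x y"

text \<open>\<open>C_mix K k n j\<close> is \<open>C\<^sub>n\<^sup>k\<^sub>j\<close>.\<close>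

definition C_mix :: "'n::finite fscalar \<Rightarrow> 'n \<Rightarrow> 'n \<Rightarrow> 'n \<Rightarrow> 'n fscalar" where
  "C_mix K k n j x y = (\<Sum>m\<in>UNIV. g_up K k m x y * C_low K n m j x y)"

definition Gamma_F :: "'n::finite fscalar \<Rightarrow> 'n \<Rightarrow> 'n \<Rightarrow> 'n \<Rightarrow> 'n fscalar" where
  "Gamma_F K k i j x y = gamma_F K k i j x y
     - (\<Sum>n\<in>UNIV. G_bar K n i x y * C_mix K k n j x y)
     - (\<Sum>n\<in>UNIV. G_bar K n j x y * C_mix K k n i x y)
     + (\<Sum>n\<in>UNIV. G_bar_up K k n x y * C_low K n i j x y)"

text \<open>\<open>h_cov K W i j\<close> is \<open>W\<^sub>i\<^sub>|\<^sub>j\<close>.\<close>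

definition h_cov :: "'n::finite fscalar \<Rightarrow> ('n \<Rightarrow> 'n fscalar) \<Rightarrow> 'n \<Rightarrow> 'n \<Rightarrow> 'n fscalar" where
  "h_cov K W i j x y = dx j (W i) x y
     - (\<Sum>k\<in>UNIV. G_bar K k j x y * dy k (W i) x y)
     - (\<Sum>k\<in>UNIV. Gamma_F K k i j x y * W k x y)"


section \<open>The Finsleroid--Finsler space\<close>

definition finsleroid_space ::
  "('m::{t2_space,second_countable_topology}, 'n::finite) chart set
     \<Rightarrow> (('m, 'n) chart \<Rightarrow> real^'n \<Rightarrow> real^'n^'n)
     \<Rightarrow> (('m, 'n) chart \<Rightarrow> real^'n \<Rightarrow> real^'n) \<Rightarrow> ('m \<Rightarrow> real) \<Rightarrow> bool" where
  "finsleroid_space \<A> a b g \<longleftrightarrow>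
     2 \<le> CARD('n) \<and> smooth_atlas \<A> \<and> riemannian_metric \<A> a \<and>
     smooth_covector \<A> b \<and> unit_covector \<A> a b \<and>
     smooth_scalar \<A> g \<and> (\<forall>p. -2 < g p \<and> g p < 2)"

definition K_chart ::
  "(('m, 'n::finite) chart \<Rightarrow> real^'n \<Rightarrow> real^'n^'n) \<Rightarrow> (('m, 'n) chart \<Rightarrow> real^'n \<Rightarrow> real^'n)
     \<Rightarrow> ('m \<Rightarrow> real) \<Rightarrow> ('m, 'n) chart \<Rightarrow> 'n fscalar" where
  "K_chart a b g c x y = finsleroid_K (a c x) (b c x) (g (pt c x)) y"

text \<open>
  A scalar on the part \<open>q > 0\<close> of the tangent bundle: a family of functions of \<open>(x,y)\<close>, one
  for each chart, that is invariant under changes of charts.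
\<close>

definition tangent_scalar ::
  "('m, 'n::finite) chart set \<Rightarrow> (('m, 'n) chart \<Rightarrow> real^'n \<Rightarrow> real^'n^'n)
     \<Rightarrow> (('m, 'n) chart \<Rightarrow> real^'n \<Rightarrow> real^'n) \<Rightarrow> (('m, 'n) chart \<Rightarrow> 'n fscalar) \<Rightarrow> bool" where
  "tangent_scalar \<A> a b \<eta> \<longleftrightarrow>
     (\<forall>c\<in>\<A>. \<forall>d\<in>\<A>. \<forall>x\<in>overlap c d. \<forall>y. q_norm (a c x) (b c x) y > 0 \<longrightarrow>
        \<eta> c x y = \<eta> d (trans_map c d x) (trans_jac c d x *v y))"

end

theory Submission
  imports Defs
begin

text \<open>In the coframe \<open>b\<close>, \<open>w\<^sub>i = \<partial>q/\<partial>y\<^sup>i\<close>, which is orthonormal for \<open>a\<close>, put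
  \<open>r = a - b \<otimes> b - w \<otimes> w\<close> and \<open>p = q b - u w\<close>. Every Finslerian object is built from
  \<open>b\<close>, \<open>w\<close>, \<open>r\<close> with coefficients depending on \<open>g\<close>, \<open>u\<close>, \<open>q\<close> only: \<open>K\<^sup>2 = B J\<close> with
  \<open>J = exp (- G f)\<close>, \<open>g\<^sub>i\<^sub>j = y\<^sub>iy\<^sub>j/K\<^sup>2 + (J/B) p\<^sub>ip\<^sub>j + J r\<^sub>i\<^sub>j\<close>, the Cartan vector \<open>A\<close> is a multiple of \<open>p\<close> of
  \<open>g\<close>-length \<open>N \<bar>g\<bar> / 2\<close>, and \<open>H_cal = J r\<close>. Since \<open>b\<close> is parallel, an \<open>x\<close>-derivative is a Christoffel
  term plus a \<open>y\<close>-derivative plus \<open>\<mu> b\<^sub>j \<partial>/\<partial>g\<close>, so that the spray is the Riemannian one up to a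
  combination of \<open>y\<close> and \<open>b\<close>. The Christoffel terms cancel in \<open>A\<^sub>i\<^sub>|\<^sub>j\<close>; besides the change of the length
  of \<open>A\<close>, which gives \<open>g\<^sub>j A\<^sub>i / g\<close>, only a multiple of \<open>r\<^sub>i\<^sub>j\<close> survives, and its coefficient \<open>\<eta>\<close> is a
  function of \<open>g\<close>, \<open>u\<close>, \<open>q\<close>, \<open>\<mu>\<close>.\<close>


section \<open>Scalar coefficients\<close>

text \<open>That only a multiple of \<open>r\<close> survives has a structural reason. The
  connection is metrical and keeps \<open>y\<close> parallel, so \<open>y^i A_i|j = 0\<close>, and
  \<open>A^i A_i|j\<close> is half the gradient of \<open>A_i A^i = N^2 g^2 / 4\<close>. Hence
  \<open>A_i|j - g_j A_i / g\<close> is annihilated in the index \<open>i\<close> by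
  \<open>y\<close> and by the raised \<open>A\<close>, which together span the plane of
  \<open>bu\<close> and \<open>wu\<close>; a tensor built from \<open>b\<close>, \<open>w\<close>,
  \<open>r\<close> with this property is a multiple of \<open>r\<close>. Metricity is not set up
  here: the same vanishing is found by comparing the coefficients of \<open>b_i b_j\<close>,
  \<open>b_i w_j\<close>, \<open>w_i b_j\<close>, \<open>w_i w_j\<close>, which also delivers
  \<eta>. The obstacle is the amount of calculus. The coefficients of the metric and of
  \<open>A\<close> are therefore differentiated once, along an arbitrary curve of values
  \<open>(g, u, q)\<close>, and the derivatives in \<open>x\<close> and in \<open>y\<close> are
  instances. Inside scalars the Christoffel symbols act like a variation of \<open>y\<close>, so no
  normal coordinates are chosen. The connection coefficients are not computed in full, only
  contracted with \<open>p\<close>, the direction of \<open>A\<close>.\<close>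

definition J_fun :: "real \<Rightarrow> real \<Rightarrow> real \<Rightarrow> real" where
  "J_fun g u q = exp (- G_of g * (pi / 2 - arctan ((u / q + g / 2) / h_of g)))"

text \<open>The logarithmic derivative of \<open>J_fun\<close> in the charge at fixed
  \<open>u\<close>, \<open>q\<close>. The last term comes from
  \<open>dG/dg = 1 / h^3\<close>.\<close>

definition Lam :: "real \<Rightarrow> real \<Rightarrow> real \<Rightarrow> real" where
  "Lam g u q = g * q * (2 * q + g * u) / (4 * (h_of g)\<^sup>2 * B_fun g u q)
     - (pi / 2 - arctan ((u / q + g / 2) / h_of g)) / (h_of g) ^ 3"

lemma charge_sq_less: "\<bar>g\<bar> < 2 \<Longrightarrow> g\<^sup>2 < 4" for g :: real
  using abs_square_less_1[of "g / 2"] by (simp add: power_divide)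

lemma h_of_pos: "\<bar>g\<bar> < 2 \<Longrightarrow> 0 < h_of g"
  using charge_sq_less by (simp add: h_of_def)

lemma h_of_sq: "\<bar>g\<bar> < 2 \<Longrightarrow> (h_of g)\<^sup>2 = 1 - g\<^sup>2 / 4"
  using charge_sq_less[of g] by (simp add: h_of_def)

text \<open>Thus \<open>B\<close> is the squared length of the plane vector
  \<open>(u + g q / 2, h q)\<close>, and for \<open>q > 0\<close> the function \<open>f\<close> is
  its polar angle; in these coordinates \<open>K = 1\<close> is an arc of a logarithmic
  spiral.\<close>

lemma B_fun_alt: "\<bar>g\<bar> < 2 \<Longrightarrow> B_fun g u q = (u + g / 2 * q)\<^sup>2 + (h_of g)\<^sup>2 * q\<^sup>2"
  by (simp only: power_mult_distrib h_of_sq B_fun_def) (simp add: power2_eq_square algebra_simps)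

lemma B_fun_pos:
  assumes "\<bar>g\<bar> < 2" "0 < q"
  shows "0 < B_fun g u q"
  unfolding B_fun_alt[OF assms(1)] using h_of_pos[OF assms(1)] assms(2)
  by (intro add_nonneg_pos) auto

text \<open>For \<open>q > 0\<close> the two branches of \<open>f\<close> are one smooth function, also across \<open>u = 0\<close>.\<close>

lemma f_fun_eq:
  assumes g: "\<bar>g\<bar> < 2" and q: "0 < q"
  shows "f_fun g u q = pi / 2 - arctan ((u / q + g / 2) / h_of g)"
proof -
  define h where "h = h_of g"
  have h: "0 < h" "h\<^sup>2 = 1 - g\<^sup>2 / 4"
    using h_of_pos[OF g] h_of_sq[OF g] by (auto simp: h_def)
  \<comment> \<open>\<alpha> is the value of \<phi> at \<open>u = 0\<close>, so
    \<open>\<phi> - \<alpha>\<close> has the sign of \<open>u\<close>, which selects the branch of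
    \<open>f_fun\<close>.\<close>
  define \<alpha> where "\<alpha> = arctan (g / (2 * h))"
  define \<phi> where "\<phi> = arctan ((u / q + g / 2) / h)"
  have G2: "G_of g / 2 = g / (2 * h)" by (simp add: G_of_def h_def)
  have range: "- pi / 2 < \<alpha>" "\<alpha> < pi / 2" "- pi / 2 < \<phi>" "\<phi> < pi / 2"
    using arctan_bounded by (auto simp: \<alpha>_def \<phi>_def)
  have tan: "tan \<alpha> = g / (2 * h)" "tan \<phi> = (u / q + g / 2) / h"
    by (auto simp: \<alpha>_def \<phi>_def tan_arctan)
  have cos0: "cos \<alpha> > 0" "cos \<phi> > 0"
    using range by (auto intro!: cos_gt_zero_pi)
  have less: "\<alpha> < \<phi> \<longleftrightarrow> 0 < u" "\<phi> < \<alpha> \<longleftrightarrow> u < 0"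
    using h(1) q unfolding \<alpha>_def \<phi>_def arctan_less_iff
    by (auto simp: field_simps zero_less_mult_iff mult_less_0_iff)
  have s: "sin \<alpha> = g / (2 * h) * cos \<alpha>" "sin \<phi> = (u / q + g / 2) / h * cos \<phi>"
    using tan cos0 by (simp_all add: tan_def field_simps)
  \<comment> \<open>The arctangent in \<open>f_fun\<close> is taken of the cotangent of
    \<open>\<phi> - \<alpha>\<close>. The angle \<open>pi / 2 + \<alpha> - \<phi>\<close> is in the
    principal range for \<open>u > 0\<close>; for \<open>u < 0\<close> it has to be lowered by
    \<open>pi\<close>, which absorbs the \<open>pi\<close> of that branch.\<close>
  have key: "tan (pi / 2 + \<alpha> - \<phi>) = (q + g / 2 * u) / (h * u)" if "u \<noteq> 0"
  proof -
    have sd: "sin (\<phi> - \<alpha>) = u / (q * h) * (cos \<phi> * cos \<alpha>)"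
      unfolding sin_diff s using h(1) q by (simp add: field_simps)
    have "cos (\<phi> - \<alpha>) * h\<^sup>2 = cos \<phi> * cos \<alpha> * (h\<^sup>2 + (u / q + g / 2) * (g / 2))"
      unfolding cos_diff s using h(1) by (simp add: field_simps power2_eq_square)
    also have "\<dots> = cos \<phi> * cos \<alpha> * ((q + g / 2 * u) / q)"
      unfolding h(2) using q by (simp add: field_simps power2_eq_square)
    finally have cd: "cos (\<phi> - \<alpha>) = cos \<phi> * cos \<alpha> * ((q + g / 2 * u) / q) / h\<^sup>2"
      using h(1) by (simp only: eq_divide_eq) simp
    have "tan (pi / 2 + \<alpha> - \<phi>) = cos (\<phi> - \<alpha>) / sin (\<phi> - \<alpha>)"
      using sin_cos_eq[of "\<phi> - \<alpha>"] cos_sin_eq[of "\<phi> - \<alpha>"]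
      by (simp add: tan_def algebra_simps)
    then show ?thesis
      unfolding sd cd using that q h(1) cos0 by (simp add: divide_simps power2_eq_square)
  qed
  have Lf: "L / (h_of g * u) = L / (h * u)" for L by (simp add: h_def)
  consider "u > 0" | "u < 0" | "u = 0" by linarith
  then show ?thesis
  proof cases
    case 1
    have "arctan ((q + g / 2 * u) / (h * u)) = pi / 2 + \<alpha> - \<phi>"
      using key 1 less range by (intro arctan_unique) auto
    with 1 show ?thesis
      by (simp add: f_fun_def Let_def G2 Lf flip: \<alpha>_def h_def \<phi>_def)
  next
    case 2
    have "tan (pi / 2 + \<alpha> - \<phi> - pi) = (q + g / 2 * u) / (h * u)"
      using key 2 tan_periodic_pi[of "pi / 2 + \<alpha> - \<phi> - pi"] by (simp only: diff_add_cancel)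
    then have "arctan ((q + g / 2 * u) / (h * u)) = pi / 2 + \<alpha> - \<phi> - pi"
      using 2 less range by (intro arctan_unique) auto
    with 2 show ?thesis
      by (simp add: f_fun_def Let_def G2 Lf flip: \<alpha>_def h_def \<phi>_def)
  next
    case 3
    then show ?thesis
      by (simp add: f_fun_def Let_def G_of_def mult.commute)
  qed
qed

lemma h_of_deriv:
  assumes "(\<gamma> has_real_derivative \<gamma>') (at t)" "\<bar>\<gamma> t\<bar> < 2"
  shows "((\<lambda>t. h_of (\<gamma> t)) has_real_derivative - \<gamma> t * \<gamma>' / (4 * h_of (\<gamma> t))) (at t)"
proof -
  have "0 < 1 - (\<gamma> t)\<^sup>2 / 4" using charge_sq_less[OF assms(2)] by simp
  then show ?thesis
    unfolding h_of_def
    by (auto intro!: derivative_eq_intros assms(1) simp: field_simps)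
qed

text \<open>Along a curve, so that a constant \<gamma> gives the \<open>y\<close>-derivatives and a
  varying one the \<open>x\<close>-derivatives. Since only the ratio \<open>u / q\<close> enters,
  \<open>u'\<close> and \<open>q'\<close> occur solely in \<open>q u' - u q'\<close>.\<close>

lemma
  assumes \<gamma>: "(\<gamma> has_real_derivative \<gamma>') (at t)" and u: "(u has_real_derivative u') (at t)"
    and q: "(q has_real_derivative q') (at t)" and g2: "\<bar>\<gamma> t\<bar> < 2" and q0: "0 < q t"
  shows arctan_slope_deriv:
      "((\<lambda>t. pi / 2 - arctan ((u t / q t + \<gamma> t / 2) / h_of (\<gamma> t))) has_real_derivative
        (- (2 * q t + u t * \<gamma> t) * q t / 4 * \<gamma>' / h_of (\<gamma> t) - h_of (\<gamma> t) * q t * u'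
          + h_of (\<gamma> t) * u t * q') / B_fun (\<gamma> t) (u t) (q t)) (at t)" (is ?A)
    and J_fun_deriv:
      "((\<lambda>t. J_fun (\<gamma> t) (u t) (q t)) has_real_derivative
        J_fun (\<gamma> t) (u t) (q t) * (Lam (\<gamma> t) (u t) (q t) * \<gamma>'
          + \<gamma> t * (q t * u' - u t * q') / B_fun (\<gamma> t) (u t) (q t))) (at t)" (is ?J)
proof -
  define h where "h = h_of (\<gamma> t)"
  define g where "g = \<gamma> t"
  define B where "B = B_fun g (u t) (q t)"
  have h: "0 < h" "h\<^sup>2 = 1 - g\<^sup>2 / 4"
    using h_of_pos[OF g2] h_of_sq[OF g2] by (auto simp: h_def g_def)
  have B: "0 < B" using B_fun_pos[OF g2 q0] by (simp add: B_def g_def)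
  have Beq: "B = (u t + g / 2 * q t)\<^sup>2 + h\<^sup>2 * (q t)\<^sup>2"
    using B_fun_alt[OF g2] by (simp add: B_def g_def h_def)
  have one: "1 + ((u t / q t + g / 2) / h)\<^sup>2 = B / (h\<^sup>2 * (q t)\<^sup>2)"
    unfolding Beq using h(1) q0 by (simp add: field_simps power2_eq_square)
  note hd = h_of_deriv[OF \<gamma> g2]
  have d1: "((\<lambda>t. (u t / q t + \<gamma> t / 2) / h_of (\<gamma> t)) has_real_derivative
      (((u' * q t - u t * q') / (q t)\<^sup>2 + \<gamma>' / 2) * h + (u t / q t + g / 2) * (g * \<gamma>' / (4 * h))) / h\<^sup>2) (at t)"
    using q0 h(1) unfolding h_def g_def
    by (auto intro!: derivative_eq_intros \<gamma> u q hd simp: field_simps power2_eq_square)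
  have "(((u' * q t - u t * q') / (q t)\<^sup>2 + \<gamma>' / 2) * h + (u t / q t + g / 2) * (g * \<gamma>' / (4 * h))) / h\<^sup>2
      = (((u' * q t - u t * q') / (q t)\<^sup>2) * h + \<gamma>' * (h\<^sup>2 / 2 + (u t / q t + g / 2) * (g / 4)) / h) / h\<^sup>2"
    using h(1) q0 by (simp add: divide_simps power2_eq_square) (simp add: algebra_simps)
  also have "h\<^sup>2 / 2 + (u t / q t + g / 2) * (g / 4) = (2 * q t + u t * g) / (4 * q t)"
    unfolding h(2) using q0 by (simp add: field_simps power2_eq_square)
  finally have d1': "((\<lambda>t. (u t / q t + \<gamma> t / 2) / h_of (\<gamma> t)) has_real_derivative
      (((u' * q t - u t * q') / (q t)\<^sup>2) * h + \<gamma>' * ((2 * q t + u t * g) / (4 * q t)) / h) / h\<^sup>2) (at t)"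
    using d1 by (simp only: )
  have d2: "((\<lambda>t. pi / 2 - arctan ((u t / q t + \<gamma> t / 2) / h_of (\<gamma> t))) has_real_derivative
      - ((((u' * q t - u t * q') / (q t)\<^sup>2) * h + \<gamma>' * ((2 * q t + u t * g) / (4 * q t)) / h) / h\<^sup>2)
        / (1 + ((u t / q t + g / 2) / h)\<^sup>2)) (at t)"
    by (rule derivative_eq_intros d1' refl)+ (simp add: g_def h_def divide_simps)
  have e2: "- ((((u' * q t - u t * q') / (q t)\<^sup>2) * h + \<gamma>' * ((2 * q t + u t * g) / (4 * q t)) / h) / h\<^sup>2)
        / (B / (h\<^sup>2 * (q t)\<^sup>2))
      = (- (2 * q t + u t * g) * q t / 4 * \<gamma>' / h - h * q t * u' + h * u t * q') / B"
    using h(1) q0 B by (simp add: divide_simps power2_eq_square) (simp add: algebra_simps)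
  from d2[unfolded one e2] show A: ?A by (simp add: g_def h_def B_def)
  have "g\<^sup>2 / 4 + h\<^sup>2 = 1" using h(2) by simp
  have hG: "(\<gamma>' * h - g * (- g * \<gamma>' / (4 * h))) / (h * h) = \<gamma>' * (g\<^sup>2 / 4 + h\<^sup>2) / h ^ 3"
    using h(1) by (simp add: divide_simps power2_eq_square power3_eq_cube) (simp add: algebra_simps)
  have dG: "((\<lambda>t. G_of (\<gamma> t)) has_real_derivative \<gamma>' / h ^ 3) (at t)"
    using DERIV_divide[OF \<gamma> hd, folded h_def g_def, unfolded hG \<open>g\<^sup>2 / 4 + h\<^sup>2 = 1\<close>] h(1)
    unfolding G_of_def by (simp add: h_def)
  show ?J
  proof -
    define F where "F = pi / 2 - arctan ((u t / q t + \<gamma> t / 2) / h_of (\<gamma> t))"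
    have "- (\<gamma>' / h ^ 3) * F + (- (2 * q t + u t * g) * q t / 4 * \<gamma>' / h - h * q t * u' + h * u t * q') / B * - (g / h)
      = (g * q t * (2 * q t + g * u t) / (4 * h\<^sup>2 * B) - F / h ^ 3) * \<gamma>' + g * (q t * u' - u t * q') / B"
      using h(1) B
      by (simp add: divide_simps power2_eq_square power3_eq_cube) (simp add: algebra_simps)
    then show ?thesis
      using DERIV_fun_exp[OF DERIV_mult[OF DERIV_minus[OF dG] A]]
      unfolding J_fun_def Lam_def G_of_def F_def g_def h_def B_def by simp
  qed
qed

text \<open>This is the symmetry of mixed derivatives:
  \<open>d ln J = Lam dg + (g / B) (q du - u dq)\<close>, and the charge derivative of
  \<open>g / B\<close> is \<open>(B - g u q) / B^2 = (u^2 + q^2) / B^2\<close>. The proof is a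
  direct differentiation.\<close>

lemma Lam_deriv:
  assumes u: "(u has_real_derivative u') (at t)"
    and q: "(q has_real_derivative q') (at t)" and g2: "\<bar>g\<bar> < 2" and q0: "0 < q t"
  shows "((\<lambda>t. Lam g (u t) (q t)) has_real_derivative
    ((u t)\<^sup>2 + (q t)\<^sup>2) / (B_fun g (u t) (q t))\<^sup>2 * (q t * u' - u t * q')) (at t)"
proof -
  define h where "h = h_of g"
  define B where "B = B_fun g (u t) (q t)"
  have h: "0 < h" "h\<^sup>2 = 1 - g\<^sup>2 / 4"
    using h_of_pos[OF g2] h_of_sq[OF g2] by (auto simp: h_def)
  have B: "0 < B" using B_fun_pos[OF g2 q0] by (simp add: B_def)
  have dB: "((\<lambda>t. B_fun g (u t) (q t)) has_real_derivative (2 * u t + g * q t) * u' + (g * u t + 2 * q t) * q') (at t)"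
    unfolding B_fun_def
    by (rule derivative_eq_intros u q refl)+ (simp add: algebra_simps)
  have dA: "((\<lambda>t. pi / 2 - arctan ((u t / q t + g / 2) / h_of g)) has_real_derivative
        (- h * q t * u' + h * u t * q') / B) (at t)"
    using arctan_slope_deriv[OF DERIV_const[of g] u q] g2 q0 by (simp add: h_def B_def)
  define c d where "c = h\<^sup>2" and "d = h ^ 3"
  have cd: "c \<noteq> 0" "d = c * h" using h(1) by (auto simp: c_def d_def power2_eq_square power3_eq_cube)
  have "((\<lambda>t. Lam g (u t) (q t)) has_real_derivative
     (((g * q' * (2 * q t + g * u t) + g * q t * (2 * q' + g * u')) * B
       - g * q t * (2 * q t + g * u t) * ((2 * u t + g * q t) * u' + (g * u t + 2 * q t) * q')) / (4 * B\<^sup>2)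
       + (q t * u' - u t * q') / B) / c) (at t)"
  proof -
    have t1: "((\<lambda>t. g * q t * (2 * q t + g * u t) / (4 * c * B_fun g (u t) (q t))) has_real_derivative
       (((g * q' * (2 * q t + g * u t) + g * q t * (2 * q' + g * u')) * B
       - g * q t * (2 * q t + g * u t) * ((2 * u t + g * q t) * u' + (g * u t + 2 * q t) * q')) / (4 * B\<^sup>2)) / c) (at t)"
      using B cd by (auto intro!: derivative_eq_intros u q dB simp: divide_simps power2_eq_square simp flip: B_def)
        (simp add: algebra_simps)
    have t2: "(- h * q t * u' + h * u t * q') / B / d = - ((q t * u' - u t * q') / B / c)"
      using h(1) B cd by (simp add: divide_simps) (simp add: algebra_simps)
    show ?thesis
      using DERIV_diff[OF t1 DERIV_cdivide[OF dA, of d], unfolded t2]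
      unfolding Lam_def h_def[symmetric] c_def[symmetric] d_def[symmetric]
      by (rule DERIV_cong) (simp add: add_divide_distrib)
  qed
  also have "((g * q' * (2 * q t + g * u t) + g * q t * (2 * q' + g * u')) * B
       - g * q t * (2 * q t + g * u t) * ((2 * u t + g * q t) * u' + (g * u t + 2 * q t) * q')) / (4 * B\<^sup>2)
       + (q t * u' - u t * q') / B
    = h\<^sup>2 * (((u t)\<^sup>2 + (q t)\<^sup>2) / B\<^sup>2 * (q t * u' - u t * q'))"
    unfolding h(2) using B
    by (simp add: divide_simps) (simp add: B_def B_fun_def power2_eq_square algebra_simps)
  finally show ?thesis using h(1) by (simp add: B_def c_def)
qed

section \<open>Coefficients of the Finslerian metric and their derivatives\<close>

definition E1 :: "real \<Rightarrow> real \<Rightarrow> real \<Rightarrow> real" where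
  "E1 g u q = 1 + g * (u * q + g * q\<^sup>2) / B_fun g u q"

definition E2 :: "real \<Rightarrow> real \<Rightarrow> real \<Rightarrow> real" where
  "E2 g u q = g * q\<^sup>2 / B_fun g u q"

definition E3 :: "real \<Rightarrow> real \<Rightarrow> real \<Rightarrow> real" where
  "E3 g u q = 1 - g * (u * q) / B_fun g u q"

text \<open>\<open>E1_dot\<close>, \<open>E2_dot\<close>, \<open>E3_dot\<close> are the partial
  derivatives in the charge at fixed \<open>u\<close>, \<open>q\<close>.\<close>

definition E1_dot :: "real \<Rightarrow> real \<Rightarrow> real \<Rightarrow> real" where
  "E1_dot g u q = (u * q + 2 * g * q\<^sup>2) / B_fun g u q - g * u * q * (u * q + g * q\<^sup>2) / (B_fun g u q)\<^sup>2"

definition E2_dot :: "real \<Rightarrow> real \<Rightarrow> real \<Rightarrow> real" where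
  "E2_dot g u q = q\<^sup>2 / B_fun g u q - g * u * q * q\<^sup>2 / (B_fun g u q)\<^sup>2"

definition E3_dot :: "real \<Rightarrow> real \<Rightarrow> real \<Rightarrow> real" where
  "E3_dot g u q = - u * q / B_fun g u q + g * (u * q)\<^sup>2 / (B_fun g u q)\<^sup>2"

text \<open>\<open>E1\<close>, \<open>E2\<close>, \<open>E3\<close> are homogeneous of degree zero
  in \<open>(u, q)\<close>, so by Euler their remaining derivative is a multiple of
  \<open>q u' - u q'\<close>.\<close>

lemma
  assumes \<gamma>: "(\<gamma> has_real_derivative \<gamma>') (at t)" and u: "(u has_real_derivative u') (at t)"
    and q: "(q has_real_derivative q') (at t)" and g2: "\<bar>\<gamma> t\<bar> < 2" and q0: "0 < q t"
  shows B_fun_deriv: "((\<lambda>t. B_fun (\<gamma> t) (u t) (q t)) has_real_derivative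
      u t * q t * \<gamma>' + (2 * u t + \<gamma> t * q t) * u' + (\<gamma> t * u t + 2 * q t) * q') (at t)" (is ?B)
    and E1_deriv: "((\<lambda>t. E1 (\<gamma> t) (u t) (q t)) has_real_derivative
      E1_dot (\<gamma> t) (u t) (q t) * \<gamma>' + (\<gamma> t * ((q t)\<^sup>2 - (u t)\<^sup>2) - (\<gamma> t)\<^sup>2 * q t * (2 * u t + \<gamma> t * q t))
        / (B_fun (\<gamma> t) (u t) (q t))\<^sup>2 * (q t * u' - u t * q')) (at t)" (is ?E1)
    and E2_deriv: "((\<lambda>t. E2 (\<gamma> t) (u t) (q t)) has_real_derivative
      E2_dot (\<gamma> t) (u t) (q t) * \<gamma>' - \<gamma> t * q t * (2 * u t + \<gamma> t * q t)
        / (B_fun (\<gamma> t) (u t) (q t))\<^sup>2 * (q t * u' - u t * q')) (at t)" (is ?E2)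
    and E3_deriv: "((\<lambda>t. E3 (\<gamma> t) (u t) (q t)) has_real_derivative
      E3_dot (\<gamma> t) (u t) (q t) * \<gamma>' - \<gamma> t * ((q t)\<^sup>2 - (u t)\<^sup>2)
        / (B_fun (\<gamma> t) (u t) (q t))\<^sup>2 * (q t * u' - u t * q')) (at t)" (is ?E3)
proof -
  show B: ?B
    unfolding B_fun_def
    by (rule derivative_eq_intros \<gamma> u q refl)+ (simp add: algebra_simps)
  define N where "N = B_fun (\<gamma> t) (u t) (q t)"
  have N: "N \<noteq> 0" using B_fun_pos[OF g2 q0, of "u t"] by (simp add: N_def)
  note q2 = DERIV_power[OF q, of 2]
  note uq = DERIV_mult[OF u q]
  note Y = DERIV_divide[OF DERIV_mult[OF \<gamma> q2] B, folded N_def, OF N]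
  note X = DERIV_divide[OF DERIV_mult[OF \<gamma> uq] B, folded N_def, OF N]
  note Z = DERIV_divide[OF DERIV_mult[OF \<gamma> DERIV_add[OF uq DERIV_mult[OF \<gamma> q2]]] B, folded N_def, OF N]
  show ?E1
    using DERIV_add[OF DERIV_const[of 1] Z] N unfolding E1_def E1_dot_def N_def[symmetric]
    by (elim DERIV_cong) (simp add: divide_simps, simp add: N_def B_fun_def, algebra)
  show ?E2
    using Y N unfolding E2_def E2_dot_def N_def[symmetric]
    by (elim DERIV_cong) (simp add: divide_simps, simp add: N_def B_fun_def, algebra)
  show ?E3
    using DERIV_diff[OF DERIV_const[of 1] X] N unfolding E3_def E3_dot_def N_def[symmetric]
    by (elim DERIV_cong) (simp add: divide_simps, simp add: N_def B_fun_def, algebra)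
qed

text \<open>The entry \<open>g_ij\<close>, with \<open>E1\<close>, \<open>E2\<close>,
  \<open>E3\<close> as the entries of its block in the plane of \<open>b\<close> and
  \<open>w\<close>. It takes the components as numbers so that it can be differentiated along any
  curve.\<close>

definition metric_coeff :: "real \<Rightarrow> real \<Rightarrow> real \<Rightarrow> real \<Rightarrow> real \<Rightarrow> real \<Rightarrow> real \<Rightarrow> real \<Rightarrow> real" where
  "metric_coeff g u q bi bj wi wj r = J_fun g u q *
     (r + E1 g u q * (bi * bj) + E2 g u q * (bi * wj + wi * bj) + E3 g u q * (wi * wj))"

definition metric_dot :: "real \<Rightarrow> real \<Rightarrow> real \<Rightarrow> real \<Rightarrow> real \<Rightarrow> real \<Rightarrow> real \<Rightarrow> real \<Rightarrow> real" where
  "metric_dot g u q bi bj wi wj r = Lam g u q * metric_coeff g u q bi bj wi wj r + J_fun g u q *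
     (E1_dot g u q * (bi * bj) + E2_dot g u q * (bi * wj + wi * bj) + E3_dot g u q * (wi * wj))"

text \<open>The numbers \<open>nw\<close>, \<open>ri\<close>, \<open>rj\<close> describe a variation of the vector \<open>y\<close>; the primed numbers
  the remaining variation of the two covectors and of \<open>r\<close>.\<close>

lemma metric_coeff_deriv:
  assumes \<gamma>: "(\<gamma> has_real_derivative \<gamma>') (at t)"
    and u: "(u has_real_derivative nb) (at t)" and q: "(q has_real_derivative nw) (at t)"
    and bi: "(bi has_real_derivative bi') (at t)" and bj: "(bj has_real_derivative bj') (at t)"
    and wi: "(wi has_real_derivative wi' + ri / q t) (at t)"
    and wj: "(wj has_real_derivative wj' + rj / q t) (at t)"
    and r: "(r has_real_derivative r' - (wi t * rj + wj t * ri) / q t) (at t)"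
    and g2: "\<bar>\<gamma> t\<bar> < 2" and q0: "0 < q t"
  defines "B \<equiv> B_fun (\<gamma> t) (u t) (q t)" and "J \<equiv> J_fun (\<gamma> t) (u t) (q t)"
    and "pI \<equiv> q t * bi t - u t * wi t" and "pJ \<equiv> q t * bj t - u t * wj t"
    and "np \<equiv> q t * nb - u t * nw"
  shows "((\<lambda>t. metric_coeff (\<gamma> t) (u t) (q t) (bi t) (bj t) (wi t) (wj t) (r t)) has_real_derivative
     metric_dot (\<gamma> t) (u t) (q t) (bi t) (bj t) (wi t) (wj t) (r t) * \<gamma>'
     + J * (r' + E1 (\<gamma> t) (u t) (q t) * (bi' * bj t + bi t * bj')
            + E2 (\<gamma> t) (u t) (q t) * (bi' * wj t + bi t * wj' + wi' * bj t + wi t * bj')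
            + E3 (\<gamma> t) (u t) (q t) * (wi' * wj t + wi t * wj'))
     + J * (\<gamma> t / B * (np * r t + pI * rj + pJ * ri + 2 / B * (np * pI * pJ)))) (at t)"
proof -
  note J = J_fun_deriv[OF \<gamma> u q g2 q0]
  note E = E1_deriv[OF \<gamma> u q g2 q0] E2_deriv[OF \<gamma> u q g2 q0] E3_deriv[OF \<gamma> u q g2 q0]
  have B: "B > 0" using B_fun_pos[OF g2 q0] by (simp add: B_def)
  define e1 where "e1 = E1 (\<gamma> t) (u t) (q t)"
  define e2 where "e2 = E2 (\<gamma> t) (u t) (q t)"
  define e3 where "e3 = E3 (\<gamma> t) (u t) (q t)"
  note M = DERIV_mult[OF J DERIV_add[OF DERIV_add[OF DERIV_add[OF r
     DERIV_mult[OF E(1) DERIV_mult[OF bi bj]]]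
     DERIV_mult[OF E(2) DERIV_add[OF DERIV_mult[OF bi wj] DERIV_mult[OF wi bj]]]]
     DERIV_mult[OF E(3) DERIV_mult[OF wi wj]]]]
  have e: "e3 = 1 - \<gamma> t * (u t * q t) / B" "e2 = \<gamma> t * (q t)\<^sup>2 / B" "e1 = 1 + \<gamma> t * (u t * q t + \<gamma> t * (q t)\<^sup>2) / B"
    by (simp_all add: e1_def e2_def e3_def E1_def E2_def E3_def B_def)
  \<comment> \<open>All terms caused by the variation of \<open>y\<close> collapse into the
    symmetric shape of the Cartan tensor.\<close>
  have main: "\<gamma> t * np / B * (r t + e1 * (bi t * bj t) + e2 * (bi t * wj t + wi t * bj t) + e3 * (wi t * wj t))
      - (wi t * rj + wj t * ri) / q t
      + (\<gamma> t * ((q t)\<^sup>2 - (u t)\<^sup>2) - (\<gamma> t)\<^sup>2 * q t * (2 * u t + \<gamma> t * q t)) / B\<^sup>2 * np * (bi t * bj t)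
      - \<gamma> t * q t * (2 * u t + \<gamma> t * q t) / B\<^sup>2 * np * (bi t * wj t + wi t * bj t)
      - \<gamma> t * ((q t)\<^sup>2 - (u t)\<^sup>2) / B\<^sup>2 * np * (wi t * wj t)
      + e2 * (bi t * (rj / q t) + ri / q t * bj t) + e3 * (ri / q t * wj t + wi t * (rj / q t))
    = \<gamma> t / B * (np * r t + pI * rj + pJ * ri + 2 / B * (np * pI * pJ))" (is "?l = _")
  proof -
    have r1: "e2 / q t = \<gamma> t * q t / B" "(e3 - 1) / q t = - \<gamma> t * u t / B"
      using q0 B unfolding e by (simp_all add: field_simps power2_eq_square)
    \<comment> \<open>\<open>q^2\<close>, \<open>- u q\<close>, \<open>u^2\<close> are the
      coefficients of \<open>p \<otimes> p\<close> in the coframe \<open>b\<close>,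
      \<open>w\<close>; this is the origin of the term
      \<open>2 / B * (np * pI * pJ)\<close>.\<close>
    have c1: "e1 * B + ((q t)\<^sup>2 - (u t)\<^sup>2) - \<gamma> t * q t * (2 * u t + \<gamma> t * q t) = 2 * (q t)\<^sup>2"
      "e2 * B - q t * (2 * u t + \<gamma> t * q t) = - 2 * (u t * q t)"
      "e3 * B - ((q t)\<^sup>2 - (u t)\<^sup>2) = 2 * (u t)\<^sup>2"
      using B unfolding e by (simp_all add: field_simps) (simp_all add: B_def B_fun_def power2_eq_square algebra_simps)
    have "?l =
      \<gamma> t * np / B\<^sup>2 * ((e1 * B + ((q t)\<^sup>2 - (u t)\<^sup>2) - \<gamma> t * q t * (2 * u t + \<gamma> t * q t)) * (bi t * bj t)
         + (e2 * B - q t * (2 * u t + \<gamma> t * q t)) * (bi t * wj t + wi t * bj t)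
         + (e3 * B - ((q t)\<^sup>2 - (u t)\<^sup>2)) * (wi t * wj t))
      + \<gamma> t * np / B * r t
      + e2 / q t * (bi t * rj + ri * bj t) + (e3 - 1) / q t * (ri * wj t + wi t * rj)"
      using B q0 by (simp add: field_simps power2_eq_square)
    also have "\<dots> = \<gamma> t / B * (np * r t + pI * rj + pJ * ri + 2 / B * (np * pI * pJ))"
      unfolding r1 c1 pI_def pJ_def using B by (simp add: field_simps power2_eq_square)
    finally show ?thesis .
  qed
  define si where "si = ri / q t"
  define sj where "sj = rj / q t"
  have s: "(wi t * rj + wj t * ri) / q t = wi t * sj + wj t * si"
    by (simp add: si_def sj_def add_divide_distrib)
  define k1 where "k1 = (\<gamma> t * ((q t)\<^sup>2 - (u t)\<^sup>2) - (\<gamma> t)\<^sup>2 * q t * (2 * u t + \<gamma> t * q t)) / B\<^sup>2"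
  define k2 where "k2 = \<gamma> t * q t * (2 * u t + \<gamma> t * q t) / B\<^sup>2"
  define k3 where "k3 = \<gamma> t * ((q t)\<^sup>2 - (u t)\<^sup>2) / B\<^sup>2"
  have gB: "\<gamma> t * np / B = \<gamma> t / B * np" by simp
  define k where "k = \<gamma> t / B"
  show ?thesis
    using M unfolding metric_coeff_def metric_dot_def
      B_def[symmetric] J_def[symmetric] np_def[symmetric] e1_def[symmetric] e2_def[symmetric] e3_def[symmetric]
      k1_def[symmetric] k2_def[symmetric] k3_def[symmetric] s si_def[symmetric] sj_def[symmetric] gB k_def[symmetric]
    unfolding main[unfolded s gB, folded k_def k1_def k2_def k3_def si_def sj_def, symmetric]
    by (rule DERIV_cong) (simp add: algebra_simps)
qed

section \<open>Adapted frames\<close>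

text \<open>Vectors and covectors are plain functions of the index, so that any free index of a
  tensor can be bound by a lambda and contracted.\<close>

definition contr :: "('n::finite \<Rightarrow> real) \<Rightarrow> ('n \<Rightarrow> real) \<Rightarrow> real" where
  "contr f h = (\<Sum>k\<in>UNIV. f k * h k)"

lemma contr_linear:
  "contr (\<lambda>k. f k + f' k) h = contr f h + contr f' h"
  "contr h (\<lambda>k. f k + f' k) = contr h f + contr h f'"
  "contr (\<lambda>k. f k - f' k) h = contr f h - contr f' h"
  "contr h (\<lambda>k. f k - f' k) = contr h f - contr h f'"
  "contr (\<lambda>k. - f k) h = - contr f h"
  "contr h (\<lambda>k. - f k) = - contr h f"
  "contr (\<lambda>k. c * f k) h = c * contr f h"
  "contr h (\<lambda>k. c * f k) = c * contr h f"
  "contr (\<lambda>k. f k * c) h = c * contr f h"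
  "contr h (\<lambda>k. f k * c) = c * contr h f"
  "contr (\<lambda>k. f k / c) h = contr f h / c"
  "contr h (\<lambda>k. f k / c) = contr h f / c"
  by (simp_all add: contr_def algebra_simps sum.distrib sum_subtractf sum_negf
      sum_distrib_left sum_distrib_right sum_divide_distrib)

lemma contr_delta:
  "contr (\<lambda>k. if k = i then c else 0) f = c * f i"
  "contr f (\<lambda>k. if k = i then c else 0) = c * f i"
proof -
  have "(\<lambda>k. (if k = i then c else 0) * f k) = (\<lambda>k. if k = i then c * f i else 0)"
    by (auto simp: fun_eq_iff)
  then show "contr (\<lambda>k. if k = i then c else 0) f = c * f i"
    unfolding contr_def by (simp only: sum.delta finite UNIV_I if_True)
  then show "contr f (\<lambda>k. if k = i then c else 0) = c * f i"
    by (simp add: contr_def mult.commute)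
qed

lemma contr_commute: "contr f h = contr h f"
  by (simp add: contr_def mult.commute)

lemma contr_swap: "contr f (\<lambda>k. contr (M k) h) = contr (\<lambda>l. contr f (\<lambda>k. M k l)) h"
  unfolding contr_def sum_distrib_left sum_distrib_right
  by (subst sum.swap) (simp add: mult.assoc)

text \<open>With \<open>m = (u + g q, q)\<close> and \<open>p = (q, - u)\<close> in the coframe
  \<open>b\<close>, \<open>w\<close>, the block of \<open>E1\<close>, \<open>E2\<close>,
  \<open>E3\<close> is \<open>(m m^T + p p^T) / B\<close>. Its determinant is 1, so
  \<open>det g_ij = J^N det a_ij\<close>. The identities for the dotted coefficients are the charge
  derivatives of \<open>E1 u + E2 q = u + g q\<close>, \<open>E2 u + E3 q = q\<close>,
  \<open>E1 q - E2 (u + g q) = q\<close> and \<open>E2 q - E3 (u + g q) = - u\<close>, which express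
  the lowering of \<open>y\<close> and of \<open>pu\<close>.\<close>

lemma
  assumes "\<bar>g\<bar> < 2" "0 < q"
  shows E1_alt: "E1 g u q = ((u + g * q)\<^sup>2 + q\<^sup>2) / B_fun g u q"
    and E2_alt: "E2 g u q = ((u + g * q) * q - u * q) / B_fun g u q"
    and E3_alt: "E3 g u q = (q\<^sup>2 + u\<^sup>2) / B_fun g u q"
    and E_dot_u: "E1_dot g u q * u + E2_dot g u q * q = q"
    and E_dot_q: "E2_dot g u q * u + E3_dot g u q * q = 0"
    and E_dot_pb: "E1_dot g u q * q - E2_dot g u q * (u + g * q) = q * E2 g u q"
    and E_dot_pw: "E2_dot g u q * q - E3_dot g u q * (u + g * q) = q * E3 g u q"
  using B_fun_pos[OF assms, of u]
  by (simp_all add: E1_def E2_def E3_def E1_dot_def E2_dot_def E3_dot_def divide_simps)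
    (simp_all add: B_fun_def power2_eq_square algebra_simps)

text \<open>The names \<open>bu\<close>, \<open>wu\<close>, \<open>ru\<close> stand for \<open>b\<close>, \<open>w\<close>, \<open>r\<close> with indices raised by \<open>a\<close>.\<close>

locale finsler_frame =
  fixes g u q :: real and b w bu wu :: "'n::finite \<Rightarrow> real" and r ru :: "'n \<Rightarrow> 'n \<Rightarrow> real"
  assumes g2: "\<bar>g\<bar> < 2" and q0: "0 < q"
    and b_bu [simp]: "contr b bu = 1" and b_wu [simp]: "contr b wu = 0"
    and w_bu [simp]: "contr w bu = 0" and w_wu [simp]: "contr w wu = 1"
    and r_bu [simp]: "contr (r i) bu = 0" and r_wu [simp]: "contr (r i) wu = 0"
    and b_ru [simp]: "contr b (\<lambda>k. ru k i) = 0" and w_ru [simp]: "contr w (\<lambda>k. ru k i) = 0"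
    and r_sym: "r i j = r j i" and ru_sym: "ru i j = ru j i"
    and r_ru: "contr (r i) (\<lambda>k. ru k j) = (if i = j then 1 else 0) - b i * bu j - w i * wu j"
begin

abbreviation "B \<equiv> B_fun g u q"
abbreviation "J \<equiv> J_fun g u q"

text \<open>Here \<open>gl\<close>, \<open>gu\<close> are the Finslerian \<open>g\<^sub>i\<^sub>j\<close>, \<open>g\<^sup>i\<^sup>j\<close>, used to raise \<open>p\<close> to \<open>pu\<close> and to lower \<open>yu = y\<close>
  to \<open>yl\<close>; \<open>gd\<close> is the derivative of \<open>gl\<close> with respect to the charge and \<open>Cc k\<close> that with respect
  to \<open>y\<^sup>k\<close>.\<close>

definition "p i = q * b i - u * w i"
definition "pu i = (q * bu i - (u + g * q) * wu i) / J"
definition "yu i = u * bu i + q * wu i"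
definition "yl i = J * ((u + g * q) * b i + q * w i)"
definition "gl i j = metric_coeff g u q (b i) (b j) (w i) (w j) (r i j)"
definition "gd i j = metric_dot g u q (b i) (b j) (w i) (w j) (r i j)"
definition "gu i j = yu i * yu j / (B * J) + J / B * (pu i * pu j) + ru i j / J"
definition "Cc k i j = J * (g / B * (p k * r i j + p i * r j k + p j * r i k + 2 / B * (p k * p i * p j)))"

lemma B_pos [simp]: "0 < B" "B \<noteq> 0"
  using B_fun_pos[OF g2 q0, of u] by simp_all

lemma J_pos [simp]: "0 < J" "J \<noteq> 0"
  by (simp_all add: J_fun_def)

lemma more_contr [simp]:
  "contr bu b = 1" "contr wu b = 0" "contr bu w = 0" "contr wu w = 1"
  "contr bu (r i) = 0" "contr wu (r i) = 0"
  "contr (\<lambda>k. r k i) bu = 0" "contr (\<lambda>k. r k i) wu = 0"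
  "contr bu (\<lambda>k. r k i) = 0" "contr wu (\<lambda>k. r k i) = 0"
  "contr b (ru i) = 0" "contr w (ru i) = 0" "contr (ru i) b = 0" "contr (ru i) w = 0"
  "contr (\<lambda>k. ru k i) b = 0" "contr (\<lambda>k. ru k i) w = 0"
proof -
  have s: "(\<lambda>k. r k i) = r i" "(\<lambda>k. ru k i) = ru i" for i
    using r_sym ru_sym by (auto simp: fun_eq_iff)
  note z = b_ru[unfolded s] w_ru[unfolded s]
  show "contr bu b = 1" "contr wu b = 0" "contr bu w = 0" "contr wu w = 1"
    "contr bu (r i) = 0" "contr wu (r i) = 0"
    by (subst contr_commute, simp)+
  then show "contr (\<lambda>k. r k i) bu = 0" "contr (\<lambda>k. r k i) wu = 0"
    "contr bu (\<lambda>k. r k i) = 0" "contr wu (\<lambda>k. r k i) = 0"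
    by (simp_all add: s)
  show "contr b (ru i) = 0" "contr w (ru i) = 0" "contr (ru i) b = 0" "contr (ru i) w = 0"
    "contr (\<lambda>k. ru k i) b = 0" "contr (\<lambda>k. ru k i) w = 0"
    using z by (simp_all add: s contr_commute[of "ru i"])
qed

lemma frame_contr [simp]:
  "contr b yu = u" "contr w yu = q" "contr p yu = 0" "contr (r i) yu = 0" "contr (\<lambda>k. r k i) yu = 0"
  "contr b pu = q / J" "contr w pu = - (u + g * q) / J" "contr p pu = B / J"
  "contr (r i) pu = 0" "contr (\<lambda>k. r k i) pu = 0"
  "contr p bu = q" "contr p wu = - u" "contr yl yu = B * J" "contr yl pu = 0"
  "contr yl (\<lambda>k. ru k i) = 0" "contr p (\<lambda>k. ru k i) = 0"
  by (simp_all add: yu_def[abs_def] p_def[abs_def] pu_def[abs_def] yl_def[abs_def] contr_linear)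
    (simp_all add: B_fun_def field_simps power2_eq_square)

lemma gl_sym: "gl i j = gl j i"
  by (simp add: gl_def metric_coeff_def r_sym[of i j] algebra_simps)

lemma gd_sym: "gd i j = gd j i"
  using gl_sym[of i j] by (simp add: gl_def gd_def metric_dot_def algebra_simps)

lemma gu_sym: "gu i j = gu j i"
  by (simp add: gu_def ru_sym[of i j] mult.commute)

lemma Cc_sym: "Cc k i j = Cc i k j" "Cc k i j = Cc k j i"
  by (simp_all add: Cc_def r_sym[of i j] r_sym[of k j] r_sym[of k i] algebra_simps)

text \<open>The factorisation of the block in \<open>E1_alt\<close>, \<open>E2_alt\<close>,
  \<open>E3_alt\<close>: \<open>yl\<close> equals \<open>J m\<close>. The covectors
  \<open>yl\<close> and \<open>p\<close> are orthogonal for the Finslerian metric, with squared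
  lengths \<open>B J\<close> and \<open>B / J\<close>, so the inverse \<open>gu\<close> can be read
  off.\<close>

lemma gl_decomp: "gl i j = yl i * yl j / (B * J) + J / B * (p i * p j) + J * r i j"
proof -
  have "(J * a) * (J * c) / (B * J) = J * (a * c / B)" for a c by (simp add: divide_simps)
  then show ?thesis
    unfolding gl_def metric_coeff_def yl_def p_def E1_alt[OF g2 q0] E2_alt[OF g2 q0] E3_alt[OF g2 q0]
    by (simp add: divide_simps) (simp add: algebra_simps power2_eq_square)
qed

lemma gl_yu [simp]: "contr (gl i) yu = yl i"
  and gl_pu [simp]: "contr (gl i) pu = p i"
  unfolding gl_decomp[abs_def] by (simp_all add: contr_linear)

lemma gl_gu: "contr (gl i) (\<lambda>k. gu k j) = (if i = j then 1 else 0)"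
proof -
  have "contr (gl i) (\<lambda>k. gu k j)
    = yl i * yu j / (B * J) + J / B * (p i * pu j) + contr (r i) (\<lambda>k. ru k j)"
    unfolding gl_decomp[abs_def] gu_def[abs_def] by (simp add: contr_linear divide_simps)
  also have "yl i * yu j / (B * J) + J / B * (p i * pu j) = b i * bu j + w i * wu j"
    unfolding yl_def yu_def p_def pu_def
    by (simp add: divide_simps) (simp add: B_fun_def algebra_simps power2_eq_square)
  finally show ?thesis by (simp add: r_ru)
qed

lemma gu_gl: "contr (gu i) (gl l) = (if l = i then 1 else 0)"
proof -
  have "(\<lambda>k. gu k i) = gu i" by (auto simp: fun_eq_iff gu_sym)
  then show ?thesis using gl_gu[of l i] by (simp add: contr_commute)
qed

text \<open>To raise an index it suffices to guess the raised vector and to lower it again; the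
  spray is found in this way.\<close>

lemma gu_raise:
  assumes "\<And>i. contr (gl i) X = Z i"
  shows "contr (gu i) Z = X i"
proof -
  have s: "(\<lambda>k. gl k l) = gl l" for l by (auto simp: fun_eq_iff gl_sym)
  have "contr (gu i) Z = contr (\<lambda>l. contr (gu i) (\<lambda>k. gl k l)) X"
    unfolding contr_swap[symmetric] assms ..
  also have "\<dots> = X i"
    unfolding s gu_gl by (simp add: contr_delta)
  finally show ?thesis .
qed

lemma gu_p [simp]: "contr (gu i) p = pu i" and gu_yl [simp]: "contr (gu i) yl = yu i"
  by (simp_all add: gu_raise)

text \<open>\<open>gl_yu\<close> differentiated in the charge with \<open>y\<close> kept
  fixed.\<close>

lemma gd_yu: "contr (gd i) yu = Lam g u q * yl i + J * (q * b i)"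
proof -
  have "contr (gd i) yu = Lam g u q * yl i + J * ((E1_dot g u q * u + E2_dot g u q * q) * b i
      + (E2_dot g u q * u + E3_dot g u q * q) * w i)"
    unfolding gl_yu[symmetric] unfolding gd_def[abs_def] metric_dot_def gl_def[symmetric]
    by (simp add: contr_linear algebra_simps)
  then show ?thesis by (simp add: E_dot_u[OF g2 q0] E_dot_q[OF g2 q0])
qed

text \<open>Minus the lowered charge derivative of \<open>pu\<close>: since \<open>p\<close> does
  not depend on the charge, differentiating \<open>contr (gl i) pu = p i\<close> leaves
  \<open>gd\<close> on \<open>pu\<close> equal to it.\<close>

definition "ed i = Lam g u q * p i + q * (E2 g u q * b i + E3 g u q * w i)"

lemma gd_pu: "contr (gd i) pu = ed i"
proof -
  have "contr (gd i) pu = Lam g u q * p i + ((E1_dot g u q * q - E2_dot g u q * (u + g * q)) * b i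
      + (E2_dot g u q * q - E3_dot g u q * (u + g * q)) * w i)"
    unfolding gl_pu[symmetric] unfolding gd_def[abs_def] metric_dot_def gl_def[symmetric]
    by (simp add: contr_linear field_simps)
  then show ?thesis unfolding E_dot_pb[OF g2 q0] E_dot_pw[OF g2 q0] by (simp add: ed_def algebra_simps)
qed

definition "rp i j = r i j + 2 / B * (p i * p j)"

lemma Cc_contr:
  "contr (Cc i j) yu = 0"
  "contr (Cc i j) pu = g * rp i j"
  "contr (Cc i j) bu = J * g * q / B * rp i j"
  by (simp_all add: Cc_def[abs_def] rp_def contr_linear r_sym[of j i] field_simps)

lemma contr_one: "contr (\<lambda>i. f i * h i) (\<lambda>_. 1) = contr f h"
  by (simp add: contr_def)

text \<open>The trace of \<open>gu\<close> times \<open>gl\<close> is the dimension, and the two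
  directions \<open>yl\<close> and \<open>p\<close> contribute 1 each.\<close>

lemma gu_r: "contr (\<lambda>i. contr (gu i) (r i)) (\<lambda>_. 1) = (real CARD('n) - 2) / J"
proof -
  have "real CARD('n) = contr (\<lambda>i. contr (gu i) (gl i)) (\<lambda>_. 1)"
    unfolding gu_gl by (simp add: contr_def)
  also have "\<dots> = contr yl yu / (B * J) + J / B * contr p pu + J * contr (\<lambda>i. contr (gu i) (r i)) (\<lambda>_. 1)"
    by (simp only: gl_decomp[abs_def] contr_linear gu_yl gu_p contr_one)
  finally show ?thesis by (simp add: field_simps)
qed

text \<open>The dimension arises as \<open>(N - 2) + 2\<close>, from the trace of \<open>r\<close>
  and from the cubic term in \<open>p\<close>; the mixed terms vanish. The value is the
  \<open>y\<close>-derivative of \<open>ln det g_ij = N ln J + ln det a_ij\<close>, as it must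
  be.\<close>

lemma trace_Cc: "contr (\<lambda>i. contr (gu i) (\<lambda>j. Cc i j k)) (\<lambda>_. 1) = real CARD('n) * g / B * p k"
proof -
  have s: "(\<lambda>j. r j m) = r m" for m
    by (auto simp: fun_eq_iff r_sym)
  have s': "(\<lambda>k. ru k i) = ru i" for i
    by (auto simp: fun_eq_iff ru_sym)
  have gr: "contr (gu i) (r k) = (if k = i then 1 else 0) / J - b k * bu i / J - w k * wu i / J" for i
    using r_ru[of k i]
    by (simp add: gu_def[abs_def] contr_linear s' contr_commute[of "ru i"] contr_commute[of yu] contr_commute[of pu] diff_divide_distrib)
  have "contr p (\<lambda>i. contr (gu i) (r k)) = 0"
    unfolding gr
    by (simp add: contr_linear contr_delta eq_commute[of k]) (simp add: p_def field_simps)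
  moreover have z: "contr pu (r k) = 0"
    using frame_contr(9)[of k] by (simp only: contr_commute)
  moreover have "contr (\<lambda>i. contr (gu i) (\<lambda>j. Cc i j k)) (\<lambda>_. 1) =
     J * (g / B * (contr p (\<lambda>i. contr (gu i) (r k)) + contr pu (r k)
       + p k * contr (\<lambda>i. contr (gu i) (r i)) (\<lambda>_. 1) + 2 / B * (p k * contr p pu)))"
    by (simp only: Cc_def s contr_linear contr_one gu_p contr_commute[of pu p])
      (simp add: z s algebra_simps)
  ultimately show ?thesis
    by (simp add: gu_r field_simps)
qed

end

section \<open>Spray and connection\<close>

text \<open>The spray differs from the Riemannian one by \<open>\<mu> (spray_y y + spray_b b)\<close>.\<close>

definition spray_y :: "real \<Rightarrow> real \<Rightarrow> real \<Rightarrow> real" where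
  "spray_y g u q = (Lam g u q * (u + g * q / 2) - g * u * q\<^sup>2 / (2 * B_fun g u q)) / 2"

definition spray_b :: "real \<Rightarrow> real \<Rightarrow> real \<Rightarrow> real" where
  "spray_b g u q = (u * q - B_fun g u q * Lam g u q) / 4"

definition spray_y_u :: "real \<Rightarrow> real \<Rightarrow> real \<Rightarrow> real" where
  "spray_y_u g u q = ((u\<^sup>2 + q\<^sup>2) / (B_fun g u q)\<^sup>2 * q * (u + g * q / 2) + Lam g u q
     - g * q\<^sup>2 / (2 * B_fun g u q) + g * u * q\<^sup>2 * (2 * u + g * q) / (2 * (B_fun g u q)\<^sup>2)) / 2"

definition spray_y_q :: "real \<Rightarrow> real \<Rightarrow> real \<Rightarrow> real" where
  "spray_y_q g u q = (Lam g u q * g / 2 - (u\<^sup>2 + q\<^sup>2) / (B_fun g u q)\<^sup>2 * u * (u + g * q / 2)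
     - g * u * q / B_fun g u q + g * u * q\<^sup>2 * (g * u + 2 * q) / (2 * (B_fun g u q)\<^sup>2)) / 2"

definition spray_b_u :: "real \<Rightarrow> real \<Rightarrow> real \<Rightarrow> real" where
  "spray_b_u g u q = (q - (2 * u + g * q) * Lam g u q - (u\<^sup>2 + q\<^sup>2) / B_fun g u q * q) / 4"

definition spray_b_q :: "real \<Rightarrow> real \<Rightarrow> real \<Rightarrow> real" where
  "spray_b_q g u q = (u - (g * u + 2 * q) * Lam g u q + (u\<^sup>2 + q\<^sup>2) / B_fun g u q * u) / 4"

lemma
  assumes u: "(u has_real_derivative u') (at t)"
    and q: "(q has_real_derivative q') (at t)" and g2: "\<bar>g\<bar> < 2" and q0: "0 < q t"
  shows spray_y_deriv: "((\<lambda>t. spray_y g (u t) (q t)) has_real_derivative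
      spray_y_u g (u t) (q t) * u' + spray_y_q g (u t) (q t) * q') (at t)" (is ?Y)
    and spray_b_deriv: "((\<lambda>t. spray_b g (u t) (q t)) has_real_derivative
      spray_b_u g (u t) (q t) * u' + spray_b_q g (u t) (q t) * q') (at t)" (is ?B)
proof -
  define N where "N = B_fun g (u t) (q t)"
  have N: "N \<noteq> 0" using B_fun_pos[OF g2 q0, of "u t"] by (simp add: N_def)
  then have N2: "2 * N \<noteq> 0" by simp
  note B = B_fun_deriv[OF DERIV_const[of g] u q g2 q0]
  note L = Lam_deriv[OF u q g2 q0]
  note uq2 = DERIV_mult[OF DERIV_cmult[OF u, of g] DERIV_power[OF q, of 2]]
  show ?Y
    using DERIV_cdivide[OF DERIV_diff[OF DERIV_mult[OF L DERIV_add[OF u DERIV_cdivide[OF DERIV_cmult[OF q, of g], of 2]]]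
        DERIV_divide[OF uq2 DERIV_cmult[OF B, of 2], folded N_def, OF N2]], of 2]
    unfolding spray_y_def spray_y_u_def spray_y_q_def N_def[symmetric]
    by (rule DERIV_cong) (use N in \<open>simp add: divide_simps, algebra?\<close>)
  show ?B
    using DERIV_cdivide[OF DERIV_diff[OF DERIV_mult[OF u q] DERIV_mult[OF B L]], of 4] N
    unfolding spray_b_def spray_b_u_def spray_b_q_def N_def[symmetric]
    by (elim DERIV_cong) (simp add: divide_simps, algebra?)
qed

text \<open>The deviation from the Riemannian spray has the components
  \<open>u spray_y + spray_b\<close> along \<open>b\<close> and \<open>q spray_y\<close> along
  \<open>w\<close>; the first four formulas are their partial derivatives in \<open>u\<close> and
  \<open>q\<close>. The last one is \<open>J\<close> times the gradient of \<open>spray_b\<close>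
  contracted with \<open>pu\<close>. The simplifications rest on
  \<open>u^2 + q^2 = B - g u q\<close>.\<close>

lemma
  assumes g2: "\<bar>g\<bar> < 2" and q0: "0 < q"
  shows spray_db_u: "spray_y g u q + u * spray_y_u g u q + spray_b_u g u q = u * (Lam g u q + u * q / B_fun g u q) / 2" (is ?U)
    and spray_db_q: "u * spray_y_q g u q + spray_b_q g u q = - q * (Lam g u q - u * q / B_fun g u q) / 2" (is ?V)
    and spray_dw_u: "q * spray_y_u g u q = q * (Lam g u q + u * q / B_fun g u q) / 2" (is ?P)
    and spray_dw_q: "spray_y g u q + q * spray_y_q g u q = (Lam g u q * (u + g * q) - q + q ^ 3 / B_fun g u q) / 2" (is ?Q)
    and spray_b_u_alt: "spray_b_u g u q = (g * u * q\<^sup>2 / B_fun g u q - (2 * u + g * q) * Lam g u q) / 4" (is ?tu)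
    and spray_b_q_alt: "spray_b_q g u q = (2 * u - g * u\<^sup>2 * q / B_fun g u q - (g * u + 2 * q) * Lam g u q) / 4" (is ?tq)
    and spray_b_p: "q * spray_b_u g u q - (u + g * q) * spray_b_q g u q
      = (g * B_fun g u q * Lam g u q - 2 * u\<^sup>2 - g * u * q) / 4" (is ?T)
proof -
  define B where "B = B_fun g u q"
  have B0: "B \<noteq> 0" using B_fun_pos[OF g2 q0, of u] by (simp add: B_def)
  define k where "k = 1 / B"
  define L where "L = Lam g u q"
  have kB: "(u\<^sup>2 + q\<^sup>2) * k = 1 - g * u * q * k" using B0 by (simp add: k_def field_simps) (simp add: B_def B_fun_def)
  have Bk: "x / B = x * k" "x / (2 * B) = x * k / 2" "x / B\<^sup>2 = x * k\<^sup>2" "x / (2 * B\<^sup>2) = x * k\<^sup>2 / 2" for x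
    by (simp_all add: k_def power_divide)
  have R: "(u\<^sup>2 + q\<^sup>2) * k\<^sup>2 = (1 - g * u * q * k) * k"
    unfolding kB[symmetric] by (simp add: power2_eq_square)
  note d = spray_y_def spray_b_def spray_y_u_def spray_y_q_def spray_b_u_def spray_b_q_def
  show tu: ?tu ?tq
    unfolding d B_def[symmetric] L_def[symmetric] Bk R kB
    by (simp_all add: algebra_simps power2_eq_square power3_eq_cube)
  have yu: "spray_y_u g u q = (L + u * q * k) / 2"
    unfolding d B_def[symmetric] L_def[symmetric] Bk R using B0
    by (simp add: k_def divide_simps) (simp add: B_def B_fun_def algebra_simps power2_eq_square)
  show ?P unfolding yu B_def[symmetric] L_def[symmetric] Bk by simp
  show ?U unfolding yu tu d(1) B_def[symmetric] L_def[symmetric] Bk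
    by (simp add: field_simps power2_eq_square)
  show ?Q
    unfolding d B_def[symmetric] L_def[symmetric] Bk R using B0
    by (simp add: k_def divide_simps) (simp add: B_def B_fun_def algebra_simps power2_eq_square power3_eq_cube)
  show ?V
    unfolding d B_def[symmetric] L_def[symmetric] Bk R kB using B0
    by (simp add: k_def divide_simps) (simp add: B_def B_fun_def algebra_simps power2_eq_square power3_eq_cube)
  show ?T
    unfolding tu B_def[symmetric] L_def[symmetric] using B0
    by (simp add: divide_simps) (simp add: B_def B_fun_def algebra_simps power2_eq_square power3_eq_cube)
qed

text \<open>The part without \<open>r\<close> is bilinear in the covector components, so it is enough to compare
  four scalar coefficients.\<close>

lemma cartan_derivative_identity:
  fixes g u q bi bj wi wj r :: real
  assumes g2: "\<bar>g\<bar> < 2" and q0: "0 < q"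
  defines "B \<equiv> B_fun g u q" and "\<Lambda> \<equiv> Lam g u q" and "s \<equiv> spray_y g u q"
    and "pI \<equiv> q * bi - u * wi" and "pJ \<equiv> q * bj - u * wj"
    and "sj \<equiv> spray_y_u g u q * bj + spray_y_q g u q * wj"
    and "ti \<equiv> spray_b_u g u q * bi + spray_b_q g u q * wi"
    and "tj \<equiv> spray_b_u g u q * bj + spray_b_q g u q * wj"
    and "T \<equiv> q * spray_b_u g u q - (u + g * q) * spray_b_q g u q"
  defines "ei \<equiv> \<Lambda> * pI + q * (E2 g u q * bi + E3 g u q * wi)"
    and "ej \<equiv> \<Lambda> * pJ + q * (E2 g u q * bj + E3 g u q * wj)"
    and "rr \<equiv> r + 2 / B * (pI * pJ)"
    and "X \<equiv> s * wj + q * sj" and "Y \<equiv> s * bj + u * sj + tj"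
  shows "bj * (\<Lambda> - u * q / B) / 2 * pI + (u / B * Y + (g * u + q) / B * X) * pI
      - (X * bi - Y * wi - u / q * s * r)
      - (bj * ei + bi * ej - q * (\<Lambda> * (r + E1 g u q * (bi * bj) + E2 g u q * (bi * wj + wi * bj) + E3 g u q * (wi * wj))
          + E1_dot g u q * (bi * bj) + E2_dot g u q * (bi * wj + wi * bj) + E3_dot g u q * (wi * wj))) / 2
      + g * (s * rr + 2 / B * (q * pJ * ti)) / 2 + g * (s * rr + 2 / B * (q * pI * tj)) / 2
      - (s * g + T * g * q / B) * rr / 2
    = (u * s / q + q * \<Lambda> / 2 + g * s / 2 - g * q * T / (2 * B)) * r"
proof -
  have B0: "B \<noteq> 0" using B_fun_pos[OF g2 q0, of u] by (simp add: B_def)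
  \<comment> \<open>An opaque inverse of \<open>B\<close> keeps the identity polynomial in the
    covector components; \<open>B\<close> is expanded only inside the scalar coefficients.\<close>
  define k where "k = 1 / B"
  have Bk: "x / B = x * k" "x / (2 * B) = x * k / 2" for x
    by (simp_all add: k_def power_divide)
  define U where "U = u * (\<Lambda> + u * q * k) / 2"
  define V where "V = - q * (\<Lambda> - u * q * k) / 2"
  define P where "P = q * (\<Lambda> + u * q * k) / 2"
  define Q where "Q = (\<Lambda> * (u + g * q) - q + q ^ 3 * k) / 2"
  define tu where "tu = spray_b_u g u q"
  define tq where "tq = spray_b_q g u q"
  have X: "X = P * bj + Q * wj"
    using spray_dw_u[OF g2 q0, of u] spray_dw_q[OF g2 q0, of u]
    unfolding X_def sj_def P_def Q_def s_def \<Lambda>_def B_def[symmetric] Bk by algebra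
  have Y: "Y = U * bj + V * wj"
    using spray_db_u[OF g2 q0, of u] spray_db_q[OF g2 q0, of u]
    unfolding Y_def sj_def tj_def U_def V_def s_def \<Lambda>_def B_def[symmetric] Bk by algebra
  have \<Phi>b: "u * k * U + (g * u + q) * k * P = (\<Lambda> + u * q * k) / 2"
    unfolding U_def P_def k_def using B0
    by (simp add: divide_simps) (simp add: B_def B_fun_def algebra_simps power2_eq_square)
  have \<Phi>w: "u * k * V + (g * u + q) * k * Q = g * (\<Lambda> - u * q * k) / 2"
    unfolding V_def Q_def k_def using B0
    by (simp add: divide_simps) (simp add: B_def B_fun_def algebra_simps power2_eq_square power3_eq_cube)
  have T: "T = (g * B * \<Lambda> - 2 * u\<^sup>2 - g * u * q) / 4"
    unfolding T_def B_def \<Lambda>_def by (rule spray_b_p[OF g2 q0])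
  define e1 e2 e3 d1 d2 d3 where "e1 = E1 g u q" and "e2 = E2 g u q" and "e3 = E3 g u q"
    and "d1 = E1_dot g u q" and "d2 = E2_dot g u q" and "d3 = E3_dot g u q"
  note folds = tu_def[symmetric] tq_def[symmetric]
    e1_def[symmetric] e2_def[symmetric] e3_def[symmetric] d1_def[symmetric] d2_def[symmetric] d3_def[symmetric]
  have t: "tu = (g * u * q\<^sup>2 * k - (2 * u + g * q) * \<Lambda>) / 4" "tq = (2 * u - g * u\<^sup>2 * q * k - (g * u + 2 * q) * \<Lambda>) / 4"
    unfolding tu_def tq_def \<Lambda>_def by (simp_all only: spray_b_u_alt[OF g2 q0] spray_b_q_alt[OF g2 q0] B_def[symmetric] Bk)
  note ex = T t U_def V_def P_def Q_def e1_def e2_def e3_def d1_def d2_def d3_def s_def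
      E1_def E2_def E3_def E1_dot_def E2_dot_def E3_dot_def spray_y_def
      B_def[symmetric] \<Lambda>_def[symmetric] k_def
  \<comment> \<open>The coefficient of \<open>bi * bj\<close> in the difference of the two sides;
    \<open>bw\<close>, \<open>wb\<close> and \<open>ww\<close> are those of \<open>bi * wj\<close>,
    \<open>wi * bj\<close> and \<open>wi * wj\<close>.\<close>
  have bb: "(\<Lambda> - u * q * k) / 2 * q + (\<Lambda> + u * q * k) / 2 * q
      - P - (2 * (\<Lambda> * q + q * e2) - q * (\<Lambda> * e1 + d1)) / 2
      + g * k * (s - T * q * k) * q\<^sup>2 + 2 * g * k * q\<^sup>2 * tu = 0"
    unfolding ex using B0
    by (simp add: divide_simps) (simp add: B_def B_fun_def power2_eq_square algebra_simps)
  have bw: "g * (\<Lambda> - u * q * k) / 2 * q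
      - Q - (q * e3 - \<Lambda> * u - q * (\<Lambda> * e2 + d2)) / 2
      - g * k * (s - T * q * k) * (q * u) + g * k * q * (q * tq - u * tu) = 0"
    unfolding ex using B0
    by (simp add: divide_simps) (simp add: B_def B_fun_def power2_eq_square power3_eq_cube algebra_simps)
  have wb: "U - (\<Lambda> - u * q * k) / 2 * u - (\<Lambda> + u * q * k) / 2 * u
      - (q * e3 - \<Lambda> * u - q * (\<Lambda> * e2 + d2)) / 2
      - g * k * (s - T * q * k) * (q * u) + g * k * q * (q * tq - u * tu) = 0"
    unfolding ex using B0
    by (simp add: divide_simps) (simp add: B_def B_fun_def power2_eq_square power3_eq_cube algebra_simps)
  have ww: "V - g * (\<Lambda> - u * q * k) / 2 * u
      + q * (\<Lambda> * e3 + d3) / 2 + g * k * (s - T * q * k) * u\<^sup>2 - 2 * g * k * q * u * tq = 0"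
    unfolding ex using B0
    by (simp add: divide_simps) (simp add: B_def B_fun_def power2_eq_square power3_eq_cube algebra_simps)
  have \<Phi>: "u * k * Y + (g * u + q) * k * X = (\<Lambda> + u * q * k) / 2 * bj + g * (\<Lambda> - u * q * k) / 2 * wj"
    unfolding X Y \<Phi>b[symmetric] \<Phi>w[symmetric] by (simp add: algebra_simps)
  define c1 c2 where "c1 = (\<Lambda> - u * q * k) / 2" and "c2 = (\<Lambda> + u * q * k) / 2"
  have c1: "x * (\<Lambda> - u * q * k) / 2 = x * c1" for x by (simp add: c1_def)
  note cs = c1 c1_def[symmetric] c2_def[symmetric]
  have "bj * (\<Lambda> - u * q * k) / 2 * pI + (u * k * Y + (g * u + q) * k * X) * pI
      - (X * bi - Y * wi - u / q * s * r)
      - (bj * ei + bi * ej - q * (\<Lambda> * (r + e1 * (bi * bj) + e2 * (bi * wj + wi * bj) + e3 * (wi * wj))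
          + d1 * (bi * bj) + d2 * (bi * wj + wi * bj) + d3 * (wi * wj))) / 2
      + g * (s * rr + 2 * k * (q * pJ * ti)) / 2 + g * (s * rr + 2 * k * (q * pI * tj)) / 2
      - (s * g + T * g * q * k) * rr / 2
    = (u / q * s + q * \<Lambda> / 2 + g * s / 2 - g * q * T * k / 2) * r
      + bi * bj * ((\<Lambda> - u * q * k) / 2 * q + (\<Lambda> + u * q * k) / 2 * q
      - P - (2 * (\<Lambda> * q + q * e2) - q * (\<Lambda> * e1 + d1)) / 2
      + g * k * (s - T * q * k) * q\<^sup>2 + 2 * g * k * q\<^sup>2 * tu)
      + bi * wj * (g * (\<Lambda> - u * q * k) / 2 * q
      - Q - (q * e3 - \<Lambda> * u - q * (\<Lambda> * e2 + d2)) / 2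
      - g * k * (s - T * q * k) * (q * u) + g * k * q * (q * tq - u * tu))
      + wi * bj * (U - (\<Lambda> - u * q * k) / 2 * u - (\<Lambda> + u * q * k) / 2 * u
      - (q * e3 - \<Lambda> * u - q * (\<Lambda> * e2 + d2)) / 2
      - g * k * (s - T * q * k) * (q * u) + g * k * q * (q * tq - u * tu))
      + wi * wj * (V - g * (\<Lambda> - u * q * k) / 2 * u
      + q * (\<Lambda> * e3 + d3) / 2 + g * k * (s - T * q * k) * u\<^sup>2 - 2 * g * k * q * u * tq)"
    unfolding \<Phi> ei_def ej_def rr_def ti_def tj_def folds cs Bk
    unfolding X Y pI_def pJ_def
    by (simp add: field_simps power2_eq_square)
  then show ?thesis
    unfolding bb bw wb ww folds Bk by simp
qed

lemma contr_swap1: "contr (\<lambda>i. contr f (\<lambda>l. M l i)) h = contr f (\<lambda>l. contr (\<lambda>i. M l i) h)"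
  unfolding contr_def sum_distrib_left sum_distrib_right
  by (subst sum.swap) (simp add: mult.assoc)

lemma contr_swap2: "contr (\<lambda>i. contr (\<lambda>l. M l i) f) h = contr (\<lambda>l. contr (\<lambda>i. M l i) h) f"
  using contr_swap1[of f M h] by (simp add: contr_commute[of _ f])

lemma contr_delta': "contr (\<lambda>k. if i = k then c else 0) f = c * f i"
  "contr f (\<lambda>k. if i = k then c else 0) = c * f i"
  by (simp_all add: eq_commute[of i] contr_delta)

lemma contr_zero: "contr f (\<lambda>l. 0) = 0"
  by (simp add: contr_def)

section \<open>Christoffel symbols, spray and connection coefficients at a point\<close>

context finsler_frame
begin

text \<open>\<open>Ga\<close> plays the role of the Christoffel symbols of \<open>a\<close>, and \<open>dg Ga \<mu> j n i\<close> that of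
  \<open>\<partial>g\<^sub>n\<^sub>i/\<partial>x\<^sup>j\<close>.\<close>

definition "n0 Ga l j = contr (Ga l j) yu"

definition "dg Ga \<mu> j n i = \<mu> * b j * gd n i + contr (\<lambda>l. Ga l j n) (\<lambda>l. gl l i)
   + contr (\<lambda>l. Ga l j i) (\<lambda>l. gl l n) + contr (\<lambda>l. n0 Ga l j) (\<lambda>l. Cc l n i)"

definition "gam Ga \<mu> n i j = (dg Ga \<mu> j n i + dg Ga \<mu> i n j - dg Ga \<mu> n j i) / 2"

text \<open>As for a Levi-Civita connection: because \<open>Ga\<close> is symmetric, the terms
  \<open>Ga\<close> times \<open>gl\<close> cancel in the cyclic sum except for the two equal ones
  in which \<open>Ga\<close> carries both \<open>i\<close> and \<open>j\<close>. The rest stems from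
  the charge and from the dependence of the metric on \<open>y\<close>.\<close>

lemma gam_eq:
  assumes "\<And>l i j. Ga l i j = Ga l j i"
  shows "gam Ga \<mu> n i j = \<mu> * (b j * gd n i + b i * gd n j - b n * gd j i) / 2
    + contr (\<lambda>l. Ga l i j) (\<lambda>l. gl l n)
    + (contr (\<lambda>l. n0 Ga l j) (\<lambda>l. Cc l n i) + contr (\<lambda>l. n0 Ga l i) (\<lambda>l. Cc l n j)
       - contr (\<lambda>l. n0 Ga l n) (\<lambda>l. Cc l j i)) / 2"
  unfolding gam_def dg_def assms[of _ j n] assms[of _ i n] assms[of _ j i]
  by (simp add: gd_sym[of j n] algebra_simps add_divide_distrib diff_divide_distrib)

lemma
  shows Cc_yu: "contr (\<lambda>i. Cc l n i) yu = 0" "contr (\<lambda>n. Cc l n i) yu = 0" "contr (\<lambda>l. Cc l n i) yu = 0"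
    and Cc_pu: "contr (\<lambda>n. Cc l n i) pu = g * rp l i"
    and Cc_pu1: "contr pu (\<lambda>l. Cc l i j) = g * rp i j"
    and Cc_bu1: "contr bu (\<lambda>l. Cc l i j) = J * g * q / B * rp i j"
    and Cc_yu1: "contr yu (\<lambda>l. Cc l i j) = 0"
proof -
  have s: "(\<lambda>n. Cc l n i) = Cc l i" "(\<lambda>l. Cc l n i) = Cc n i" for l i n
    using Cc_sym by (auto simp: fun_eq_iff)
  have "Cc l n i = Cc n i l" for l n i using Cc_sym by metis
  then show "contr (\<lambda>i. Cc l n i) yu = 0" "contr (\<lambda>n. Cc l n i) yu = 0" "contr (\<lambda>l. Cc l n i) yu = 0"
    "contr (\<lambda>n. Cc l n i) pu = g * rp l i" "contr pu (\<lambda>l. Cc l i j) = g * rp i j"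
    "contr bu (\<lambda>l. Cc l i j) = J * g * q / B * rp i j" "contr yu (\<lambda>l. Cc l i j) = 0"
    unfolding s by (simp_all add: Cc_contr contr_commute[of pu] contr_commute[of bu] contr_commute[of yu])
qed

abbreviation "gdy i \<equiv> contr (gd i) yu"

text \<open>The Cartan terms disappear because \<open>Cc\<close> is annihilated by \<open>y\<close>
  in every slot.\<close>

lemma gam_yy:
  assumes "\<And>l i j. Ga l i j = Ga l j i"
  shows "contr (\<lambda>i. contr (\<lambda>j. gam Ga \<mu> n i j) yu) yu
    = \<mu> * (2 * u * gdy n - b n * contr gdy yu) / 2 + contr (gl n) (\<lambda>l. contr (\<lambda>i. contr (Ga l i) yu) yu)"
proof -
  have s: "(\<lambda>l. gl l n) = gl n" "(\<lambda>i. gd i j) = gd j" for n j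
    using gl_sym gd_sym by (auto simp: fun_eq_iff)
  have swap: "contr (\<lambda>j. contr (\<lambda>l. Ga l i j) F) yu = contr (\<lambda>l. contr (Ga l i) yu) F"
    "contr (\<lambda>j. contr (\<lambda>l. n0 Ga l j) F) yu = contr (\<lambda>l. contr (n0 Ga l) yu) F" for i F
    by (rule contr_swap2)+
  have 1: "contr (\<lambda>j. gam Ga \<mu> n i j) yu = \<mu> * (u * gd n i + b i * gdy n - b n * gdy i) / 2
     + contr (\<lambda>l. contr (Ga l i) yu) (gl n)
     + contr (\<lambda>l. contr (n0 Ga l) yu) (\<lambda>l. Cc l n i) / 2" for i
    unfolding gam_eq[OF assms] contr_linear swap contr_swap1 Cc_yu contr_zero s
    by simp
  have 2: "contr (\<lambda>i. contr (\<lambda>l. contr (Ga l i) yu) F) yu = contr (\<lambda>l. contr (\<lambda>i. contr (Ga l i) yu) yu) F" for F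
    by (rule contr_swap2)
  show ?thesis
    unfolding 1 contr_linear 2 contr_swap1 Cc_yu contr_zero s
    by (simp add: contr_commute[of _ "gl n"])
qed

text \<open>The left-hand side is twice the spray, hence the factor 2 in front of \<mu>. The
  right-hand side is verified in lowered form by \<open>gu_raise\<close>.\<close>

lemma spray_eq:
  assumes "\<And>l i j. Ga l i j = Ga l j i"
  shows "contr (\<lambda>i. contr (\<lambda>j. contr (gu k) (\<lambda>n. gam Ga \<mu> n i j)) yu) yu
    = contr (\<lambda>i. contr (Ga k i) yu) yu + 2 * \<mu> * (spray_y g u q * yu k + spray_b g u q * bu k)"
proof -
  define S where "S k = contr (\<lambda>i. contr (Ga k i) yu) yu + 2 * \<mu> * (spray_y g u q * yu k + spray_b g u q * bu k)" for k
  have glb: "contr (gl n) bu = J * (E1 g u q * b n + E2 g u q * w n)" for n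
    by (simp add: gl_def[abs_def] metric_coeff_def contr_linear algebra_simps)
  have yy: "contr gdy yu = Lam g u q * (B * J) + J * q * u"
    unfolding gd_yu by (simp add: contr_linear)
  \<comment> \<open>Its components along \<open>b\<close> and \<open>w\<close> form a linear system
    whose solution is the pair \<open>spray_y\<close>, \<open>spray_b\<close>.\<close>
  have d: "spray_y g u q * yl n + spray_b g u q * (J * (E1 g u q * b n + E2 g u q * w n))
    = (2 * u * gdy n - b n * contr gdy yu) / 4" for n
    unfolding yy
    unfolding gd_yu yl_def spray_y_def spray_b_def E1_def E2_def
    by (simp add: divide_simps) (simp add: B_fun_def algebra_simps power2_eq_square)
  have "contr (\<lambda>i. contr (\<lambda>j. contr (gu k) (\<lambda>n. gam Ga \<mu> n i j)) yu) yu
    = contr (gu k) (\<lambda>n. contr (\<lambda>i. contr (\<lambda>j. gam Ga \<mu> n i j) yu) yu)"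
    by (simp only: contr_swap1)
  also have "\<dots> = S k"
  proof (rule gu_raise)
    fix n
    show "contr (gl n) S = contr (\<lambda>i. contr (\<lambda>j. gam Ga \<mu> n i j) yu) yu"
      unfolding gam_yy[OF assms] S_def[abs_def]
      using d[of n, THEN arg_cong, of "\<lambda>x. 2 * \<mu> * x"] by (simp add: contr_linear glb algebra_simps)
  qed
  finally show ?thesis unfolding S_def .
qed

definition "sy j = spray_y_u g u q * b j + spray_y_q g u q * w j"
definition "sb j = spray_b_u g u q * b j + spray_b_q g u q * w j"

text \<open>The derivative of \<open>\<mu> (spray_y y^k + spray_b b^k)\<close> in
  \<open>y^j\<close>, with \<open>sy\<close> and \<open>sb\<close> as the gradients of the two
  coefficients; \<open>Nn\<close> adds the Riemannian part and is the nonlinear connection.\<close>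

definition "Dn \<mu> k j = \<mu> * ((if k = j then spray_y g u q else 0) + yu k * sy j + bu k * sb j)"

definition "Nn Ga \<mu> k j = n0 Ga k j + Dn \<mu> k j"

definition "Cmix k n j = contr (gu k) (\<lambda>m. Cc n m j / 2)"

definition "Gam Ga \<mu> k i j = contr (gu k) (\<lambda>n. gam Ga \<mu> n i j)
   - contr (\<lambda>n. Nn Ga \<mu> n i) (\<lambda>n. Cmix k n j) - contr (\<lambda>n. Nn Ga \<mu> n j) (\<lambda>n. Cmix k n i)
   + contr (\<lambda>n. contr (gu k) (\<lambda>m. Nn Ga \<mu> n m)) (\<lambda>n. Cc n i j / 2)"

lemma gu_swap_p: "contr (\<lambda>k. contr (gu k) X) p = contr X pu"
proof -
  have s: "(\<lambda>k. gu k l) = gu l" for l by (auto simp: fun_eq_iff gu_sym)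
  have "contr (\<lambda>k. contr (gu k) X) p = contr (\<lambda>l. contr (\<lambda>k. gu k l) p) X"
    by (rule contr_swap2)
  then show ?thesis by (simp add: s contr_commute[of X])
qed

lemma Dn_contr:
  shows "contr (\<lambda>k. Dn \<mu> k j) (\<lambda>k. rp k i) = \<mu> * (spray_y g u q * rp j i + 2 / B * (q * p i * sb j))"
    and "contr (\<lambda>k. Dn \<mu> k j) b = \<mu> * (spray_y g u q * b j + u * sy j + sb j)"
    and "contr (\<lambda>k. Dn \<mu> k j) w = \<mu> * (spray_y g u q * w j + q * sy j)"
    and "contr (\<lambda>k. Dn \<mu> k j) (r i) = \<mu> * (spray_y g u q * r i j)"
    and "contr (\<lambda>n. contr (Dn \<mu> n) pu) (\<lambda>n. Cc n i j)
       = \<mu> * (spray_y g u q * g + (q * spray_b_u g u q - (u + g * q) * spray_b_q g u q) * g * q / B) * rp i j"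
proof -
  have y: "contr yu p = 0" "contr yu b = u" "contr yu w = q" "contr yu (r i) = 0" "contr bu p = q" for i
    by (simp_all add: contr_commute[of yu] contr_commute[of bu])
  have s: "contr yu (\<lambda>k. r k i) = 0" "contr bu (\<lambda>k. r k i) = 0" for i
    by (simp_all add: contr_commute[of yu])
  have "contr yu (\<lambda>k. rp k i) = 0" "contr bu (\<lambda>k. rp k i) = 2 / B * (q * p i)"
    unfolding rp_def by (simp_all add: contr_linear y s)
  then show "contr (\<lambda>k. Dn \<mu> k j) (\<lambda>k. rp k i) = \<mu> * (spray_y g u q * rp j i + 2 / B * (q * p i * sb j))"
    by (simp add: Dn_def contr_linear contr_delta)
  show "contr (\<lambda>k. Dn \<mu> k j) b = \<mu> * (spray_y g u q * b j + u * sy j + sb j)"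
    "contr (\<lambda>k. Dn \<mu> k j) w = \<mu> * (spray_y g u q * w j + q * sy j)"
    "contr (\<lambda>k. Dn \<mu> k j) (r i) = \<mu> * (spray_y g u q * r i j)"
    by (simp_all add: Dn_def contr_linear contr_delta y)
  have "contr (Dn \<mu> n) pu = \<mu> * (spray_y g u q * pu n + yu n * contr sy pu + bu n * contr sb pu)" for n
    unfolding Dn_def[abs_def] by (simp add: contr_linear contr_delta' algebra_simps)
  moreover have "contr sb pu = (q * spray_b_u g u q - (u + g * q) * spray_b_q g u q) / J"
    unfolding sb_def[abs_def] by (simp add: contr_linear field_simps)
  ultimately have 1: "contr (Dn \<mu> n) pu = \<mu> * (spray_y g u q * pu n + yu n * contr sy pu
      + bu n * ((q * spray_b_u g u q - (u + g * q) * spray_b_q g u q) / J))" for n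
    by (simp only:)
  show "contr (\<lambda>n. contr (Dn \<mu> n) pu) (\<lambda>n. Cc n i j)
       = \<mu> * (spray_y g u q * g + (q * spray_b_u g u q - (u + g * q) * spray_b_q g u q) * g * q / B) * rp i j"
    unfolding 1 contr_linear Cc_pu1 Cc_bu1 Cc_yu1 by (simp add: field_simps)
qed

text \<open>Contracting with \<open>p\<close> amounts to contracting the lowered symbols with
  \<open>pu\<close>, where the Cartan tensor reduces to \<open>g * rp\<close>. The parts with
  \<open>n0\<close> in \<open>gam\<close> cancel against those in \<open>Nn\<close>, so of the
  Riemannian connection only the genuine Christoffel term is left.\<close>

lemma Gam_p:
  assumes "\<And>l i j. Ga l i j = Ga l j i"
  shows "contr (\<lambda>k. Gam Ga \<mu> k i j) p = contr (\<lambda>l. Ga l i j) p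
    + \<mu> * (b j * ed i + b i * ed j - q / J * gd j i) / 2
    - g * contr (\<lambda>k. Dn \<mu> k i) (\<lambda>k. rp k j) / 2 - g * contr (\<lambda>k. Dn \<mu> k j) (\<lambda>k. rp k i) / 2
    + contr (\<lambda>n. contr (Dn \<mu> n) pu) (\<lambda>n. Cc n i j) / 2"
proof -
  have s: "(\<lambda>l. gl l n) = gl n" "(\<lambda>i. gd i j) = gd j" for n j
    using gl_sym gd_sym by (auto simp: fun_eq_iff)
  have g1: "contr (\<lambda>n. gam Ga \<mu> n i j) pu = \<mu> * (b j * ed i + b i * ed j - q / J * gd j i) / 2
     + contr (\<lambda>l. Ga l i j) p
     + (g * contr (\<lambda>l. n0 Ga l j) (\<lambda>l. rp l i) + g * contr (\<lambda>l. n0 Ga l i) (\<lambda>l. rp l j)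
       - contr (\<lambda>l. contr (n0 Ga l) pu) (\<lambda>l. Cc l j i)) / 2"
  proof -
    have s2: "contr (\<lambda>n. gl n l) pu = p l" for l
    proof -
      have e: "(\<lambda>n. gl n l) = gl l" by (auto simp: fun_eq_iff gl_sym)
      show ?thesis unfolding e by (rule gl_pu)
    qed
    have glp: "contr (\<lambda>n. contr (\<lambda>l. Ga l i j) (\<lambda>l. gl l n)) pu = contr (\<lambda>l. Ga l i j) p"
      by (simp only: contr_swap1 s2 gl_pu)
    have swap: "contr (\<lambda>n. contr (\<lambda>l. n0 Ga l n) F) pu = contr (\<lambda>l. contr (n0 Ga l) pu) F" for F
      by (rule contr_swap2)
    show ?thesis
      unfolding gam_eq[OF assms] contr_linear s
      unfolding glp[unfolded s] gd_pu swap contr_swap1 Cc_pu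
      by (simp add: contr_linear s2 field_simps)
  qed
  have C: "contr (\<lambda>k. contr f (\<lambda>n. Cmix k n j)) p = g * contr f (\<lambda>n. rp n j) / 2" for f j
    unfolding contr_swap1 Cmix_def gu_swap_p
    by (simp add: contr_linear Cc_pu)
  have N: "contr (\<lambda>k. contr (\<lambda>n. contr (gu k) (\<lambda>m. Nn Ga \<mu> n m)) (\<lambda>n. Cc n i j)) p
     = contr (\<lambda>n. contr (Nn Ga \<mu> n) pu) (\<lambda>n. Cc n i j)"
    by (subst contr_swap2) (simp add: gu_swap_p)
  show ?thesis
    unfolding Gam_def contr_linear gu_swap_p g1 C N
    unfolding Nn_def[abs_def] contr_linear Cc_sym(2)[of _ j i]
    by (simp add: field_simps)
qed

text \<open>The factor in \<open>A_k = \<phi> p_k\<close>: half of \<open>K = sqrt (B J)\<close>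
  times the trace in \<open>trace_Cc\<close>.\<close>

definition "\<phi> = real CARD('n) * sqrt (B * J) * g / (2 * B)"

text \<open>The derivative of \<open>\<phi> p_i\<close> in \<open>y^k\<close>; the first term is
  that of \<phi>, the second that of \<open>p_i\<close>.\<close>

definition "dA k i = \<phi> * (- (u / B * b k + (g * u + q) / B * w k) * p i + (w k * b i - b k * w i - u / q * r i k))"

definition "eta \<mu> = \<mu> * \<phi> / J * (u * spray_y g u q / q + q * Lam g u q / 2 + g * spray_y g u q / 2
     - g * q * (q * spray_b_u g u q - (u + g * q) * spray_b_q g u q) / (2 * B))"

text \<open>The left-hand side is \<open>A_i|j\<close> written out: its first three terms are the
  \<open>x\<close>-derivative of \<open>\<phi> p_i\<close>, through the charge, through the free
  index and through \<open>y\<close>. The last two of these cancel against the Riemannian parts of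
  \<open>Nn\<close> and \<open>Gam\<close>; what remains is
  \<open>cartan_derivative_identity\<close>.\<close>

lemma covariant_derivative:
  assumes sym: "\<And>l i j. Ga l i j = Ga l j i" and "g \<noteq> 0"
  shows "\<mu> * b j * \<phi> * (1 / g + (Lam g u q - u * q / B) / 2) * p i + \<phi> * contr (\<lambda>l. Ga l j i) p
       + contr (\<lambda>k. n0 Ga k j) (\<lambda>k. dA k i)
       - contr (\<lambda>k. Nn Ga \<mu> k j) (\<lambda>k. dA k i)
       - \<phi> * contr (\<lambda>k. Gam Ga \<mu> k i j) p
     = 1 / g * (\<mu> * b j) * (\<phi> * p i) + eta \<mu> * (J * r i j)"
proof -
  define D where "D = contr (\<lambda>k. Dn \<mu> k j) (\<lambda>k. dA k i)"
  define Y where "Y = spray_y g u q * b j + u * sy j + sb j"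
  define X where "X = spray_y g u q * w j + q * sy j"
  have D: "D = \<mu> * \<phi> * (- (u / B * Y + (g * u + q) / B * X) * p i + (X * b i - Y * w i - u / q * spray_y g u q * r i j))"
    unfolding D_def dA_def contr_linear Dn_contr X_def[symmetric] Y_def[symmetric]
    by (simp add: algebra_simps)
  have N: "contr (\<lambda>k. Nn Ga \<mu> k j) (\<lambda>k. dA k i) = contr (\<lambda>k. n0 Ga k j) (\<lambda>k. dA k i) + D"
    unfolding Nn_def D_def by (simp add: contr_linear)
  have gdJ: "q / J * gd j i = q * (Lam g u q * (r i j + E1 g u q * (b i * b j) + E2 g u q * (b i * w j + w i * b j)
          + E3 g u q * (w i * w j))
          + E1_dot g u q * (b i * b j) + E2_dot g u q * (b i * w j + w i * b j) + E3_dot g u q * (w i * w j))"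
    by (simp add: gd_def metric_dot_def metric_coeff_def r_sym[of j i] field_simps)
  have main: "b j * (Lam g u q - u * q / B) / 2 * p i + (u / B * Y + (g * u + q) / B * X) * p i
      - (X * b i - Y * w i - u / q * spray_y g u q * r i j)
      - (b j * ed i + b i * ed j - q / J * gd j i) / 2
      + g * (spray_y g u q * rp i j + 2 / B * (q * p j * sb i)) / 2
      + g * (spray_y g u q * rp i j + 2 / B * (q * p i * sb j)) / 2
      - (spray_y g u q * g + (q * spray_b_u g u q - (u + g * q) * spray_b_q g u q) * g * q / B) * rp i j / 2
    = (u * spray_y g u q / q + q * Lam g u q / 2 + g * spray_y g u q / 2
       - g * q * (q * spray_b_u g u q - (u + g * q) * spray_b_q g u q) / (2 * B)) * r i j"
    unfolding gdJ X_def Y_def rp_def ed_def sy_def sb_def p_def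
    by (rule cartan_derivative_identity[OF g2 q0])
  have rp: "rp j i = rp i j" by (simp add: rp_def r_sym[of j i] mult.commute)
  have G: "contr (\<lambda>k. Gam Ga \<mu> k i j) p - contr (\<lambda>l. Ga l j i) p
    = \<mu> * ((b j * ed i + b i * ed j - q / J * gd j i) / 2
      - g * (spray_y g u q * rp i j + 2 / B * (q * p j * sb i)) / 2
      - g * (spray_y g u q * rp i j + 2 / B * (q * p i * sb j)) / 2
      + (spray_y g u q * g + (q * spray_b_u g u q - (u + g * q) * spray_b_q g u q) * g * q / B) * rp i j / 2)"
    unfolding Gam_p[OF sym] Dn_contr sym[of _ j i] rp by (simp add: field_simps)
  \<comment> \<open>A regrouping with the large subterms as variables, so that they are not
    multiplied out.\<close>
  have comb: "a + \<mu> * \<phi> * c - \<mu> * \<phi> * (- Z * P + XY)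
      - \<phi> * (\<mu> * (E / 2 - g * W1 / 2 - g * W2 / 2 + K / 2))
    = a + \<mu> * \<phi> * (c + Z * P - XY - E / 2 + g * W1 / 2 + g * W2 / 2 - K / 2)" for a c Z P XY E W1 W2 K
    by (simp add: field_simps)
  have "\<mu> * b j * \<phi> * (1 / g + (Lam g u q - u * q / B) / 2) * p i + \<phi> * contr (\<lambda>l. Ga l j i) p
       + contr (\<lambda>k. n0 Ga k j) (\<lambda>k. dA k i)
       - contr (\<lambda>k. Nn Ga \<mu> k j) (\<lambda>k. dA k i)
       - \<phi> * contr (\<lambda>k. Gam Ga \<mu> k i j) p
     = 1 / g * (\<mu> * b j) * (\<phi> * p i) + \<mu> * \<phi> * (b j * (Lam g u q - u * q / B) / 2 * p i) - D
       - \<phi> * (contr (\<lambda>k. Gam Ga \<mu> k i j) p - contr (\<lambda>l. Ga l j i) p)"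
    unfolding N by (simp add: algebra_simps)
  also have "\<dots> = 1 / g * (\<mu> * b j) * (\<phi> * p i) + \<mu> * \<phi> * ((u * spray_y g u q / q + q * Lam g u q / 2 + g * spray_y g u q / 2
     - g * q * (q * spray_b_u g u q - (u + g * q) * spray_b_q g u q) / (2 * B)) * r i j)"
    by (simp only: G D comb main)
  finally show ?thesis unfolding eta_def by simp
qed

end

section \<open>Derivatives of the frame in a chart\<close>

lemma contr_deriv:
  assumes "\<And>k. ((\<lambda>t. f t k) has_real_derivative f' k) (at s)"
    and "\<And>k. ((\<lambda>t. h t k) has_real_derivative h' k) (at s)"
  shows "((\<lambda>t. contr (f t) (h t)) has_real_derivative contr f' (h s) + contr (f s) h') (at s)"
  unfolding contr_def sum.distrib[symmetric]
  by (rule DERIV_sum, rule DERIV_cong[OF DERIV_mult[OF assms]]) simp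

text \<open>\<open>n\<close> is the variation of the vector \<open>y\<close>, \<open>Lb\<close>, \<open>La\<close> and \<open>Lay\<close> that of the background.\<close>

lemma frame_deriv:
  fixes b ay :: "real \<Rightarrow> 'n::finite \<Rightarrow> real" and a :: "real \<Rightarrow> 'n \<Rightarrow> 'n \<Rightarrow> real" and n :: "'n \<Rightarrow> real"
  assumes b: "\<And>i. ((\<lambda>t. b t i) has_real_derivative Lb i) (at s)"
    and a: "\<And>i j. ((\<lambda>t. a t i j) has_real_derivative La i j) (at s)"
    and u: "(u has_real_derivative contr n (b s)) (at s)"
    and ay: "\<And>i. ((\<lambda>t. ay t i) has_real_derivative Lay i + contr n (a s i)) (at s)"
    and Q: "(Q has_real_derivative 2 * contr n (ay s)) (at s)"
    and pos: "0 < Q s - (u s)\<^sup>2"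
  defines "q \<equiv> \<lambda>t. sqrt (Q t - (u t)\<^sup>2)"
  defines "w \<equiv> \<lambda>t i. (ay t i - u t * b t i) / q t"
  defines "r \<equiv> \<lambda>t i j. a t i j - b t i * b t j - w t i * w t j"
  defines "Lw \<equiv> \<lambda>i. (Lay i - u s * Lb i) / q s"
  shows frame_deriv_q: "(q has_real_derivative contr n (w s)) (at s)"
    and frame_deriv_w: "((\<lambda>t. w t i) has_real_derivative Lw i + contr n (r s i) / q s) (at s)"
    and frame_deriv_r: "((\<lambda>t. r t i j) has_real_derivative
      (La i j - (Lb i * b s j + b s i * Lb j) - (Lw i * w s j + w s i * Lw j))
       - (w s i * contr n (r s j) + w s j * contr n (r s i)) / q s) (at s)"
proof -
  have q0: "0 < q s" using pos by (simp add: q_def)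
  have nw: "contr n (w s) = (contr n (ay s) - u s * contr n (b s)) / q s"
    unfolding w_def by (simp add: contr_linear)
  have nr: "contr n (r s i) = contr n (a s i) - b s i * contr n (b s) - w s i * contr n (w s)" for i
    unfolding r_def by (simp add: contr_linear)
  have "((\<lambda>t. Q t - (u t)\<^sup>2) has_real_derivative 2 * contr n (ay s) - 2 * u s * contr n (b s)) (at s)"
    by (rule DERIV_cong[OF DERIV_diff[OF Q DERIV_power[OF u, of 2]]]) simp
  from DERIV_chain2[OF DERIV_real_sqrt[OF pos] this]
  show dq: "(q has_real_derivative contr n (w s)) (at s)"
    unfolding q_def[abs_def] nw by (rule DERIV_cong) (simp add: q_def divide_simps)
  show dw: "((\<lambda>t. w t i) has_real_derivative Lw i + contr n (r s i) / q s) (at s)" for i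
  proof -
    have "((\<lambda>t. (ay t i - u t * b t i) / q t) has_real_derivative
      ((Lay i + contr n (a s i) - (contr n (b s) * b s i + Lb i * u s)) * q s
        - (ay s i - u s * b s i) * contr n (w s)) / (q s * q s)) (at s)"
      by (rule DERIV_divide[OF DERIV_diff[OF ay DERIV_mult[OF u b]] dq]) (use q0 in simp)
    moreover have "((Lay i + contr n (a s i) - (contr n (b s) * b s i + Lb i * u s)) * q s
        - (ay s i - u s * b s i) * contr n (w s)) / (q s * q s) = Lw i + contr n (r s i) / q s"
    proof -
      have wi: "ay s i - u s * b s i = w s i * q s" using q0 by (simp add: w_def)
      show ?thesis unfolding wi nr Lw_def using q0 by (simp add: field_simps)
    qed
    ultimately show ?thesis unfolding w_def by simp
  qed
  show "((\<lambda>t. r t i j) has_real_derivative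
      (La i j - (Lb i * b s j + b s i * Lb j) - (Lw i * w s j + w s i * Lw j))
       - (w s i * contr n (r s j) + w s j * contr n (r s i)) / q s) (at s)"
  proof -
    define R where "R i = contr n (r s i)" for i
    note dw = dw[folded R_def]
    show ?thesis
      unfolding R_def[symmetric] unfolding r_def
      by (rule DERIV_cong[OF DERIV_diff[OF DERIV_diff[OF a DERIV_mult[OF b b]] DERIV_mult[OF dw dw]]])
        (use q0 in \<open>simp add: field_simps\<close>)
  qed
qed

section \<open>Curve derivatives of the metric function, the Cartan vector and the lowered
  \<open>y\<close>\<close>

definition phi_fun :: "real \<Rightarrow> real \<Rightarrow> real \<Rightarrow> real \<Rightarrow> real" where
  "phi_fun N g u q = N * sqrt (B_fun g u q * J_fun g u q) * g / (2 * B_fun g u q)"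

text \<open>\<open>phi_fun\<close> is \<open>N g sqrt (J / B) / 2\<close>, so its derivative is best
  given logarithmically; the summand \<open>1 / \<gamma>\<close> is the source of
  \<open>g_j A_i / g\<close>.\<close>

lemma
  assumes \<gamma>: "(\<gamma> has_real_derivative \<gamma>') (at t)" and u: "(u has_real_derivative nb) (at t)"
    and q: "(q has_real_derivative nw) (at t)" and g2: "\<bar>\<gamma> t\<bar> < 2" and q0: "0 < q t"
  defines "B \<equiv> B_fun (\<gamma> t) (u t) (q t)" and "J \<equiv> J_fun (\<gamma> t) (u t) (q t)"
  shows K2_deriv: "((\<lambda>t. B_fun (\<gamma> t) (u t) (q t) * J_fun (\<gamma> t) (u t) (q t)) has_real_derivative
      B * J * (Lam (\<gamma> t) (u t) (q t) + u t * q t / B) * \<gamma>' + 2 * J * ((u t + \<gamma> t * q t) * nb + q t * nw)) (at t)" (is ?K)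
    and phi_deriv: "\<gamma> t \<noteq> 0 \<Longrightarrow> ((\<lambda>t. phi_fun N (\<gamma> t) (u t) (q t)) has_real_derivative
      phi_fun N (\<gamma> t) (u t) (q t) * ((1 / \<gamma> t + (Lam (\<gamma> t) (u t) (q t) - u t * q t / B) / 2) * \<gamma>'
        - (u t / B * nb + (\<gamma> t * u t + q t) / B * nw))) (at t)" (is "_ \<Longrightarrow> ?P")
proof -
  note dJ = J_fun_deriv[OF \<gamma> u q g2 q0]
  note dB = B_fun_deriv[OF \<gamma> u q g2 q0]
  have B: "0 < B" using B_fun_pos[OF g2 q0] by (simp add: B_def)
  have J: "0 < J" by (simp add: J_def J_fun_def)
  show K: ?K
    by (rule DERIV_cong[OF DERIV_mult[OF dB dJ]])
      (use B in \<open>simp add: divide_simps flip: B_def J_def\<close>, simp add: algebra_simps)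
  assume g0: "\<gamma> t \<noteq> 0"
  define k where "k = sqrt (B * J)"
  have k: "0 < k" "k * k = B * J" using B J by (simp_all add: k_def)
  have BJ: "0 < B_fun (\<gamma> t) (u t) (q t) * J_fun (\<gamma> t) (u t) (q t)" using B J by (simp add: B_def J_def)
  \<comment> \<open>Replacing \<open>J\<close> makes the derivative of the square root rational in
    \<open>k\<close>.\<close>
  have Jk: "J = k * k / B" using k(2) B by simp
  have N: "2 * B_fun (\<gamma> t) (u t) (q t) \<noteq> 0" using B by (simp add: B_def)
  define L where "L = Lam (\<gamma> t) (u t) (q t)"
  have dk: "((\<lambda>t. sqrt (B_fun (\<gamma> t) (u t) (q t) * J_fun (\<gamma> t) (u t) (q t))) has_real_derivative
      k * ((L + u t * q t / B) * \<gamma>' / 2 + ((u t + \<gamma> t * q t) * nb + q t * nw) / B)) (at t)"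
  proof (rule DERIV_cong[OF DERIV_chain2[OF DERIV_real_sqrt[OF BJ] K]], unfold B_def[symmetric] J_def[symmetric] k_def[symmetric] L_def[symmetric])
    show "inverse k / 2 * (B * J * (L + u t * q t / B) * \<gamma>' + 2 * J * ((u t + \<gamma> t * q t) * nb + q t * nw))
      = k * ((L + u t * q t / B) * \<gamma>' / 2 + ((u t + \<gamma> t * q t) * nb + q t * nw) / B)"
      unfolding Jk using k(1) B by (simp add: divide_simps) (simp add: algebra_simps)
  qed
  note D = DERIV_divide[OF DERIV_mult[OF DERIV_cmult[OF dk, of N] \<gamma>] DERIV_cmult[OF dB, of 2] N,
    folded B_def J_def, folded k_def]
  show ?P
    unfolding phi_fun_def
    apply (rule DERIV_cong[OF D])
    unfolding B_def[symmetric] J_def[symmetric] k_def[symmetric] L_def[symmetric]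
    using B g0
    apply (simp add: divide_simps)
    apply (simp add: algebra_simps)
    done
qed

lemma A_deriv:
  fixes N :: real
  assumes \<gamma>: "(\<gamma> has_real_derivative \<gamma>') (at t)" and u: "(u has_real_derivative nb) (at t)"
    and q: "(q has_real_derivative nw) (at t)"
    and b: "(b has_real_derivative b') (at t)" and w: "(w has_real_derivative w' + r / q t) (at t)"
    and g2: "\<bar>\<gamma> t\<bar> < 2" and q0: "0 < q t" and g0: "\<gamma> t \<noteq> 0"
  defines "B \<equiv> B_fun (\<gamma> t) (u t) (q t)" and "\<phi> \<equiv> phi_fun N (\<gamma> t) (u t) (q t)"
    and "pI \<equiv> q t * b t - u t * w t"
  shows "((\<lambda>t. phi_fun N (\<gamma> t) (u t) (q t) * (q t * b t - u t * w t)) has_real_derivative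
      \<gamma>' * \<phi> * (1 / \<gamma> t + (Lam (\<gamma> t) (u t) (q t) - u t * q t / B) / 2) * pI
      + \<phi> * (q t * b' - u t * w')
      + \<phi> * (- (u t / B * nb + (\<gamma> t * u t + q t) / B * nw) * pI + (nw * b t - nb * w t - u t / q t * r))) (at t)"
  apply (rule DERIV_cong[OF DERIV_mult[OF phi_deriv[OF \<gamma> u q g2 q0 g0] DERIV_diff[OF DERIV_mult[OF q b] DERIV_mult[OF u w]]]])
  unfolding \<phi>_def[symmetric] B_def[symmetric] pI_def[symmetric]
  by (simp add: algebra_simps)

text \<open>The lowered \<open>y\<close> is half the gradient of \<open>K^2\<close>, so its
  derivative in \<open>y\<close> is \<open>g_ij\<close>; this is where \<open>E1\<close>,
  \<open>E2\<close>, \<open>E3\<close> come from.\<close>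

lemma yl_deriv:
  assumes u: "(u has_real_derivative bi) (at t)"
    and q: "(q has_real_derivative wi) (at t)" and w: "(w has_real_derivative r / q t) (at t)"
    and g2: "\<bar>g\<bar> < 2" and q0: "0 < q t"
  shows "((\<lambda>t. J_fun g (u t) (q t) * ((u t + g * q t) * bj + q t * w t)) has_real_derivative
      metric_coeff g (u t) (q t) bi bj wi (w t) r) (at t)"
proof -
  define B where "B = B_fun g (u t) (q t)"
  have B: "B \<noteq> 0" using B_fun_pos[OF g2 q0, of "u t"] by (simp add: B_def)
  note dJ = J_fun_deriv[OF DERIV_const[of g] u q g2 q0]
  show ?thesis
    apply (rule DERIV_cong[OF DERIV_mult[OF dJ DERIV_add[OF DERIV_cmult_right[OF DERIV_add[OF u DERIV_cmult[OF q]]] DERIV_mult[OF q w]]]])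
    unfolding metric_coeff_def E1_alt[OF g2 q0] E2_alt[OF g2 q0] E3_alt[OF g2 q0] B_def[symmetric]
    using B q0
    apply (simp add: divide_simps)
    apply (simp add: B_def B_fun_def algebra_simps power2_eq_square)
    done
qed

text \<open>Gram-Schmidt for the pair \<open>b\<close>, \<open>y\<close>: \<open>w\<close> is the
  normalised part of the lowered \<open>y\<close> orthogonal to \<open>b\<close>, and
  \<open>wu\<close> is the same vector with its index raised, so \<open>r\<close> and
  \<open>ru\<close> vanish on the plane of both.\<close>

lemma finsler_frame_of_metric:
  fixes a ai :: "'n::finite \<Rightarrow> 'n \<Rightarrow> real" and b y :: "'n \<Rightarrow> real" and g q :: real
  defines "bu \<equiv> \<lambda>i. contr (ai i) b" and "ay \<equiv> \<lambda>i. contr (a i) y" and "u \<equiv> contr b y"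
  defines "w \<equiv> \<lambda>i. (ay i - u * b i) / q" and "wu \<equiv> \<lambda>i. (y i - u * bu i) / q"
  assumes sym: "\<And>i j. a i j = a j i" and sym': "\<And>i j. ai i j = ai j i"
    and inv: "\<And>i j. contr (a i) (\<lambda>k. ai k j) = (if i = j then 1 else 0)"
    and unit: "contr b bu = 1" and g2: "\<bar>g\<bar> < 2" and q0: "0 < q" and S: "contr ay y = u\<^sup>2 + q\<^sup>2"
  shows "finsler_frame g q b w bu wu (\<lambda>i j. a i j - b i * b j - w i * w j) (\<lambda>i j. ai i j - bu i * bu j - wu i * wu j)"
proof -
  have abu: "contr (a i) bu = b i" for i
    unfolding bu_def by (subst contr_swap) (simp add: inv contr_delta')
  have ayai: "contr ay (\<lambda>k. ai k j) = y j" for j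
  proof -
    have "contr ay (\<lambda>k. ai k j) = contr (\<lambda>k. ai k j) (\<lambda>k. contr (\<lambda>l. a k l) y)"
      by (simp add: contr_commute[of ay]) (simp add: ay_def)
    also have "\<dots> = contr (\<lambda>l. contr (a l) (\<lambda>k. ai k j)) y"
      by (subst contr_swap) (simp add: contr_commute[of "\<lambda>k. ai k j"] sym)
    finally show ?thesis by (simp add: inv contr_delta)
  qed
  have bai: "contr b (\<lambda>k. ai k j) = bu j" for j
    by (simp add: bu_def contr_commute[of b] sym'[of _ j])
  have aybu: "contr ay bu = u"
  proof -
    have "contr ay bu = contr (\<lambda>l. contr ay (\<lambda>k. ai k l)) b"
      unfolding bu_def by (rule contr_swap)
    then show ?thesis by (simp add: ayai u_def contr_commute[of y])
  qed
  have wE: "w = (\<lambda>i. (ay i - u * b i) / q)" and wuE: "wu = (\<lambda>i. (y i - u * bu i) / q)"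
    by (simp_all add: w_def wu_def)
  have by': "contr b y = u" by (simp add: u_def)
  have w_bu: "contr w bu = 0" unfolding wE by (simp add: contr_linear aybu unit)
  have b_wu: "contr b wu = 0" unfolding wuE by (simp add: contr_linear by' unit)
  have w_y: "contr w y = q"
    unfolding wE using q0 by (simp add: contr_linear S by') (simp add: field_simps power2_eq_square)
  have w_wu: "contr w wu = 1" unfolding wuE using q0 by (simp add: contr_linear w_y w_bu)
  have a_wu: "contr (a i) wu = w i" for i
    unfolding wuE by (simp add: contr_linear abu wE) (simp add: ay_def)
  have wai: "contr w (\<lambda>k. ai k j) = wu j" for j
    unfolding wE by (simp add: contr_linear ayai bai wuE)
  show ?thesis
  proof unfold_locales
    show "a i j - b i * b j - w i * w j = a j i - b j * b i - w j * w i"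
      "ai i j - bu i * bu j - wu i * wu j = ai j i - bu j * bu i - wu j * wu i" for i j
      by (simp_all add: sym[of i] sym'[of i] mult.commute)
  qed (simp_all add: g2 q0 unit b_wu w_bu w_wu contr_linear abu a_wu bai wai inv)
qed

section \<open>Partial derivatives along coordinate lines and inverse matrices\<close>

definition has_pd :: "'n::finite \<Rightarrow> (real^'n \<Rightarrow> real) \<Rightarrow> real \<Rightarrow> real^'n \<Rightarrow> bool" where
  "has_pd i f D x \<longleftrightarrow> ((\<lambda>t. f (x + t *\<^sub>R axis i 1)) has_real_derivative D) (at 0)"

lemma has_pd_pd: "has_pd i f D x \<Longrightarrow> pd i f x = D"
  unfolding has_pd_def pd_def by (rule DERIV_imp_deriv)

text \<open>Agreement on a short coordinate segment is enough, so closed formulas that hold only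
  where \<open>q > 0\<close> can be differentiated.\<close>

lemma has_pd_cong:
  assumes "\<forall>\<^sub>F t in nhds 0. f (x + t *\<^sub>R axis i 1) = h (x + t *\<^sub>R axis i 1)" "has_pd i h D x"
  shows "has_pd i f D x"
  using assms DERIV_cong_ev[OF refl assms(1) refl] unfolding has_pd_def by blast

lemma has_pd_pos:
  assumes "has_pd i f D x" "0 < f x"
  shows "\<forall>\<^sub>F t in nhds 0. 0 < f (x + t *\<^sub>R axis i 1)"
proof -
  have "isCont (\<lambda>t. f (x + t *\<^sub>R axis i 1)) 0"
    using assms(1) DERIV_isCont unfolding has_pd_def by blast
  then have "((\<lambda>t. f (x + t *\<^sub>R axis i 1)) \<longlongrightarrow> f (x + 0 *\<^sub>R axis i 1)) (nhds 0)"
    unfolding isCont_def by (rule tendsto_at_iff_tendsto_nhds[THEN iffD1])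
  then show ?thesis
    using assms(2) by (intro order_tendstoD(1)) auto
qed

lemma has_pd_component: "has_pd k (\<lambda>y. y $ i) (if i = k then 1 else 0) y"
  unfolding has_pd_def by (auto intro!: derivative_eq_intros simp: axis_def)

lemma eventually_in_open:
  fixes x :: "real^'n::finite"
  assumes "open U" "x \<in> U"
  shows "\<forall>\<^sub>F t in nhds 0. x + t *\<^sub>R axis i 1 \<in> U"
proof -
  have "((\<lambda>t. x + t *\<^sub>R axis i (1::real)) \<longlongrightarrow> x + 0 *\<^sub>R axis i 1) (nhds 0)"
    by (intro tendsto_intros filterlim_ident)
  then show ?thesis
    using assms by (auto dest!: topological_tendstoD)
qed

lemma matrix_inv_eqI:
  fixes A X :: "real^'n^'n"
  assumes "A ** X = mat 1"
  shows "matrix_inv A = X"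
proof -
  have XA: "X ** A = mat 1" using assms matrix_left_right_inverse by blast
  have "A ** matrix_inv A = mat 1 \<and> matrix_inv A ** A = mat 1"
    unfolding matrix_inv_def by (rule someI[where x = X]) (use assms XA in simp)
  then have "matrix_inv A = (X ** A) ** matrix_inv A" by (simp add: XA)
  also have "\<dots> = X" using \<open>_ \<and> _\<close> by (simp add: matrix_mul_assoc[symmetric])
  finally show ?thesis .
qed

lemma matrix_inv_eq_contr:
  fixes H X :: "'n::finite \<Rightarrow> 'n \<Rightarrow> real"
  assumes "\<And>i j. contr (H i) (\<lambda>k. X k j) = (if i = j then 1 else 0)"
  shows "matrix_inv (\<chi> i j. H i j) $ i $ j = X i j"
proof -
  have "(\<chi> i j. H i j) ** (\<chi> i j. X i j) = mat 1"
    using assms by (simp add: vec_eq_iff matrix_matrix_mult_def mat_def contr_def)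
  from matrix_inv_eqI[OF this] show ?thesis by simp
qed

lemma
  fixes A :: "real^'n::finite^'n"
  assumes sym: "\<And>i j. A $ i $ j = A $ j $ i"
    and pos: "\<And>y. y \<noteq> 0 \<Longrightarrow> 0 < (\<Sum>i\<in>UNIV. \<Sum>j\<in>UNIV. A $ i $ j * y $ i * y $ j)"
  shows matrix_inv_contr: "contr (\<lambda>k. A $ i $ k) (\<lambda>k. matrix_inv A $ k $ j) = (if i = j then 1 else 0)"
    and matrix_inv_sym: "matrix_inv A $ i $ j = matrix_inv A $ j $ i"
proof -
  have "y = 0" if "A *v y = 0" for y
  proof (rule ccontr)
    assume "y \<noteq> 0"
    have "(\<Sum>i\<in>UNIV. \<Sum>j\<in>UNIV. A $ i $ j * y $ i * y $ j) = (\<Sum>i\<in>UNIV. y $ i * (A *v y) $ i)"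
      by (simp add: matrix_vector_mult_def sum_distrib_left ac_simps)
    then show False using pos[OF \<open>y \<noteq> 0\<close>] that by simp
  qed
  then obtain X where X: "X ** A = mat 1"
    using matrix_left_invertible_ker by blast
  then have AX: "A ** X = mat 1" using matrix_left_right_inverse by blast
  have inv: "matrix_inv A = X" using AX by (rule matrix_inv_eqI)
  show "contr (\<lambda>k. A $ i $ k) (\<lambda>k. matrix_inv A $ k $ j) = (if i = j then 1 else 0)" for i j
    using AX unfolding inv by (simp add: vec_eq_iff matrix_matrix_mult_def mat_def contr_def)
  have "transpose A = A" using sym by (simp add: vec_eq_iff transpose_def)
  moreover have "transpose A ** transpose X = mat 1"
    using X by (metis matrix_transpose_mul transpose_mat)
  ultimately have "matrix_inv A = transpose X" by (simp add: matrix_inv_eqI)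
  then have "X = transpose X" by (simp add: inv)
  then show "matrix_inv A $ i $ j = matrix_inv A $ j $ i"
    unfolding inv by (metis transpose_def vec_lambda_beta)
qed

text \<open>\<open>Ga\<close> stands for the Christoffel symbols of \<open>a\<close>. All
  information on \<open>x\<close>-derivatives enters through \<open>da\<close> (the connection is
  metrical), \<open>db\<close> (\<open>b\<close> is parallel) and \<open>d\<gamma>\<close> (the
  space is involutive).\<close>

locale finsleroid_chart =
  fixes U :: "(real^'n::finite) set" and a :: "real^'n \<Rightarrow> real^'n^'n" and b :: "real^'n \<Rightarrow> real^'n"
    and \<gamma> \<mu> :: "real^'n \<Rightarrow> real" and Ga :: "real^'n \<Rightarrow> 'n \<Rightarrow> 'n \<Rightarrow> 'n \<Rightarrow> real"
  assumes open_U: "open U"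
    and a_sym: "x \<in> U \<Longrightarrow> a x $ i $ j = a x $ j $ i"
    and a_pos: "x \<in> U \<Longrightarrow> y \<noteq> 0 \<Longrightarrow> 0 < (\<Sum>i\<in>UNIV. \<Sum>j\<in>UNIV. a x $ i $ j * y $ i * y $ j)"
    and b_unit: "x \<in> U \<Longrightarrow> (\<Sum>i\<in>UNIV. \<Sum>j\<in>UNIV. matrix_inv (a x) $ i $ j * b x $ i * b x $ j) = 1"
    and \<gamma>2: "x \<in> U \<Longrightarrow> \<bar>\<gamma> x\<bar> < 2" and \<gamma>0: "x \<in> U \<Longrightarrow> \<gamma> x \<noteq> 0"
    and Ga_sym: "x \<in> U \<Longrightarrow> Ga x l i j = Ga x l j i"
    and da: "x \<in> U \<Longrightarrow> has_pd j (\<lambda>x. a x $ n $ i)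
      (contr (\<lambda>l. Ga x l j n) (\<lambda>l. a x $ l $ i) + contr (\<lambda>l. Ga x l j i) (\<lambda>l. a x $ l $ n)) x"
    and db: "x \<in> U \<Longrightarrow> has_pd j (\<lambda>x. b x $ i) (contr (\<lambda>l. Ga x l j i) (vec_nth (b x))) x"
    and d\<gamma>: "x \<in> U \<Longrightarrow> has_pd j \<gamma> (\<mu> x * b x $ j) x"
begin

definition "K x y = finsleroid_K (a x) (b x) (\<gamma> x) y"
definition "bu x i = contr (\<lambda>j. matrix_inv (a x) $ i $ j) (vec_nth (b x))"
definition "uu x y = contr (vec_nth (b x)) (vec_nth y)"
definition "ay x y i = contr (\<lambda>j. a x $ i $ j) (vec_nth y)"
definition "Qf x y = contr (ay x y) (vec_nth y)"
definition "qq x y = sqrt (Qf x y - (uu x y)\<^sup>2)"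
definition "ww x y i = (ay x y i - uu x y * b x $ i) / qq x y"
definition "wu x y i = (y $ i - uu x y * bu x i) / qq x y"
definition "rr x y i j = a x $ i $ j - b x $ i * b x $ j - ww x y i * ww x y j"
definition "ru x y i j = matrix_inv (a x) $ i $ j - bu x i * bu x j - wu x y i * wu x y j"

abbreviation "\<Omega> x y \<equiv> x \<in> U \<and> 0 < qq x y"

lemma uu_eq: "b_form (b x) y = uu x y"
  by (simp add: b_form_def uu_def contr_def)

lemma Qf_eq: "Qf x y = (\<Sum>i\<in>UNIV. \<Sum>j\<in>UNIV. a x $ i $ j * y $ i * y $ j)"
  by (simp add: Qf_def ay_def contr_def sum_distrib_right sum_distrib_left mult_ac)

lemma qq_eq:
  assumes "x \<in> U"
  shows "q_norm (a x) (b x) y = qq x y"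
proof -
  have "0 \<le> Qf x y"
    using a_pos[OF assms, of y] by (cases "y = 0") (auto simp: Qf_eq)
  then show ?thesis
    unfolding q_norm_def S_norm_def uu_eq Qf_eq[symmetric] qq_def by simp
qed

lemma Qf_pos: "0 < qq x y \<Longrightarrow> 0 < Qf x y - (uu x y)\<^sup>2"
  by (simp add: qq_def)

lemma frame:
  assumes "\<Omega> x y"
  shows "finsler_frame (\<gamma> x) (qq x y) (vec_nth (b x)) (ww x y) (bu x) (wu x y) (rr x y) (ru x y)"
proof -
  have x: "x \<in> U" and q: "0 < qq x y" using assms by auto
  have "contr (vec_nth (b x)) (\<lambda>i. contr (\<lambda>j. matrix_inv (a x) $ i $ j) (vec_nth (b x))) = 1"
    using b_unit[OF x] by (simp add: contr_def sum_distrib_left mult_ac)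
  moreover have "contr (\<lambda>i. contr (\<lambda>j. a x $ i $ j) (vec_nth y)) (vec_nth y)
      = (contr (vec_nth (b x)) (vec_nth y))\<^sup>2 + (qq x y)\<^sup>2"
    using Qf_pos[OF q] by (simp add: qq_def Qf_def ay_def[abs_def] uu_def)
  ultimately show ?thesis
    using finsler_frame_of_metric[where a = "\<lambda>i j. a x $ i $ j" and ai = "\<lambda>i j. matrix_inv (a x) $ i $ j"
        and b = "vec_nth (b x)" and y = "vec_nth y" and g = "\<gamma> x" and q = "qq x y"]
      a_sym[OF x] matrix_inv_contr[OF a_sym[OF x] a_pos[OF x]] matrix_inv_sym[OF a_sym[OF x] a_pos[OF x]]
      \<gamma>2[OF x] q
    unfolding bu_def[abs_def, symmetric] ww_def[abs_def] wu_def[abs_def] rr_def[abs_def] ru_def[abs_def] ay_def uu_def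
    by (simp add: bu_def[abs_def])
qed

text \<open>The instance of \<open>frame_deriv\<close> in which \<open>n\<close> is a coordinate
  vector and the background is fixed. The last claim serves to show that \<open>q > 0\<close>
  persists nearby.\<close>

lemma vertical:
  assumes "\<Omega> x y"
  shows "has_pd k (uu x) (b x $ k) y" and "has_pd k (qq x) (ww x y k) y"
    and "has_pd k (\<lambda>y. ww x y i) (rr x y i k / qq x y) y"
    and "has_pd k (\<lambda>y. rr x y i j) (0 - (ww x y i * rr x y j k + ww x y j * rr x y i k) / qq x y) y"
    and "has_pd k (\<lambda>y. Qf x y - (uu x y)\<^sup>2) (2 * ay x y k - 2 * uu x y * b x $ k) y"
proof -
  have x: "x \<in> U" and q: "0 < qq x y" using assms by auto
  define n where "n i = (if i = k then 1 else 0 :: real)" for i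
  define Y where "Y t = y + t *\<^sub>R axis k 1" for t :: real
  have Y0: "Y 0 = y" by (simp add: Y_def)
  have n: "contr n f = f k" for f unfolding n_def by (simp add: contr_delta)
  have dY: "((\<lambda>t. Y t $ i) has_real_derivative n i) (at 0)" for i
    using has_pd_component[of k i y] by (simp add: has_pd_def Y_def n_def)
  have lin: "((\<lambda>t. contr f (vec_nth (Y t))) has_real_derivative contr n f) (at 0)" for f
    using contr_deriv[OF DERIV_const[of "f _"] dY] by (simp add: contr_def mult.commute)
  have u: "((\<lambda>t. uu x (Y t)) has_real_derivative contr n (vec_nth (b x))) (at 0)"
    unfolding uu_def by (rule lin)
  have ay: "((\<lambda>t. ay x (Y t) i) has_real_derivative contr n (\<lambda>j. a x $ i $ j)) (at 0)" for i
    unfolding ay_def by (rule lin)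
  have Q: "((\<lambda>t. Qf x (Y t)) has_real_derivative 2 * contr n (ay x (Y 0))) (at 0)"
  proof -
    have "contr (\<lambda>i. contr n (\<lambda>j. a x $ i $ j)) (vec_nth y) + contr (ay x y) n = 2 * contr n (ay x y)"
      unfolding n contr_commute[of _ n] by (simp add: ay_def a_sym[OF x, of _ k])
    then show ?thesis
      unfolding Qf_def using contr_deriv[of "\<lambda>t. ay x (Y t)" _ 0 "\<lambda>t. vec_nth (Y t)", OF ay dY] by (simp add: Y0)
  qed
  have ay': "((\<lambda>t. ay x (Y t) i) has_real_derivative 0 + contr n (\<lambda>j. a x $ i $ j)) (at 0)" for i
    using ay by simp
  have pos: "0 < Qf x (Y 0) - (uu x (Y 0))\<^sup>2" using Qf_pos[OF q] by (simp add: Y0)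
  note fd = frame_deriv[where b = "\<lambda>_. vec_nth (b x)" and a = "\<lambda>_ i j. a x $ i $ j" and ay = "\<lambda>t. ay x (Y t)"
      and u = "\<lambda>t. uu x (Y t)" and Q = "\<lambda>t. Qf x (Y t)" and n = n and Lb = "\<lambda>_. 0" and La = "\<lambda>_ _. 0" and Lay = "\<lambda>_. 0" and s = 0,
      OF DERIV_const DERIV_const u ay' Q pos, folded qq_def, folded ww_def, folded rr_def]
  show "has_pd k (uu x) (b x $ k) y" using u unfolding has_pd_def Y_def n .
  show "has_pd k (qq x) (ww x y k) y" using fd(1) unfolding n has_pd_def by (simp add: Y0) (simp add: Y_def)
  show "has_pd k (\<lambda>y. ww x y i) (rr x y i k / qq x y) y"
    using fd(2)[of i] unfolding n has_pd_def by (simp add: Y0) (simp add: Y_def)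
  show "has_pd k (\<lambda>y. rr x y i j) (0 - (ww x y i * rr x y j k + ww x y j * rr x y i k) / qq x y) y"
    using fd(3)[of i j] unfolding n has_pd_def by (simp add: Y0) (simp add: Y_def)
  show "has_pd k (\<lambda>y. Qf x y - (uu x y)\<^sup>2) (2 * ay x y k - 2 * uu x y * b x $ k) y"
    using DERIV_diff[OF Q DERIV_power[OF u, of 2]] unfolding n has_pd_def by (simp add: Y0) (simp add: Y_def mult_ac)
qed

definition "N0 x y l j = contr (Ga x l j) (vec_nth y)"

text \<open>The instance of \<open>frame_deriv\<close> in which \<open>n\<close> is
  \<open>N0\<close>, the Christoffel symbols contracted with \<open>y\<close>: as \<open>a\<close>
  and \<open>b\<close> are parallel, \<open>u\<close> and \<open>q\<close> vary in \<open>x\<close>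
  as if \<open>y\<close> moved by \<open>N0\<close>, and the free indices contribute one term with
  \<open>Ga\<close> each.\<close>

lemma horizontal:
  assumes "\<Omega> x y"
  shows "has_pd j (\<lambda>x. uu x y) (contr (\<lambda>l. N0 x y l j) (vec_nth (b x))) x"
    and "has_pd j (\<lambda>x. qq x y) (contr (\<lambda>l. N0 x y l j) (ww x y)) x"
    and "has_pd j (\<lambda>x. ww x y i) (contr (\<lambda>l. Ga x l j i) (ww x y) + contr (\<lambda>l. N0 x y l j) (rr x y i) / qq x y) x"
    and "has_pd j (\<lambda>x. rr x y i m) (contr (\<lambda>l. Ga x l j i) (\<lambda>l. rr x y l m) + contr (\<lambda>l. Ga x l j m) (\<lambda>l. rr x y l i)
       - (ww x y i * contr (\<lambda>l. N0 x y l j) (rr x y m) + ww x y m * contr (\<lambda>l. N0 x y l j) (rr x y i)) / qq x y) x"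
    and "\<exists>D. has_pd j (\<lambda>x. Qf x y - (uu x y)\<^sup>2) D x"
proof -
  have x: "x \<in> U" and q: "0 < qq x y" using assms by auto
  define n where "n l = N0 x y l j" for l
  define X where "X t = x + t *\<^sub>R axis j 1" for t :: real
  have X0: "X 0 = x" by (simp add: X_def)
  define Lb where "Lb i = contr (\<lambda>l. Ga x l j i) (vec_nth (b x))" for i
  define La where "La i m = contr (\<lambda>l. Ga x l j i) (\<lambda>l. a x $ l $ m) + contr (\<lambda>l. Ga x l j m) (\<lambda>l. a x $ l $ i)" for i m
  define Lay where "Lay i = contr (\<lambda>l. Ga x l j i) (ay x y)" for i
  have b: "((\<lambda>t. b (X t) $ i) has_real_derivative Lb i) (at 0)" for i
    using db[OF x, of j i] by (simp add: has_pd_def X_def Lb_def)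
  have a: "((\<lambda>t. a (X t) $ i $ m) has_real_derivative La i m) (at 0)" for i m
    using da[OF x, of j i m] by (simp add: has_pd_def X_def La_def)
  \<comment> \<open>Moves the Christoffel symbol from the contracted covector to
    \<open>y\<close>.\<close>
  have sw: "contr (\<lambda>i. contr (\<lambda>l. Ga x l j i) f) (vec_nth y) = contr n f" for f
    unfolding n_def N0_def by (rule contr_swap2)
  have lin: "((\<lambda>t. contr (F t) (vec_nth y)) has_real_derivative contr F' (vec_nth y)) (at 0)"
    if "\<And>i. ((\<lambda>t. F t i) has_real_derivative F' i) (at 0)" for F F'
    using contr_deriv[of F F' 0, OF that DERIV_const[of "y $ _"]] by (simp add: contr_def)
  have u: "((\<lambda>t. uu (X t) y) has_real_derivative contr n (vec_nth (b (X 0)))) (at 0)"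
    using lin[of "\<lambda>t. vec_nth (b (X t))", OF b] unfolding uu_def Lb_def sw X0 .
  have ay: "((\<lambda>t. ay (X t) y i) has_real_derivative Lay i + contr n (\<lambda>m. a (X 0) $ i $ m)) (at 0)" for i
  proof -
    have "contr (La i) (vec_nth y) = contr (\<lambda>l. Ga x l j i) (ay x y) + contr n (\<lambda>l. a x $ l $ i)"
      unfolding La_def[abs_def] contr_linear sw ay_def[abs_def] contr_swap1 ..
    then show ?thesis
      using lin[of "\<lambda>t m. a (X t) $ i $ m", OF a] unfolding ay_def[symmetric] X0 Lay_def
      by (simp add: a_sym[OF x, of _ i])
  qed
  have Q: "((\<lambda>t. Qf (X t) y) has_real_derivative 2 * contr n (ay (X 0) y)) (at 0)"
  proof -
    have "contr (\<lambda>i. contr n (\<lambda>m. a x $ i $ m)) (vec_nth y) = contr n (ay x y)"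
      unfolding contr_swap1 by (simp add: ay_def[abs_def] a_sym[OF x, of _ _])
    then show ?thesis
      using lin[of "\<lambda>t. ay (X t) y", OF ay] unfolding Qf_def Lay_def X0 contr_linear sw by simp
  qed
  have pos: "0 < Qf (X 0) y - (uu (X 0) y)\<^sup>2" using Qf_pos[OF q] by (simp add: X0)
  note fd = frame_deriv[where b = "\<lambda>t. vec_nth (b (X t))" and a = "\<lambda>t i m. a (X t) $ i $ m" and ay = "\<lambda>t. ay (X t) y"
      and u = "\<lambda>t. uu (X t) y" and Q = "\<lambda>t. Qf (X t) y" and n = n and Lb = Lb and La = La and Lay = Lay and s = 0,
      OF b a u ay Q pos, folded qq_def, folded ww_def, folded rr_def, unfolded X0]
  have Lw: "(Lay i - uu x y * Lb i) / qq x y = contr (\<lambda>l. Ga x l j i) (ww x y)" for i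
    unfolding Lay_def Lb_def ww_def[abs_def] by (simp add: contr_linear)
  have Lr: "La i m - (Lb i * b x $ m + b x $ i * Lb m) - (contr (\<lambda>l. Ga x l j i) (ww x y) * ww x y m + ww x y i * contr (\<lambda>l. Ga x l j m) (ww x y))
     = contr (\<lambda>l. Ga x l j i) (\<lambda>l. rr x y l m) + contr (\<lambda>l. Ga x l j m) (\<lambda>l. rr x y l i)" for i m
    unfolding La_def Lb_def rr_def by (simp add: contr_linear)
  note fd' = fd[unfolded Lw Lr, unfolded X_def, folded has_pd_def]
  show "has_pd j (\<lambda>x. uu x y) (contr (\<lambda>l. N0 x y l j) (vec_nth (b x))) x"
    using u unfolding X0 unfolding has_pd_def X_def n_def .
  show "has_pd j (\<lambda>x. qq x y) (contr (\<lambda>l. N0 x y l j) (ww x y)) x"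
    "has_pd j (\<lambda>x. ww x y i) (contr (\<lambda>l. Ga x l j i) (ww x y) + contr (\<lambda>l. N0 x y l j) (rr x y i) / qq x y) x"
    "has_pd j (\<lambda>x. rr x y i m) (contr (\<lambda>l. Ga x l j i) (\<lambda>l. rr x y l m) + contr (\<lambda>l. Ga x l j m) (\<lambda>l. rr x y l i)
       - (ww x y i * contr (\<lambda>l. N0 x y l j) (rr x y m) + ww x y m * contr (\<lambda>l. N0 x y l j) (rr x y i)) / qq x y) x"
    using fd' unfolding has_pd_def n_def by auto
  show "\<exists>D. has_pd j (\<lambda>x. Qf x y - (uu x y)\<^sup>2) D x"
    using DERIV_diff[OF Q DERIV_power[OF u, of 2]] unfolding has_pd_def X_def by blast
qed

text \<open>The radicand of \<open>q\<close> is differentiable along the coordinate line, hence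
  continuous, so it stays positive.\<close>

lemma ev_vertical: "\<Omega> x y \<Longrightarrow> \<forall>\<^sub>F t in nhds 0. \<Omega> x (y + t *\<^sub>R axis k 1)"
  using has_pd_pos[OF vertical(5)[of x y k]] Qf_pos by (auto simp: qq_def)

lemma ev_horizontal:
  assumes "\<Omega> x y"
  shows "\<forall>\<^sub>F t in nhds 0. \<Omega> (x + t *\<^sub>R axis k 1) y"
proof -
  obtain D where "has_pd k (\<lambda>x. Qf x y - (uu x y)\<^sup>2) D x" using horizontal(5)[OF assms] by blast
  from has_pd_pos[OF this] Qf_pos assms
  have "\<forall>\<^sub>F t in nhds 0. 0 < qq (x + t *\<^sub>R axis k 1) y" by (simp add: qq_def)
  moreover have "\<forall>\<^sub>F t in nhds 0. x + t *\<^sub>R axis k 1 \<in> U"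
    using assms by (intro eventually_in_open[OF open_U]) auto
  ultimately show ?thesis by eventually_elim simp
qed

section \<open>The Finsler geometry of a chart\<close>

abbreviation "JJ x y \<equiv> J_fun (\<gamma> x) (uu x y) (qq x y)"
abbreviation "BB x y \<equiv> B_fun (\<gamma> x) (uu x y) (qq x y)"

lemma K_eq:
  assumes "\<Omega> x y"
  shows "K x y = sqrt (BB x y * JJ x y)"
proof -
  have "exp (- (1 / 2) * z) = sqrt (exp (- z))" for z :: real
  proof -
    have "exp (- z) = (exp (- (1 / 2) * z))\<^sup>2" by (simp add: power2_eq_square flip: exp_add)
    then show ?thesis by simp
  qed
  then have "exp (- (1 / 2) * G * f) = sqrt (exp (- G * f))" for G f :: real
    by (metis mult.assoc mult_minus_left)
  then show ?thesis
    using assms \<gamma>2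
    by (simp only: K_def finsleroid_K_def Let_def uu_eq qq_eq f_fun_eq J_fun_def real_sqrt_mult)
qed

lemma BJ_pos: "\<Omega> x y \<Longrightarrow> 0 < BB x y * JJ x y"
  using B_fun_pos[OF \<gamma>2] by (simp add: J_fun_def)

lemma K_pos: "\<Omega> x y \<Longrightarrow> 0 < K x y"
  using K_eq BJ_pos by simp

lemma K2_eq: "\<Omega> x y \<Longrightarrow> (K x y)\<^sup>2 = BB x y * JJ x y"
  using K_eq BJ_pos by (metis less_imp_le real_sqrt_pow2)

lemma dy_K2:
  assumes "\<Omega> x y"
  shows "dy j (\<lambda>x y. (K x y)\<^sup>2) x y
    = 2 * (JJ x y * ((uu x y + \<gamma> x * qq x y) * b x $ j + qq x y * ww x y j))"
proof -
  have x: "x \<in> U" and q: "0 < qq x y" using assms by auto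
  have ev: "\<forall>\<^sub>F t in nhds 0. (K x (y + t *\<^sub>R axis j 1))\<^sup>2
     = BB x (y + t *\<^sub>R axis j 1) * JJ x (y + t *\<^sub>R axis j 1)"
    using ev_vertical[OF assms] by eventually_elim (rule K2_eq)
  have "has_pd j (\<lambda>y. BB x y * JJ x y)
      (2 * JJ x y * ((uu x y + \<gamma> x * qq x y) * b x $ j + qq x y * ww x y j)) y"
    using K2_deriv[OF DERIV_const[of "\<gamma> x"] vertical(1,2)[OF assms, unfolded has_pd_def]] q \<gamma>2[OF x]
    unfolding has_pd_def by simp
  from has_pd_pd[OF has_pd_cong[OF ev this]] show ?thesis
    unfolding dy_def by simp
qed

lemma g_low_eq:
  assumes "\<Omega> x y"
  shows "g_low K i j x y = metric_coeff (\<gamma> x) (uu x y) (qq x y) (b x $ i) (b x $ j) (ww x y i) (ww x y j) (rr x y i j)"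
proof -
  have x: "x \<in> U" and q: "0 < qq x y" using assms by auto
  let ?Y = "\<lambda>y. JJ x y * ((uu x y + \<gamma> x * qq x y) * b x $ j + qq x y * ww x y j)"
  have ev: "\<forall>\<^sub>F t in nhds 0. dy j (\<lambda>x y. (K x y)\<^sup>2) x (y + t *\<^sub>R axis i 1) = 2 * ?Y (y + t *\<^sub>R axis i 1)"
    using ev_vertical[OF assms] by eventually_elim (rule dy_K2)
  have r: "rr x y j i = rr x y i j" by (simp add: rr_def a_sym[OF x, of j i])
  have w: "((\<lambda>t. ww x (y + t *\<^sub>R axis i 1) j) has_real_derivative rr x y i j / qq x (y + 0 *\<^sub>R axis i 1)) (at 0)"
    using vertical(3)[OF assms, of i j] by (simp add: has_pd_def r)
  have "has_pd i ?Y (metric_coeff (\<gamma> x) (uu x y) (qq x y) (b x $ i) (b x $ j) (ww x y i) (ww x y j) (rr x y i j)) y"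
    using yl_deriv[OF vertical(1,2)[OF assms, of i, unfolded has_pd_def] w, of "\<gamma> x" "b x $ j"] q \<gamma>2[OF x]
    unfolding has_pd_def by simp
  then have "has_pd i (\<lambda>y. 2 * ?Y y) (2 * metric_coeff (\<gamma> x) (uu x y) (qq x y) (b x $ i) (b x $ j) (ww x y i) (ww x y j) (rr x y i j)) y"
    unfolding has_pd_def by (rule DERIV_cmult)
  from has_pd_pd[OF has_pd_cong[OF ev this]] show ?thesis
    unfolding g_low_def dy_def[of i] by simp
qed

context
  fixes x y
  assumes \<Omega>: "\<Omega> x y"
begin

interpretation F: finsler_frame "\<gamma> x" "uu x y" "qq x y" "vec_nth (b x)" "ww x y" "bu x" "wu x y" "rr x y" "ru x y"
  using \<Omega> by (rule frame)

lemma xU: "x \<in> U" and q0: "0 < qq x y"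
  using \<Omega> by auto

lemma g2: "\<bar>\<gamma> x\<bar> < 2"
  using xU by (rule \<gamma>2)

lemma yu: "F.yu = vec_nth y"
  using q0 by (auto simp: F.yu_def wu_def fun_eq_iff)

lemma n0: "F.n0 (Ga x) = N0 x y"
  by (simp add: fun_eq_iff F.n0_def N0_def yu)

lemma g_low_F: "g_low K i j x y = F.gl i j"
  by (simp add: g_low_eq[OF \<Omega>] F.gl_def)

lemma g_up_F: "g_up K i j x y = F.gu i j"
  unfolding g_up_def g_low_F by (rule matrix_inv_eq_contr) (rule F.gl_gu)

lemma dy_g_low: "dy k (g_low K i j) x y = F.Cc k i j"
proof -
  have ev: "\<forall>\<^sub>F t in nhds 0. g_low K i j x (y + t *\<^sub>R axis k 1)
     = (\<lambda>y. metric_coeff (\<gamma> x) (uu x y) (qq x y) (b x $ i) (b x $ j) (ww x y i) (ww x y j) (rr x y i j)) (y + t *\<^sub>R axis k 1)"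
    using ev_vertical[OF \<Omega>] by eventually_elim (rule g_low_eq)
  note v = vertical[OF \<Omega>, of k, unfolded has_pd_def]
  have w: "((\<lambda>t. ww x (y + t *\<^sub>R axis k 1) i) has_real_derivative 0 + rr x y i k / qq x (y + 0 *\<^sub>R axis k 1)) (at 0)" for i
    using v(3)[of i] by simp
  have r: "((\<lambda>t. rr x (y + t *\<^sub>R axis k 1) i j) has_real_derivative
    0 - (ww x (y + 0 *\<^sub>R axis k 1) i * rr x y j k + ww x (y + 0 *\<^sub>R axis k 1) j * rr x y i k) / qq x (y + 0 *\<^sub>R axis k 1)) (at 0)"
    using v(4)[of i j] by simp
  have "has_pd k (\<lambda>y. metric_coeff (\<gamma> x) (uu x y) (qq x y) (b x $ i) (b x $ j) (ww x y i) (ww x y j) (rr x y i j)) (F.Cc k i j) y"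
    using metric_coeff_deriv[OF DERIV_const[of "\<gamma> x"] v(1,2) DERIV_const DERIV_const w w r] g2 q0
    unfolding has_pd_def by (simp add: F.Cc_def F.p_def)
  from has_pd_pd[OF has_pd_cong[OF ev this]] show ?thesis
    unfolding dy_def .
qed

lemma dx_g_low: "dx j (g_low K n i) x y = F.dg (Ga x) (\<mu> x) j n i"
proof -
  have ev: "\<forall>\<^sub>F t in nhds 0. g_low K n i (x + t *\<^sub>R axis j 1) y
     = (\<lambda>x. metric_coeff (\<gamma> x) (uu x y) (qq x y) (b x $ n) (b x $ i) (ww x y n) (ww x y i) (rr x y n i)) (x + t *\<^sub>R axis j 1)"
    using ev_horizontal[OF \<Omega>] by eventually_elim (rule g_low_eq)
  note h = horizontal[OF \<Omega>, of j, unfolded has_pd_def]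
  note db' = db[OF xU, of j, unfolded has_pd_def]
  have w: "((\<lambda>t. ww (x + t *\<^sub>R axis j 1) y i) has_real_derivative contr (\<lambda>l. Ga x l j i) (ww x y)
     + contr (\<lambda>l. N0 x y l j) (rr x y i) / qq (x + 0 *\<^sub>R axis j 1) y) (at 0)" for i
    using h(3)[of i] by simp
  have r: "((\<lambda>t. rr (x + t *\<^sub>R axis j 1) y n i) has_real_derivative
      contr (\<lambda>l. Ga x l j n) (\<lambda>l. rr x y l i) + contr (\<lambda>l. Ga x l j i) (\<lambda>l. rr x y l n)
      - (ww (x + 0 *\<^sub>R axis j 1) y n * contr (\<lambda>l. N0 x y l j) (rr x y i) + ww (x + 0 *\<^sub>R axis j 1) y i * contr (\<lambda>l. N0 x y l j) (rr x y n))
         / qq (x + 0 *\<^sub>R axis j 1) y) (at 0)"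
    using h(4)[of n i] by simp
  have C: "contr f (\<lambda>l. F.Cc l n i) = JJ x y * (\<gamma> x / BB x y * ((qq x y * contr f (vec_nth (b x)) - uu x y * contr f (ww x y)) * rr x y n i
       + F.p n * contr f (rr x y i) + F.p i * contr f (rr x y n)
       + 2 / BB x y * ((qq x y * contr f (vec_nth (b x)) - uu x y * contr f (ww x y)) * F.p n * F.p i)))" for f
  proof -
    have p: "contr f F.p = qq x y * contr f (vec_nth (b x)) - uu x y * contr f (ww x y)"
      unfolding F.p_def[abs_def] by (simp add: contr_linear)
    show ?thesis
      unfolding F.Cc_def p[symmetric]
      by (simp add: contr_linear algebra_simps)
  qed
  have G: "contr f (\<lambda>l. F.gl l i) = JJ x y * (contr f (\<lambda>l. rr x y l i)
      + E1 (\<gamma> x) (uu x y) (qq x y) * (contr f (vec_nth (b x)) * b x $ i)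
      + E2 (\<gamma> x) (uu x y) (qq x y) * (contr f (vec_nth (b x)) * ww x y i + contr f (ww x y) * b x $ i)
      + E3 (\<gamma> x) (uu x y) (qq x y) * (contr f (ww x y) * ww x y i))" for f i
    unfolding F.gl_def metric_coeff_def by (simp add: contr_linear algebra_simps)
  define D where "D = F.dg (Ga x) (\<mu> x) j n i"
  \<comment> \<open>\<open>dg\<close> in the grouping of \<open>metric_coeff_deriv\<close>: charge,
    free indices, variation of \<open>y\<close>.\<close>
  have D: "D = F.gd n i * (\<mu> x * b x $ j)
     + JJ x y * (contr (\<lambda>l. Ga x l j n) (\<lambda>l. rr x y l i) + contr (\<lambda>l. Ga x l j i) (\<lambda>l. rr x y l n)
         + E1 (\<gamma> x) (uu x y) (qq x y) * (contr (\<lambda>l. Ga x l j n) (vec_nth (b x)) * b x $ i + b x $ n * contr (\<lambda>l. Ga x l j i) (vec_nth (b x)))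
         + E2 (\<gamma> x) (uu x y) (qq x y) * (contr (\<lambda>l. Ga x l j n) (vec_nth (b x)) * ww x y i + b x $ n * contr (\<lambda>l. Ga x l j i) (ww x y)
            + contr (\<lambda>l. Ga x l j n) (ww x y) * b x $ i + ww x y n * contr (\<lambda>l. Ga x l j i) (vec_nth (b x)))
         + E3 (\<gamma> x) (uu x y) (qq x y) * (contr (\<lambda>l. Ga x l j n) (ww x y) * ww x y i + ww x y n * contr (\<lambda>l. Ga x l j i) (ww x y)))
     + contr (\<lambda>l. N0 x y l j) (\<lambda>l. F.Cc l n i)"
    unfolding D_def F.dg_def n0 G by (simp add: algebra_simps)
  have "has_pd j (\<lambda>x. metric_coeff (\<gamma> x) (uu x y) (qq x y) (b x $ n) (b x $ i) (ww x y n) (ww x y i) (rr x y n i)) D x"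
    using metric_coeff_deriv[OF d\<gamma>[OF xU, of j, unfolded has_pd_def] h(1,2) db' db' w w r] g2 q0
    unfolding has_pd_def D C F.gd_def F.p_def by simp
  from has_pd_pd[OF has_pd_cong[OF ev this]] show ?thesis
    unfolding dx_def D_def .
qed

lemma C_low_F: "C_low K n i j x y = F.Cc n i j / 2"
  and cartan_F: "cartan K n i j x y = K x y / 2 * F.Cc n i j"
proof -
  \<comment> \<open>In \<open>dy_g_low\<close> the differentiation index comes first, in
    \<open>cartan\<close> last; the total symmetry of \<open>Cc\<close> reconciles them.\<close>
  have "F.Cc j n i = F.Cc n i j" using F.Cc_sym by metis
  then show "cartan K n i j x y = K x y / 2 * F.Cc n i j"
    unfolding cartan_def dy_g_low by simp
  then show "C_low K n i j x y = F.Cc n i j / 2"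
    using K_pos[OF \<Omega>] by (simp add: C_low_def)
qed

lemma phi_F: "phi_fun (real CARD('n)) (\<gamma> x) (uu x y) (qq x y) = F.\<phi>"
  by (simp add: F.\<phi>_def phi_fun_def)

lemma A_low_F: "A_low K k x y = F.\<phi> * F.p k"
proof -
  have "A_low K k x y = K x y / 2 * contr (\<lambda>i. contr (F.gu i) (\<lambda>j. F.Cc i j k)) (\<lambda>_. 1)"
    unfolding A_low_def g_up_F cartan_F contr_def by (simp add: sum_distrib_left mult_ac)
  then show ?thesis
    unfolding F.trace_Cc K_eq[OF \<Omega>] F.\<phi>_def by simp
qed

lemma A_norm_F: "(\<Sum>n\<in>UNIV. A_low K n x y * A_up K n x y) = F.\<phi>\<^sup>2 * (BB x y / JJ x y)"
proof -
  have "A_up K n x y = F.\<phi> * F.pu n" for n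
    unfolding A_up_def A_low_F g_up_F
    using F.gu_p(1)[of n] by (simp add: contr_def mult_ac flip: sum_distrib_left)
  then have "(\<Sum>n\<in>UNIV. A_low K n x y * A_up K n x y) = F.\<phi>\<^sup>2 * contr F.p F.pu"
    unfolding A_low_F contr_def by (simp add: sum_distrib_left power2_eq_square mult_ac)
  then show ?thesis by simp
qed

text \<open>In \<open>gl_decomp\<close> the term with \<open>yl\<close> is \<open>l_i l_j\<close>,
  and the term with \<open>p\<close> is \<open>A_i A_j / (A_n A^n)\<close>, where the factor \<phi>
  cancels because it is nonzero; the third term remains.\<close>

lemma H_cal_F: "H_cal K i j x y = JJ x y * rr x y i j"
proof -
  have "l_low K i x y = F.yl i / K x y" for i
    using F.gl_yu[of i] unfolding l_low_def l_up_def g_low_F yu contr_def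
    by (simp flip: sum_divide_distrib)
  then have l: "l_low K i x y * l_low K j x y = F.yl i * F.yl j / (BB x y * JJ x y)"
    using K2_eq[OF \<Omega>] by (simp add: power2_eq_square)
  have "F.\<phi> \<noteq> 0"
    using \<gamma>0[OF xU] by (simp add: F.\<phi>_def)
  then have A: "A_low K i x y * A_low K j x y / (\<Sum>n\<in>UNIV. A_low K n x y * A_up K n x y)
     = JJ x y / BB x y * (F.p i * F.p j)"
    unfolding A_norm_F
    unfolding A_low_F by (simp add: field_simps power2_eq_square)
  show ?thesis
    unfolding H_cal_def h_ang_def l A g_low_F F.gl_decomp by simp
qed

lemma gamma_F_eq: "gamma_F K k i j x y = contr (F.gu k) (\<lambda>n. F.gam (Ga x) (\<mu> x) n i j)"
  unfolding gamma_F_def g_up_F dx_g_low F.gam_def contr_def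
  by (simp add: sum_distrib_left mult_ac)

lemma spray_F: "spray K k x y = contr (\<lambda>i. contr (Ga x k i) (vec_nth y)) (vec_nth y) / 2
   + \<mu> x * (spray_y (\<gamma> x) (uu x y) (qq x y) * y $ k + spray_b (\<gamma> x) (uu x y) (qq x y) * bu x k)"
proof -
  have "spray K k x y = 1 / 2 * contr (\<lambda>i. contr (\<lambda>j. contr (F.gu k) (\<lambda>n. F.gam (Ga x) (\<mu> x) n i j)) F.yu) F.yu"
    unfolding spray_def gamma_F_eq yu contr_def[of _ "vec_nth y"]
    by (simp add: sum_distrib_left sum_distrib_right mult_ac)
  then show ?thesis
    unfolding F.spray_eq[OF Ga_sym[OF xU]] unfolding yu by (simp add: field_simps)
qed

end

section \<open>Nonlinear connection and derivatives of the Cartan vector in coordinates\<close>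

lemma G_bar_eq:
  assumes \<Omega>: "\<Omega> x y"
  shows "G_bar K k j x y = finsler_frame.Nn (\<gamma> x) (uu x y) (qq x y) (vec_nth (b x)) (ww x y) (bu x) (wu x y) (Ga x) (\<mu> x) k j"
proof -
  interpret F: finsler_frame "\<gamma> x" "uu x y" "qq x y" "vec_nth (b x)" "ww x y" "bu x" "wu x y" "rr x y" "ru x y"
    using \<Omega> by (rule frame)
  note x = xU[OF \<Omega>]
  have ev: "\<forall>\<^sub>F t in nhds 0. spray K k x (y + t *\<^sub>R axis j 1) =
     (\<lambda>y. contr (\<lambda>i. contr (Ga x k i) (vec_nth y)) (vec_nth y) / 2
      + \<mu> x * (spray_y (\<gamma> x) (uu x y) (qq x y) * y $ k + spray_b (\<gamma> x) (uu x y) (qq x y) * bu x k)) (y + t *\<^sub>R axis j 1)"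
    using ev_vertical[OF \<Omega>] by eventually_elim (rule spray_F)
  define n where "n i = (if i = j then 1 else 0 :: real)" for i
  define Y where "Y t = y + t *\<^sub>R axis j 1" for t :: real
  have Y0: "Y 0 = y" by (simp add: Y_def)
  have n: "contr n f = f j" for f unfolding n_def by (simp add: contr_delta)
  have dY: "((\<lambda>t. Y t $ i) has_real_derivative n i) (at 0)" for i
    using has_pd_component[of j i y] by (simp add: has_pd_def Y_def n_def)
  have lin: "((\<lambda>t. contr f (vec_nth (Y t))) has_real_derivative contr n f) (at 0)" for f
    using contr_deriv[OF DERIV_const[of "f _"] dY] by (simp add: contr_def mult.commute)
  have G: "((\<lambda>t. contr (\<lambda>i. contr (Ga x k i) (vec_nth (Y t))) (vec_nth (Y t))) has_real_derivative
      2 * N0 x y k j) (at 0)"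
  proof (rule DERIV_cong[OF contr_deriv[of "\<lambda>t i. contr (Ga x k i) (vec_nth (Y t))" _ 0 "\<lambda>t. vec_nth (Y t)", OF lin dY]])
    show "contr (\<lambda>i. contr n (Ga x k i)) (vec_nth (Y 0)) + contr (\<lambda>i. contr (Ga x k i) (vec_nth (Y 0))) n
      = 2 * N0 x y k j"
      unfolding n contr_commute[of _ n] by (simp add: Y0 N0_def Ga_sym[OF x, of k _ j])
  qed
  note v = vertical(1,2)[OF \<Omega>, of j, unfolded has_pd_def, folded Y_def]
  have q: "0 < qq x (Y 0)" using \<Omega> by (simp add: Y0)
  note D = DERIV_add[OF DERIV_cdivide[OF G, of 2] DERIV_cmult[OF DERIV_add[OF
      DERIV_mult[OF spray_y_deriv[OF v g2[OF \<Omega>] q] dY[of k]]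
      DERIV_cmult_right[OF spray_b_deriv[OF v g2[OF \<Omega>] q], of "bu x k"]], of "\<mu> x"]]
  have "has_pd j (\<lambda>y. contr (\<lambda>i. contr (Ga x k i) (vec_nth y)) (vec_nth y) / 2
      + \<mu> x * (spray_y (\<gamma> x) (uu x y) (qq x y) * y $ k + spray_b (\<gamma> x) (uu x y) (qq x y) * bu x k)) (F.Nn (Ga x) (\<mu> x) k j) y"
    unfolding has_pd_def Y_def[symmetric]
    by (rule DERIV_cong[OF D])
      (simp add: F.Nn_def F.Dn_def F.sy_def F.sb_def n0[OF \<Omega>] yu[OF \<Omega>] Y0 n_def algebra_simps)
  from has_pd_pd[OF has_pd_cong[OF ev this]] show ?thesis
    unfolding G_bar_def dy_def .
qed

abbreviation "p_F x y \<equiv> finsler_frame.p (uu x y) (qq x y) (vec_nth (b x)) (ww x y)"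
abbreviation "dA_F x y \<equiv> finsler_frame.dA (\<gamma> x) (uu x y) (qq x y) (vec_nth (b x)) (ww x y) (rr x y)"

lemma
  assumes \<Omega>: "\<Omega> x y"
  shows dy_A_low: "dy k (A_low K i) x y = dA_F x y k i"
    and dx_A_low: "dx j (A_low K i) x y
      = \<mu> x * b x $ j * phi_fun (real CARD('n)) (\<gamma> x) (uu x y) (qq x y) * (1 / \<gamma> x
          + (Lam (\<gamma> x) (uu x y) (qq x y) - uu x y * qq x y / BB x y) / 2)
        * p_F x y i
      + phi_fun (real CARD('n)) (\<gamma> x) (uu x y) (qq x y) * contr (\<lambda>l. Ga x l j i) (p_F x y)
      + contr (\<lambda>l. N0 x y l j) (\<lambda>l. dA_F x y l i)"
proof -
  interpret F: finsler_frame "\<gamma> x" "uu x y" "qq x y" "vec_nth (b x)" "ww x y" "bu x" "wu x y" "rr x y" "ru x y"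
    using \<Omega> by (rule frame)
  note x = xU[OF \<Omega>]
  \<comment> \<open>Needed at all neighbouring points and not only at the fixed one, hence with a
    frame interpreted afresh at each of them.\<close>
  have A_eq: "A_low K i x y = phi_fun (real CARD('n)) (\<gamma> x) (uu x y) (qq x y) * (qq x y * b x $ i - uu x y * ww x y i)"
    if "\<Omega> x y" for x y
  proof -
    interpret F': finsler_frame "\<gamma> x" "uu x y" "qq x y" "vec_nth (b x)" "ww x y" "bu x" "wu x y" "rr x y" "ru x y"
      using that by (rule frame)
    show ?thesis unfolding A_low_F[OF that] phi_F[OF that] F'.p_def ..
  qed
  have ev: "\<forall>\<^sub>F t in nhds 0. A_low K i x (y + t *\<^sub>R axis k 1) =
     (\<lambda>y. phi_fun (real CARD('n)) (\<gamma> x) (uu x y) (qq x y) * (qq x y * b x $ i - uu x y * ww x y i)) (y + t *\<^sub>R axis k 1)"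
    using ev_vertical[OF \<Omega>] by eventually_elim (rule A_eq)
  note v = vertical[OF \<Omega>, of k, unfolded has_pd_def]
  have w: "((\<lambda>t. ww x (y + t *\<^sub>R axis k 1) i) has_real_derivative 0 + rr x y i k / qq x (y + 0 *\<^sub>R axis k 1)) (at 0)"
    using v(3)[of i] by simp
  have "has_pd k (\<lambda>y. phi_fun (real CARD('n)) (\<gamma> x) (uu x y) (qq x y) * (qq x y * b x $ i - uu x y * ww x y i)) (dA_F x y k i) y"
    using A_deriv[OF DERIV_const[of "\<gamma> x"] v(1,2) DERIV_const[of "b x $ i"] w, of "real CARD('n)"] g2[OF \<Omega>] q0[OF \<Omega>] \<gamma>0[OF x]
    unfolding has_pd_def F.dA_def F.p_def phi_F[OF \<Omega>, symmetric] by simp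
  from has_pd_pd[OF has_pd_cong[OF ev this]]
  show "dy k (A_low K i) x y = dA_F x y k i" unfolding dy_def .
  have ev: "\<forall>\<^sub>F t in nhds 0. A_low K i (x + t *\<^sub>R axis j 1) y =
     (\<lambda>x. phi_fun (real CARD('n)) (\<gamma> x) (uu x y) (qq x y) * (qq x y * b x $ i - uu x y * ww x y i)) (x + t *\<^sub>R axis j 1)"
    using ev_horizontal[OF \<Omega>] by eventually_elim (rule A_eq)
  note h = horizontal[OF \<Omega>, of j, unfolded has_pd_def]
  have w: "((\<lambda>t. ww (x + t *\<^sub>R axis j 1) y i) has_real_derivative contr (\<lambda>l. Ga x l j i) (ww x y)
     + contr (\<lambda>l. N0 x y l j) (rr x y i) / qq (x + 0 *\<^sub>R axis j 1) y) (at 0)"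
    using h(3)[of i] by simp
  have p: "contr f F.p = qq x y * contr f (vec_nth (b x)) - uu x y * contr f (ww x y)" for f
    unfolding F.p_def[abs_def] by (simp add: contr_linear)
  have dA: "contr f (\<lambda>l. dA_F x y l i) = F.\<phi> * (- (uu x y / BB x y * contr f (vec_nth (b x))
        + (\<gamma> x * uu x y + qq x y) / BB x y * contr f (ww x y)) * F.p i
      + (contr f (ww x y) * b x $ i - contr f (vec_nth (b x)) * ww x y i - uu x y / qq x y * contr f (rr x y i)))" for f
    unfolding F.dA_def contr_linear by (simp add: algebra_simps)
  have "has_pd j (\<lambda>x. phi_fun (real CARD('n)) (\<gamma> x) (uu x y) (qq x y) * (qq x y * b x $ i - uu x y * ww x y i))
     (\<mu> x * b x $ j * F.\<phi> * (1 / \<gamma> x + (Lam (\<gamma> x) (uu x y) (qq x y) - uu x y * qq x y / BB x y) / 2) * F.p i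
      + F.\<phi> * contr (\<lambda>l. Ga x l j i) F.p + contr (\<lambda>l. N0 x y l j) (\<lambda>l. dA_F x y l i)) x"
    using A_deriv[OF d\<gamma>[OF x, of j, unfolded has_pd_def] h(1,2) db[OF x, of j i, unfolded has_pd_def] w, of "real CARD('n)"]
      g2[OF \<Omega>] q0[OF \<Omega>] \<gamma>0[OF x]
    unfolding has_pd_def p dA unfolding F.p_def phi_F[OF \<Omega>, symmetric] by simp
  from has_pd_pd[OF has_pd_cong[OF ev this]]
  show "dx j (A_low K i) x y
      = \<mu> x * b x $ j * phi_fun (real CARD('n)) (\<gamma> x) (uu x y) (qq x y) * (1 / \<gamma> x
          + (Lam (\<gamma> x) (uu x y) (qq x y) - uu x y * qq x y / BB x y) / 2) * F.p i
      + phi_fun (real CARD('n)) (\<gamma> x) (uu x y) (qq x y) * contr (\<lambda>l. Ga x l j i) F.p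
      + contr (\<lambda>l. N0 x y l j) (\<lambda>l. dA_F x y l i)"
    unfolding dx_def phi_F[OF \<Omega>] .
qed

lemma A_special:
  assumes \<Omega>: "\<Omega> x y"
  shows "h_cov K (A_low K) i j x y = 1 / \<gamma> x * (\<mu> x * b x $ j) * A_low K i x y
     + finsler_frame.eta TYPE('n) (\<gamma> x) (uu x y) (qq x y) (\<mu> x) * H_cal K i j x y"
proof -
  interpret F: finsler_frame "\<gamma> x" "uu x y" "qq x y" "vec_nth (b x)" "ww x y" "bu x" "wu x y" "rr x y" "ru x y"
    using \<Omega> by (rule frame)
  note x = xU[OF \<Omega>]
  have "Gamma_F K k i j x y = F.Gam (Ga x) (\<mu> x) k i j" for k
    unfolding Gamma_F_def gamma_F_eq[OF \<Omega>] C_mix_def C_low_F[OF \<Omega>] G_bar_up_def G_bar_eq[OF \<Omega>]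
      g_up_F[OF \<Omega>] F.Gam_def F.Cmix_def contr_def ..
  then have "h_cov K (A_low K) i j x y = dx j (A_low K i) x y
     - contr (\<lambda>k. F.Nn (Ga x) (\<mu> x) k j) (\<lambda>k. F.dA k i) - F.\<phi> * contr (\<lambda>k. F.Gam (Ga x) (\<mu> x) k i j) F.p"
    unfolding h_cov_def G_bar_eq[OF \<Omega>] dy_A_low[OF \<Omega>] A_low_F[OF \<Omega>]
    by (simp add: contr_def sum_distrib_left mult_ac)
  also have "\<dots> = 1 / \<gamma> x * (\<mu> x * b x $ j) * (F.\<phi> * F.p i) + F.eta (\<mu> x) * (JJ x y * rr x y i j)"
    using F.covariant_derivative[where Ga = "Ga x", OF Ga_sym[OF x] \<gamma>0[OF x], of "\<mu> x" j i]
    unfolding dx_A_low[OF \<Omega>] phi_F[OF \<Omega>] n0[OF \<Omega>] .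
  finally show ?thesis
    unfolding H_cal_F[OF \<Omega>] A_low_F[OF \<Omega>] .
qed

end

section \<open>From the manifold to a chart\<close>

lemma Cinf_on_has_pd:
  assumes "open S" "x \<in> S" "Cinf_on S f"
  shows "has_pd i f (pd i f x) x"
proof -
  have "Ck_on (Suc 0) S f" using assms(3) by (simp add: Cinf_on_def)
  then have "f differentiable (at x)"
    using assms(1,2) by (simp add: differentiable_on_eq_differentiable_at)
  then obtain f' where f': "(f has_derivative f') (at x)"
    unfolding differentiable_def by blast
  have "((\<lambda>t. x + t *\<^sub>R axis i 1) has_derivative (\<lambda>t. t *\<^sub>R axis i 1)) (at (0::real))"
    by (auto intro!: derivative_eq_intros)
  from has_derivative_compose[OF this, of f f'] f'
  have "((\<lambda>t. f (x + t *\<^sub>R axis i 1)) has_derivative (\<lambda>t. f' (t *\<^sub>R axis i 1))) (at 0)"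
    by simp
  moreover have "f' (t *\<^sub>R axis i 1) = f' (axis i 1) * t" for t
    using has_derivative_linear[OF f'] by (simp add: linear_scale)
  ultimately have "((\<lambda>t. f (x + t *\<^sub>R axis i 1)) has_real_derivative f' (axis i 1)) (at 0)"
    unfolding has_field_derivative_def by simp
  then show ?thesis
    unfolding has_pd_def pd_def using DERIV_imp_deriv by metis
qed

lemma pd_cong:
  assumes "open S" "x \<in> S" "\<And>z. z \<in> S \<Longrightarrow> f z = h z" "has_pd i h D x"
  shows "pd i f x = D"
proof -
  have "\<forall>\<^sub>F t in nhds 0. f (x + t *\<^sub>R axis i 1) = h (x + t *\<^sub>R axis i 1)"
    using eventually_in_open[OF assms(1,2), of i] by eventually_elim (rule assms(3))
  from has_pd_pd[OF has_pd_cong[OF this assms(4)]] show ?thesis .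
qed

lemma finsleroid_chartI:
  fixes \<A> :: "('m::{t2_space,second_countable_topology}, 'n::finite) chart set"
  assumes sp: "finsleroid_space \<A> a b g" and g0: "\<forall>p. g p \<noteq> 0" and par: "b_parallel \<A> a b"
    and inv: "\<And>c x i. c \<in> \<A> \<Longrightarrow> x \<in> img c \<Longrightarrow> pd i (g \<circ> pt c) x = \<mu> (pt c x) * b c x $ i"
    and c: "c \<in> \<A>"
  shows "finsleroid_chart (img c) (a c) (b c) (g \<circ> pt c) (\<mu> \<circ> pt c) (\<lambda>x l i j. christoffel (a c) l i j x)"
proof
  show op: "open (img c)"
    using sp c by (auto simp: finsleroid_space_def smooth_atlas_def)
  have rm: "riemannian_metric \<A> a" using sp by (simp add: finsleroid_space_def)
  show sym: "a c x $ i $ j = a c x $ j $ i" if "x \<in> img c" for x i j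
    using rm c that unfolding riemannian_metric_def by blast
  show pos: "0 < (\<Sum>i\<in>UNIV. \<Sum>j\<in>UNIV. a c x $ i $ j * y $ i * y $ j)" if "x \<in> img c" "y \<noteq> 0" for x y
    using rm c that unfolding riemannian_metric_def by blast
  show "(\<Sum>i\<in>UNIV. \<Sum>j\<in>UNIV. matrix_inv (a c x) $ i $ j * b c x $ i * b c x $ j) = 1" if "x \<in> img c" for x
    using sp c that unfolding finsleroid_space_def unit_covector_def by blast
  show "\<bar>(g \<circ> pt c) x\<bar> < 2" for x
  proof -
    have "- 2 < g (pt c x) \<and> g (pt c x) < 2" using sp unfolding finsleroid_space_def by blast
    then show ?thesis by auto
  qed
  show "(g \<circ> pt c) x \<noteq> 0" for x using g0 by simp
  have a_pd: "has_pd k (\<lambda>x. a c x $ i $ j) (pd k (\<lambda>x. a c x $ i $ j) x) x" if "x \<in> img c" for x i j k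
    using rm c unfolding riemannian_metric_def by (intro Cinf_on_has_pd[OF op that]) blast
  have pd_sym: "pd k (\<lambda>x. a c x $ i $ j) x = pd k (\<lambda>x. a c x $ j $ i) x" if "x \<in> img c" for x i j k
    by (rule pd_cong[OF op that sym a_pd[OF that]])
  show "christoffel (a c) l i j x = christoffel (a c) l j i x" if "x \<in> img c" for x l i j
    unfolding christoffel_def by (simp add: pd_sym[OF that, of _ j i] add.commute)
  show "has_pd j (\<lambda>x. a c x $ n $ i)
      (contr (\<lambda>l. christoffel (a c) l j n x) (\<lambda>l. a c x $ l $ i)
       + contr (\<lambda>l. christoffel (a c) l j i x) (\<lambda>l. a c x $ l $ n)) x" if x: "x \<in> img c" for x j n i
  proof -
    \<comment> \<open>Twice the Christoffel symbol of the first kind. Lowering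
      \<open>christoffel\<close> returns \<open>P / 2\<close>, and the sum of two such symbols is
      the derivative of the metric, as \<open>da\<close> demands.\<close>
    define P where "P m j n = pd n (\<lambda>x. a c x $ m $ j) x + pd j (\<lambda>x. a c x $ m $ n) x - pd m (\<lambda>x. a c x $ n $ j) x" for m j n
    have low: "contr (\<lambda>l. christoffel (a c) l j n x) (\<lambda>l. a c x $ l $ i) = P i j n / 2" for j n i
    proof -
      have mi: "contr (\<lambda>l. a c x $ i $ l) (\<lambda>l. matrix_inv (a c x) $ l $ m) = (if i = m then 1 else 0)" for m
        by (rule matrix_inv_contr) (use sym[OF x] pos[OF x] in auto)
      have "contr (\<lambda>l. christoffel (a c) l j n x) (\<lambda>l. a c x $ l $ i)
        = contr (\<lambda>l. a c x $ l $ i) (\<lambda>l. contr (\<lambda>m. matrix_inv (a c x) $ l $ m) (\<lambda>m. P m j n)) / 2"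
        unfolding christoffel_def P_def[symmetric] contr_def[of "\<lambda>m. matrix_inv (a c x) $ _ $ m", symmetric]
        by (simp add: contr_linear contr_commute[of _ "\<lambda>l. a c x $ l $ i"])
      also have "\<dots> = contr (\<lambda>m. contr (\<lambda>l. a c x $ i $ l) (\<lambda>l. matrix_inv (a c x) $ l $ m)) (\<lambda>m. P m j n) / 2"
        by (subst contr_swap) (simp add: sym[OF x, of _ i])
      finally show ?thesis
        by (simp only: mi contr_delta' mult_1)
    qed
    have "contr (\<lambda>l. christoffel (a c) l j n x) (\<lambda>l. a c x $ l $ i)
       + contr (\<lambda>l. christoffel (a c) l j i x) (\<lambda>l. a c x $ l $ n) = pd j (\<lambda>x. a c x $ n $ i) x"
      unfolding low P_def
      by (simp add: pd_sym[OF x, of j i n] pd_sym[OF x, of n j i] pd_sym[OF x, of i j n] field_simps)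
    then show ?thesis using a_pd[OF x] by simp
  qed
  show "has_pd j (\<lambda>x. b c x $ i) (contr (\<lambda>l. christoffel (a c) l j i x) (vec_nth (b c x))) x"
    if x: "x \<in> img c" for x j i
  proof -
    have "Cinf_on (img c) (\<lambda>x. b c x $ i)"
      using sp c unfolding finsleroid_space_def smooth_covector_def by blast
    moreover have "levi_civita (a c) (b c) j i x = 0"
      using par c x unfolding b_parallel_def by blast
    ultimately show ?thesis
      using Cinf_on_has_pd[OF op x, of "\<lambda>x. b c x $ i" j] by (simp add: levi_civita_def contr_def)
  qed
  show "has_pd j (g \<circ> pt c) ((\<mu> \<circ> pt c) x * b c x $ j) x" if x: "x \<in> img c" for x j
  proof -
    have "Cinf_on (img c) (g \<circ> pt c)"
      using sp c unfolding finsleroid_space_def smooth_scalar_def by blast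
    from Cinf_on_has_pd[OF op x this, of j] show ?thesis
      by (simp add: inv[OF c x])
  qed
qed

text \<open>The transformation laws of \<open>a\<close> and \<open>b\<close> make
  \<open>b(y)\<close> and \<open>q(y)\<close> chart independent when \<open>y\<close> is transformed
  by the Jacobian; so is any function of these two numbers and the base point.\<close>

lemma tangent_scalarI:
  fixes \<A> :: "('m::{t2_space,second_countable_topology}, 'n::finite) chart set"
  assumes "smooth_atlas \<A>" "riemannian_metric \<A> a" "smooth_covector \<A> b"
  shows "tangent_scalar \<A> a b (\<lambda>c x y. \<eta> (pt c x) (b_form (b c x) y) (q_norm (a c x) (b c x) y))"
  unfolding tangent_scalar_def
proof (intro ballI allI impI)
  fix c d x y
  assume c: "c \<in> \<A>" and d: "d \<in> \<A>" and x: "x \<in> overlap c d"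
  define X where "X = trans_map c d x"
  define T where "T = trans_jac c d x"
  obtain p where p: "p \<in> fst c" "p \<in> fst d" "x = snd c p"
    using x by (auto simp: overlap_def)
  have pt: "pt e (snd e p) = p" if "e \<in> \<A>" "p \<in> fst e" for e
    using assms(1) that unfolding smooth_atlas_def homeomorphism_def by blast
  have pteq: "pt c x = pt d X"
    using pt[OF c p(1)] pt[OF d p(2)] by (simp add: X_def trans_map_def p(3))
  have b: "b c x $ i = (\<Sum>k\<in>UNIV. b d X $ k * T $ k $ i)" for i
    using assms(3) c d x unfolding smooth_covector_def X_def T_def by blast
  have a: "a c x $ i $ j = (\<Sum>k\<in>UNIV. \<Sum>l\<in>UNIV. a d X $ k $ l * T $ k $ i * T $ l $ j)" for i j
    using assms(2) c d x unfolding riemannian_metric_def X_def T_def by blast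
  have Ty: "(T *v y) $ k = (\<Sum>i\<in>UNIV. T $ k $ i * y $ i)" for k
    by (simp add: matrix_vector_mult_def)
  have u: "b_form (b c x) y = b_form (b d X) (T *v y)"
    unfolding b_form_def b Ty sum_distrib_left sum_distrib_right
    by (subst sum.swap) (simp add: mult_ac)
  have prod: "z * (\<Sum>i\<in>UNIV. f i) * (\<Sum>j\<in>UNIV. h j) = (\<Sum>i\<in>UNIV. \<Sum>j\<in>UNIV. z * f i * h j)"
    for z :: real and f h :: "'n \<Rightarrow> real"
    unfolding mult.assoc sum_product by (simp only: sum_distrib_left)
  have "(\<Sum>i\<in>UNIV. \<Sum>j\<in>UNIV. a c x $ i $ j * y $ i * y $ j)
      = (\<Sum>i\<in>UNIV. \<Sum>j\<in>UNIV. \<Sum>k\<in>UNIV. \<Sum>l\<in>UNIV. a d X $ k $ l * (T $ k $ i * y $ i) * (T $ l $ j * y $ j))"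
    unfolding a sum_distrib_right by (simp add: mult_ac)
  \<comment> \<open>The sums over \<open>i\<close> and \<open>j\<close> are moved innermost, where
    they factor into the components of \<open>T *v y\<close>.\<close>
  also have "\<dots> = (\<Sum>i\<in>UNIV. \<Sum>k\<in>UNIV. \<Sum>j\<in>UNIV. \<Sum>l\<in>UNIV. a d X $ k $ l * (T $ k $ i * y $ i) * (T $ l $ j * y $ j))"
    by (intro sum.cong refl sum.swap)
  also have "\<dots> = (\<Sum>k\<in>UNIV. \<Sum>i\<in>UNIV. \<Sum>j\<in>UNIV. \<Sum>l\<in>UNIV. a d X $ k $ l * (T $ k $ i * y $ i) * (T $ l $ j * y $ j))"
    by (rule sum.swap)
  also have "\<dots> = (\<Sum>k\<in>UNIV. \<Sum>i\<in>UNIV. \<Sum>l\<in>UNIV. \<Sum>j\<in>UNIV. a d X $ k $ l * (T $ k $ i * y $ i) * (T $ l $ j * y $ j))"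
    by (intro sum.cong refl sum.swap)
  also have "\<dots> = (\<Sum>k\<in>UNIV. \<Sum>l\<in>UNIV. \<Sum>i\<in>UNIV. \<Sum>j\<in>UNIV. a d X $ k $ l * (T $ k $ i * y $ i) * (T $ l $ j * y $ j))"
    by (intro sum.cong refl sum.swap)
  also have "\<dots> = (\<Sum>k\<in>UNIV. \<Sum>l\<in>UNIV. a d X $ k $ l * (T *v y) $ k * (T *v y) $ l)"
    unfolding Ty prod ..
  finally have "S_norm (a c x) y = S_norm (a d X) (T *v y)"
    by (simp add: S_norm_def)
  then show "\<eta> (pt c x) (b_form (b c x) y) (q_norm (a c x) (b c x) y)
      = \<eta> (pt d (trans_map c d x)) (b_form (b d (trans_map c d x)) (trans_jac c d x *v y))
          (q_norm (a d (trans_map c d x)) (b d (trans_map c d x)) (trans_jac c d x *v y))"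
    by (simp add: q_norm_def u pteq flip: X_def T_def)
qed

theorem theorem3p1:
  fixes \<A> :: "('m::{t2_space,second_countable_topology}, 'n::finite) chart set"
    and a :: "('m, 'n) chart \<Rightarrow> real^'n \<Rightarrow> real^'n^'n"
    and b :: "('m, 'n) chart \<Rightarrow> real^'n \<Rightarrow> real^'n"
    and g :: "'m \<Rightarrow> real"
  assumes "finsleroid_space \<A> a b g"
    and "\<forall>p. g p \<noteq> 0"
    and "involutive \<A> b g"
    and "b_parallel \<A> a b"
  shows "\<exists>\<eta>. tangent_scalar \<A> a b \<eta> \<and>
    (\<forall>c\<in>\<A>. \<forall>x\<in>img c. \<forall>y. q_norm (a c x) (b c x) y > 0 \<longrightarrow>
      (\<forall>i k. h_cov (K_chart a b g c) (A_low (K_chart a b g c)) i k x y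
        = 1 / g (pt c x) * pd k (g \<circ> pt c) x * A_low (K_chart a b g c) i x y
          + \<eta> c x y * H_cal (K_chart a b g c) i k x y))"
proof -
  obtain \<mu> where \<mu>: "\<And>c x i. c \<in> \<A> \<Longrightarrow> x \<in> img c \<Longrightarrow> pd i (g \<circ> pt c) x = \<mu> (pt c x) * b c x $ i"
    using assms(3) unfolding involutive_def by blast
  \<comment> \<open>\<open>eta\<close> sees the chart only through \<open>u\<close> and
    \<open>q\<close>, and \<mu> and \<open>g\<close> are functions on the manifold, so it is a
    tangent scalar. \<open>TYPE('n)\<close> supplies the dimension contained in the factor of
    \<open>A\<close>.\<close>
  define \<eta> where "\<eta> p u q = finsler_frame.eta TYPE('n) (g p) u q (\<mu> p)" for p u q
  have "tangent_scalar \<A> a b (\<lambda>c x y. \<eta> (pt c x) (b_form (b c x) y) (q_norm (a c x) (b c x) y))"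
    using assms(1) unfolding finsleroid_space_def by (intro tangent_scalarI) auto
  moreover have "h_cov (K_chart a b g c) (A_low (K_chart a b g c)) i k x y
        = 1 / g (pt c x) * pd k (g \<circ> pt c) x * A_low (K_chart a b g c) i x y
          + \<eta> (pt c x) (b_form (b c x) y) (q_norm (a c x) (b c x) y) * H_cal (K_chart a b g c) i k x y"
    if c: "c \<in> \<A>" and x: "x \<in> img c" and q: "q_norm (a c x) (b c x) y > 0" for c x y i k
  proof -
    interpret finsleroid_chart "img c" "a c" "b c" "g \<circ> pt c" "\<mu> \<circ> pt c" "\<lambda>x l i j. christoffel (a c) l i j x"
      using finsleroid_chartI[OF assms(1,2,4) \<mu> c] .
    have "K = K_chart a b g c"
      by (simp add: fun_eq_iff K_def K_chart_def)
    then show ?thesis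
      using A_special[of x y i k] x q \<mu>[OF c x, of k]
      by (simp add: \<eta>_def qq_eq[OF x] uu_eq)
  qed
  ultimately show ?thesis by blast
qed

end
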